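(* Let $\mathbb{G}$ be an H-type group with homogeneous dimension $Q$, let $X_1,\dots,X_m$ be the fixed orthonormal basis of its horizontal layer, and let $\Omega\subseteq\mathbb{G}$ be open. For every $0<\lambda\le\Lambda$ and $0<\delta\le2$, and for every matrix-valued function $A=(a_{ij})_{i,j=1}^m$ on $\Omega$ with smooth coefficients such that $A(x)\in M_m(\lambda,\Lambda)$ for all $x\in\Omega$ and $A$ satisfies the $\delta$-Landis condition in $\Omega$, the family $\mathcal{K}_\Omega^A$ satisfies the critical density property, with constants depending on $A$ only through $\lambda,\Lambda,\delta$. That is, there exist $0<\varepsilon<1$ and $c>0$, depending on $A$ only through $\lambda,\Lambda,\delta$, such that for every ball $B_{2R}(x_0)\subset\Omega$ and every $u\in\mathcal{K}_\Omega^A(B_{2R}(x_0))$ with $$|\{x\in B_R(x_0):u(x)\ge1\}|\ge\varepsilon\,|B_R(x_0)|,$$ we have $$\inf_{B_{R/2}(x_0)}u\ge c .$$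
   Context: H-type groups. An H-type algebra is a finite-dimensional real Lie algebra $(\mathfrak{g},[\cdot,\cdot])$ which can be endowed with an inner product $\langle\cdot,\cdot\rangle$ such that, with $\mathfrak{z}$ the center of $\mathfrak{g}$ and $\mathfrak{b}:=\mathfrak{z}^\perp$, one has $[\mathfrak{b},\mathfrak{b}]=\mathfrak{z}$, and such that for each $z\in\mathfrak{z}$ with $\langle z,z\rangle=1$ the map $J_z:\mathfrak{b}\to\mathfrak{b}$ defined by $\langle J_z(v),w\rangle=\langle z,[v,w]\rangle$ for all $w\in\mathfrak{b}$ is orthogonal. An H-type group is a simply connected Lie group whose Lie algebra (of left-invariant vector fields) is an H-type algebra. Such an inner product is fixed, and $\|q\|=\langle q,q\rangle^{1/2}$ for $q\in\mathfrak{g}$. Setting. $\mathbb{G}=(\mathbb{R}^N,\circ,\delta_\lambda)$ is a homogeneous Lie group which is an H-type group. Put $m=\dim\mathfrak{b}$, $n=\dim\mathfrak{z}$, $N=m+n$. It is a step-two Carnot group with stratification $\mathfrak{g}=\mathfrak{b}\oplus\mathfrak{z}$ ($\mathfrak{b}$ is the horizontal layer), dilations $\delta_\lambda(x_{(1)},x_{(2)})=(\lambda x_{(1)},\lambda^2x_{(2)})$ for $(x_{(1)},x_{(2)})\in\mathbb{R}^m\times\mathbb{R}^n$, and homogeneous dimension $Q=m+2n$. Fix an orthonormal basis $X_1,\dots,X_m$ of $\mathfrak{b}$ with respect to $\langle\cdot,\cdot\rangle$. $|\cdot|$ denotes Lebesgue measure on $\mathbb{R}^N$. Norm and balls. The exponential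 map $Exp:\mathfrak{g}\to\mathbb{G}$ is a global diffeomorphism; define $v:\mathbb{G}\to\mathfrak{b}$ and $z:\mathbb{G}\to\mathfrak{z}$ by $x=Exp(v(x)+z(x))$. Put $d(x)=(\|v(x)\|^4+16\|z(x)\|^2)^{1/4}$ and $d(\xi,x)=d(x^{-1}\circ\xi)$. The ball is $B_R(x_0)=\{\xi\in\mathbb{G}: d(x_0^{-1}\circ\xi)<R\}$. Operators. $M_m(\lambda,\Lambda)$ is the set of real symmetric $m\times m$ matrices $M$ with $\lambda\|\xi\|^2\le\langle M\xi,\xi\rangle\le\Lambda\|\xi\|^2$ for every $\xi\in\mathbb{R}^m$ (Euclidean inner product and norm). For $A=(a_{ij})$ as in the claim, $\mathcal{L}_A=\sum_{i,j=1}^m a_{ij}(x)X_iX_j$ for $x\in\Omega$. $\delta$-Landis condition: for all $x\in\Omega$, $$\mathrm{Tr}(A(x))+(Q+2-m)\max_{\|\xi\|=1}\langle A(x)\xi,\xi\rangle\le(Q+4-\delta)\min_{\|\xi\|=1}\langle A(x)\xi,\xi\rangle .$$ Function class. $\mathcal{K}_\Omega^A=\{u\in C^2(V,\mathbb{R}): V\subset\Omega \text{ (open)},\ u\ge0\text{ and }\mathcal{L}_Au\le0\text{ in }V\}$. For a set $W\subset\Omega$, $u\in\mathcal{K}_\Omega^A(W)$ means that $u\in\mathcal{K}_\Omega^A$ and the domain $V$ of $u$ contains $W$. *)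

theory Defs
  imports "HOL-Analysis.Analysis" "HOL-Library.Function_Algebras"
begin

text \<open>Vector fields on a Euclidean space are functions \<^typ>\<open>'e \<Rightarrow> 'e\<close>.  They form a real vector
  space under the pointwise operations, so that the library's \<^const>\<open>span\<close> and \<^const>\<open>subspace\<close>
  apply to them.\<close>

instantiation "fun" :: (type, real_vector) real_vector
begin
definition scaleR_fun_def: "c *\<^sub>R f = (\<lambda>x. c *\<^sub>R f x)"
instance
  by standard (simp_all add: scaleR_fun_def fun_eq_iff scaleR_add_right scaleR_add_left)
end

section \<open>Functions of class \<open>C\<^sup>k\<close> on an open set\<close>

text \<open>A function is \<open>C\<^sup>k\<^sup>+\<^sup>1\<close> on an open set if it is differentiable there and all its directional
  derivatives are \<open>C\<^sup>k\<close>.  Only meant for open \<open>S\<close>.\<close>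

primrec Ck_on :: "nat \<Rightarrow> 'a::euclidean_space set \<Rightarrow> ('a \<Rightarrow> 'b::real_normed_vector) \<Rightarrow> bool" where
  "Ck_on 0 S f \<longleftrightarrow> continuous_on S f"
| "Ck_on (Suc k) S f \<longleftrightarrow> (\<forall>x\<in>S. f differentiable (at x)) \<and>
     (\<forall>w. Ck_on k S (\<lambda>x. frechet_derivative f (at x) w))"

definition smooth_on :: "'a::euclidean_space set \<Rightarrow> ('a \<Rightarrow> 'b::real_normed_vector) \<Rightarrow> bool" where
  "smooth_on S f \<longleftrightarrow> (\<forall>k. Ck_on k S f)"

section \<open>H-type algebras\<close>

definition lie_algebra_on :: "'g::real_vector set \<Rightarrow> ('g \<Rightarrow> 'g \<Rightarrow> 'g) \<Rightarrow> bool" where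
  "lie_algebra_on g br \<longleftrightarrow>
     subspace g \<and> (\<exists>B. finite B \<and> span B = g) \<and>
     (\<forall>X\<in>g. \<forall>Y\<in>g. br X Y \<in> g) \<and>
     (\<forall>X\<in>g. \<forall>Y\<in>g. \<forall>W\<in>g. \<forall>a b. br (a *\<^sub>R X + b *\<^sub>R Y) W = a *\<^sub>R br X W + b *\<^sub>R br Y W) \<and>
     (\<forall>X\<in>g. \<forall>Y\<in>g. \<forall>W\<in>g. \<forall>a b. br W (a *\<^sub>R X + b *\<^sub>R Y) = a *\<^sub>R br W X + b *\<^sub>R br W Y) \<and>
     (\<forall>X\<in>g. br X X = 0) \<and>
     (\<forall>X\<in>g. \<forall>Y\<in>g. \<forall>W\<in>g. br X (br Y W) + br Y (br W X) + br W (br X Y) = 0)"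

definition inner_product_on :: "'g::real_vector set \<Rightarrow> ('g \<Rightarrow> 'g \<Rightarrow> real) \<Rightarrow> bool" where
  "inner_product_on g ip \<longleftrightarrow>
     (\<forall>X\<in>g. \<forall>Y\<in>g. ip X Y = ip Y X) \<and>
     (\<forall>X\<in>g. \<forall>Y\<in>g. \<forall>W\<in>g. \<forall>a b. ip (a *\<^sub>R X + b *\<^sub>R Y) W = a * ip X W + b * ip Y W) \<and>
     (\<forall>X\<in>g. X \<noteq> 0 \<longrightarrow> 0 < ip X X)"

definition lie_center :: "'g::real_vector set \<Rightarrow> ('g \<Rightarrow> 'g \<Rightarrow> 'g) \<Rightarrow> 'g set" where
  "lie_center g br = {Z\<in>g. \<forall>X\<in>g. br Z X = 0}"

definition center_perp ::
  "'g::real_vector set \<Rightarrow> ('g \<Rightarrow> 'g \<Rightarrow> 'g) \<Rightarrow> ('g \<Rightarrow> 'g \<Rightarrow> real) \<Rightarrow> 'g set" where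
  "center_perp g br ip = {X\<in>g. \<forall>Z\<in>lie_center g br. ip X Z = 0}"

definition J_map ::
  "'g::real_vector set \<Rightarrow> ('g \<Rightarrow> 'g \<Rightarrow> 'g) \<Rightarrow> ('g \<Rightarrow> 'g \<Rightarrow> real) \<Rightarrow> 'g \<Rightarrow> 'g \<Rightarrow> 'g" where
  "J_map g br ip Z V = (THE U. U \<in> center_perp g br ip \<and>
     (\<forall>W\<in>center_perp g br ip. ip U W = ip Z (br V W)))"

text \<open>\<open>H_type_algebra g br ip\<close>: the Lie algebra \<open>(g, br)\<close> is an H-type algebra, and \<open>ip\<close> is an inner
  product witnessing this.  The maps \<open>J\<^sub>Z\<close> are linear on a finite-dimensional space by construction,
  so that orthogonality amounts to preservation of the inner product.\<close>

definition H_type_algebra ::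
  "'g::real_vector set \<Rightarrow> ('g \<Rightarrow> 'g \<Rightarrow> 'g) \<Rightarrow> ('g \<Rightarrow> 'g \<Rightarrow> real) \<Rightarrow> bool" where
  "H_type_algebra g br ip \<longleftrightarrow>
     lie_algebra_on g br \<and> inner_product_on g ip \<and>
     span {br V W | V W. V \<in> center_perp g br ip \<and> W \<in> center_perp g br ip} = lie_center g br \<and>
     (\<forall>Z\<in>lie_center g br. ip Z Z = 1 \<longrightarrow>
        (\<forall>V\<in>center_perp g br ip. \<forall>W\<in>center_perp g br ip.
           ip (J_map g br ip Z V) (J_map g br ip Z W) = ip V W))"

section \<open>Homogeneous Lie groups on \<open>\<real>\<^sup>m \<times> \<real>\<^sup>n\<close>\<close>

type_synonym ('m, 'n) pt = "(real ^ 'm) \<times> (real ^ 'n)"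
type_synonym ('m, 'n) vf = "('m, 'n) pt \<Rightarrow> ('m, 'n) pt"

definition dil :: "real \<Rightarrow> ('m::finite, 'n::finite) pt \<Rightarrow> ('m, 'n) pt" where
  "dil r p = (r *\<^sub>R fst p, r\<^sup>2 *\<^sub>R snd p)"

text \<open>Every identity element is fixed by all the automorphisms \<^term>\<open>dil r\<close>, \<open>r > 0\<close>, and hence is
  the origin.\<close>

definition homogeneous_lie_group ::
  "(('m::finite, 'n::finite) pt \<Rightarrow> ('m, 'n) pt \<Rightarrow> ('m, 'n) pt) \<Rightarrow>
   (('m, 'n) pt \<Rightarrow> ('m, 'n) pt) \<Rightarrow> bool" where
  "homogeneous_lie_group mul ginv \<longleftrightarrow>
     group mul 0 ginv \<and>
     smooth_on UNIV (\<lambda>(x, y). mul x y) \<and> smooth_on UNIV ginv \<and>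
     (\<forall>r>0. \<forall>x y. dil r (mul x y) = mul (dil r x) (dil r y))"

definition left_invariant_fields ::
  "('e::euclidean_space \<Rightarrow> 'e \<Rightarrow> 'e) \<Rightarrow> ('e \<Rightarrow> 'e) set" where
  "left_invariant_fields mul = {X. smooth_on UNIV X \<and>
     (\<forall>x y. frechet_derivative (mul x) (at y) (X y) = X (mul x y))}"

text \<open>The vector field of the derivation \<open>XY - YX\<close>.\<close>

definition vf_bracket :: "('e::euclidean_space \<Rightarrow> 'e) \<Rightarrow> ('e \<Rightarrow> 'e) \<Rightarrow> 'e \<Rightarrow> 'e" where
  "vf_bracket X Y = (\<lambda>p. frechet_derivative Y (at p) (X p) - frechet_derivative X (at p) (Y p))"

definition vf_apply ::
  "('e::euclidean_space \<Rightarrow> 'e) \<Rightarrow> ('e \<Rightarrow> real) \<Rightarrow> 'e \<Rightarrow> real" where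
  "vf_apply X u = (\<lambda>p. frechet_derivative u (at p) (X p))"

definition Exp :: "('e::euclidean_space \<Rightarrow> 'e) \<Rightarrow> 'e" where
  "Exp X = (THE p. \<exists>\<gamma>::real \<Rightarrow> 'e. \<gamma> 0 = 0 \<and>
     (\<forall>t. (\<gamma> has_vector_derivative X (\<gamma> t)) (at t)) \<and> \<gamma> 1 = p)"

text \<open>Homogeneity of degree \<open>k\<close> with respect to the dilations: \<open>X(u \<circ> \<delta>\<^sub>r) = r\<^sup>k (Xu) \<circ> \<delta>\<^sub>r\<close>, written
  for the components of the field (\<^term>\<open>dil r\<close> is its own derivative).\<close>

definition dil_homogeneous :: "nat \<Rightarrow> ('m::finite, 'n::finite) vf \<Rightarrow> bool" where
  "dil_homogeneous k X \<longleftrightarrow> (\<forall>r>0. \<forall>p. dil r (X p) = r ^ k *\<^sub>R X (dil r p))"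

definition vertical_layer ::
  "(('m::finite, 'n::finite) pt \<Rightarrow> ('m, 'n) pt \<Rightarrow> ('m, 'n) pt) \<Rightarrow> ('m, 'n) vf set" where
  "vertical_layer mul = lie_center (left_invariant_fields mul) vf_bracket"

definition horizontal_layer ::
  "(('m::finite, 'n::finite) pt \<Rightarrow> ('m, 'n) pt \<Rightarrow> ('m, 'n) pt) \<Rightarrow>
   (('m, 'n) vf \<Rightarrow> ('m, 'n) vf \<Rightarrow> real) \<Rightarrow> ('m, 'n) vf set" where
  "horizontal_layer mul ip = center_perp (left_invariant_fields mul) vf_bracket ip"

text \<open>The last two conditions say that the stratification \<open>b \<oplus> z\<close> of the Lie algebra is the one
  belonging to the dilations; in particular \<open>dim b = m\<close> and \<open>dim z = n\<close>.\<close>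

definition H_type_group ::
  "(('m::finite, 'n::finite) pt \<Rightarrow> ('m, 'n) pt \<Rightarrow> ('m, 'n) pt) \<Rightarrow>
   (('m, 'n) pt \<Rightarrow> ('m, 'n) pt) \<Rightarrow> (('m, 'n) vf \<Rightarrow> ('m, 'n) vf \<Rightarrow> real) \<Rightarrow> bool" where
  "H_type_group mul ginv ip \<longleftrightarrow>
     homogeneous_lie_group mul ginv \<and>
     H_type_algebra (left_invariant_fields mul) vf_bracket ip \<and>
     (\<forall>X\<in>horizontal_layer mul ip. dil_homogeneous 1 X) \<and>
     (\<forall>Z\<in>vertical_layer mul. dil_homogeneous 2 Z)"

definition horizontal_orthonormal_basis ::
  "(('m::finite, 'n::finite) pt \<Rightarrow> ('m, 'n) pt \<Rightarrow> ('m, 'n) pt) \<Rightarrow>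
   (('m, 'n) vf \<Rightarrow> ('m, 'n) vf \<Rightarrow> real) \<Rightarrow> ('m \<Rightarrow> ('m, 'n) vf) \<Rightarrow> bool" where
  "horizontal_orthonormal_basis mul ip X \<longleftrightarrow>
     (\<forall>i j. ip (X i) (X j) = (if i = j then 1 else 0)) \<and>
     span (range X) = horizontal_layer mul ip"

section \<open>Gauge and balls\<close>

definition v_part ::
  "(('m::finite, 'n::finite) pt \<Rightarrow> ('m, 'n) pt \<Rightarrow> ('m, 'n) pt) \<Rightarrow>
   (('m, 'n) vf \<Rightarrow> ('m, 'n) vf \<Rightarrow> real) \<Rightarrow> ('m, 'n) pt \<Rightarrow> ('m, 'n) vf" where
  "v_part mul ip x = (THE V. V \<in> horizontal_layer mul ip \<and>
     (\<exists>Z\<in>vertical_layer mul. x = Exp (V + Z)))"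

definition z_part ::
  "(('m::finite, 'n::finite) pt \<Rightarrow> ('m, 'n) pt \<Rightarrow> ('m, 'n) pt) \<Rightarrow>
   (('m, 'n) vf \<Rightarrow> ('m, 'n) vf \<Rightarrow> real) \<Rightarrow> ('m, 'n) pt \<Rightarrow> ('m, 'n) vf" where
  "z_part mul ip x = (THE Z. Z \<in> vertical_layer mul \<and>
     (\<exists>V\<in>horizontal_layer mul ip. x = Exp (V + Z)))"

definition gauge ::
  "(('m::finite, 'n::finite) pt \<Rightarrow> ('m, 'n) pt \<Rightarrow> ('m, 'n) pt) \<Rightarrow>
   (('m, 'n) vf \<Rightarrow> ('m, 'n) vf \<Rightarrow> real) \<Rightarrow> ('m, 'n) pt \<Rightarrow> real" where
  "gauge mul ip x = root 4 ((sqrt (ip (v_part mul ip x) (v_part mul ip x))) ^ 4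
     + 16 * (sqrt (ip (z_part mul ip x) (z_part mul ip x)))\<^sup>2)"

definition gball ::
  "(('m::finite, 'n::finite) pt \<Rightarrow> ('m, 'n) pt \<Rightarrow> ('m, 'n) pt) \<Rightarrow>
   (('m, 'n) pt \<Rightarrow> ('m, 'n) pt) \<Rightarrow> (('m, 'n) vf \<Rightarrow> ('m, 'n) vf \<Rightarrow> real) \<Rightarrow>
   ('m, 'n) pt \<Rightarrow> real \<Rightarrow> ('m, 'n) pt set" where
  "gball mul ginv ip x0 R = {\<xi>. gauge mul ip (mul (ginv x0) \<xi>) < R}"

section \<open>Horizontally elliptic operators\<close>

definition M_class :: "real \<Rightarrow> real \<Rightarrow> (real ^ 'm::finite ^ 'm) set" where
  "M_class lam Lam = {M. transpose M = M \<and>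
     (\<forall>\<xi>. lam * (norm \<xi>)\<^sup>2 \<le> (M *v \<xi>) \<bullet> \<xi> \<and> (M *v \<xi>) \<bullet> \<xi> \<le> Lam * (norm \<xi>)\<^sup>2)}"

definition L_op ::
  "('m::finite \<Rightarrow> ('m, 'n::finite) vf) \<Rightarrow> (('m, 'n) pt \<Rightarrow> real ^ 'm ^ 'm) \<Rightarrow>
   (('m, 'n) pt \<Rightarrow> real) \<Rightarrow> ('m, 'n) pt \<Rightarrow> real" where
  "L_op X A u x = (\<Sum>i\<in>UNIV. \<Sum>j\<in>UNIV. A x $ i $ j * vf_apply (X i) (vf_apply (X j) u) x)"

definition hom_dim :: "('m::finite, 'n::finite) pt itself \<Rightarrow> nat" where
  "hom_dim _ = CARD('m) + 2 * CARD('n)"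

text \<open>The maximum and the minimum over the unit sphere are attained by compactness.\<close>

definition landis_condition ::
  "real \<Rightarrow> ('m::finite, 'n::finite) pt set \<Rightarrow> (('m, 'n) pt \<Rightarrow> real ^ 'm ^ 'm) \<Rightarrow> bool" where
  "landis_condition \<delta> \<Omega> A \<longleftrightarrow> (\<forall>x\<in>\<Omega>.
     trace (A x)
       + (real (hom_dim TYPE(('m, 'n) pt)) + 2 - real CARD('m))
         * (SUP \<xi>\<in>{\<xi>. norm \<xi> = 1}. (A x *v \<xi>) \<bullet> \<xi>)
     \<le> (real (hom_dim TYPE(('m, 'n) pt)) + 4 - \<delta>)
         * (INF \<xi>\<in>{\<xi>. norm \<xi> = 1}. (A x *v \<xi>) \<bullet> \<xi>))"

text \<open>A partially defined function is represented by its domain together with a total function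
  whose values outside the domain are irrelevant.\<close>

definition K_class ::
  "('m::finite \<Rightarrow> ('m, 'n::finite) vf) \<Rightarrow> ('m, 'n) pt set \<Rightarrow> (('m, 'n) pt \<Rightarrow> real ^ 'm ^ 'm) \<Rightarrow>
   (('m, 'n) pt set \<times> (('m, 'n) pt \<Rightarrow> real)) set" where
  "K_class X \<Omega> A = {(V, u). open V \<and> V \<subseteq> \<Omega> \<and> Ck_on 2 V u \<and>
     (\<forall>x\<in>V. 0 \<le> u x) \<and> (\<forall>x\<in>V. L_op X A u x \<le> 0)}"

definition K_class_at ::
  "('m::finite \<Rightarrow> ('m, 'n::finite) vf) \<Rightarrow> ('m, 'n) pt set \<Rightarrow> (('m, 'n) pt \<Rightarrow> real ^ 'm ^ 'm) \<Rightarrow>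
   ('m, 'n) pt set \<Rightarrow> (('m, 'n) pt \<Rightarrow> real) set" where
  "K_class_at X \<Omega> A W = {u. \<exists>V. (V, u) \<in> K_class X \<Omega> A \<and> W \<subseteq> V}"

end

theory Submission
  imports Defs
begin

text \<open>
  The proof is a comparison argument with a potential, in the style of Landis.

  The Landis condition with parameter \<open>\<delta>\<close> implies that the function \<open>x \<mapsto> d(y, x)\<^sup>-\<^sup>\<alpha>\<close> with \<open>\<alpha> = Q - \<delta>\<close> is a subsolution away from \<open>y\<close>
  (\<open>kernel_subsolution\<close>).  Since \<open>\<alpha> < Q\<close>, the potential of Lebesgue measure on a bounded set with this
  kernel is bounded, by a dyadic decomposition that rests on \<open>|B\<^sub>r| = r\<^sup>Q |B\<^sub>1|\<close>
  (\<open>weighted_inverse_power_sum_le\<close>, \<open>measure_gdist_less\<close>).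

  Let \<open>u\<close> be a supersolution as in the theorem and let \<open>p\<close> be a point of the ball of radius \<open>R/2\<close>.  If \<open>u \<ge> 1\<close>
  on all but a sufficiently small portion of the ball of radius \<open>R\<close>, then \<open>u \<ge> 1\<close> on a subset \<open>F\<close> of the
  ball of radius \<open>R/4\<close> around \<open>p\<close> of at least half its measure.  The potential \<open>w\<close> of \<open>F\<close> is a subsolution off
  \<open>F\<close>.  Its value at \<open>p\<close> is at least \<open>(R/4)\<^sup>-\<^sup>\<alpha> |F|\<close>, whereas on the sphere of radius \<open>3R/2\<close> it is at most
  \<open>M = (3R/4)\<^sup>-\<^sup>\<alpha> |F|\<close>, by the triangle inequality for \<open>d\<close> (\<open>hnorm_gmul_le\<close>).  With \<open>S\<close> an upper bound of \<open>w\<close>,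
  the function \<open>2u - (w - M)/S\<close> is therefore nonnegative both on that sphere and where \<open>u = 1/2\<close>, and by the
  minimum principle (\<open>minimum_principle\<close>) also at \<open>p\<close> if \<open>u p \<le> 1/2\<close>.  This bounds \<open>u p\<close> from below by a
  constant in which the powers of \<open>R\<close> cancel (\<open>supersolution_lower_bound\<close>).  Differentiation of the
  potential is avoided by replacing the measure on \<open>F\<close> by finitely many point masses, so fine that the
  bounds persist on the region \<open>u \<le> 1/2\<close>, which has positive distance from \<open>F\<close>
  (\<open>discretised_measure\<close>).

  These computations need explicit formulas.  Homogeneity forces horizontal fields to have the form
  \<open>(a, B x\<^sub>1)\<close> with a constant vector \<open>a\<close> and a linear map \<open>B\<close>, and vertical fields to be constant
  (\<open>dil_homogeneous_1_form\<close>, \<open>dil_homogeneous_2_form\<close>).  Since every tangent vector at the origin extends to a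
  left-invariant field, this determines the integral curves of all of them, hence the exponential map,
  the gauge and the group law, which is polynomial of degree two (\<open>mul_eq\<close>, \<open>gauge_eq\<close>).
\<close>

section \<open>Sums of products and second derivatives\<close>

text \<open>Completing the square in one variable splits off a rank-one part of the definite matrix, on which the
  claim is an instance of the hypothesis on \<open>h\<close>; the Schur complement lives on one index less.  This
  induction replaces a spectral decomposition in the proof that the trace of the product of the two
  matrices is nonnegative.  Only the quadratic form of \<open>h\<close> is constrained, because the Hessians along noncommuting fields are not symmetric.\<close>

lemma definite_pairing_nonneg:
  fixes a h :: "'i \<Rightarrow> 'i \<Rightarrow> real"
  assumes "finite I"
    and "\<And>i j. i \<in> I \<Longrightarrow> j \<in> I \<Longrightarrow> a i j = a j i"
    and "\<And>x. \<exists>i\<in>I. x i \<noteq> 0 \<Longrightarrow> 0 < (\<Sum>i\<in>I. \<Sum>j\<in>I. a i j * x i * x j)"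
    and "\<And>x. 0 \<le> (\<Sum>i\<in>I. \<Sum>j\<in>I. h i j * x i * x j)"
  shows "0 \<le> (\<Sum>i\<in>I. \<Sum>j\<in>I. a i j * h i j)"
  using assms
proof (induction I arbitrary: a rule: finite_induct)
  case empty
  then show ?case by simp
next
  case (insert k I)
  let ?K = "insert k I"
  have split: "(\<Sum>i\<in>?K. g i) = g k + (\<Sum>i\<in>I. g i)" for g :: "'i \<Rightarrow> real"
    using insert.hyps by simp
  have "0 < (\<Sum>i\<in>?K. \<Sum>j\<in>?K. a i j * (if i = k then 1 else 0) * (if j = k then 1 else 0))"
    by (rule insert.prems(2)) auto
  also have "\<dots> = (\<Sum>i\<in>?K. \<Sum>j\<in>?K. if j = k then (if i = k then a k k else 0) else 0)"
    by (intro sum.cong refl) auto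
  also have "\<dots> = a k k"
    using insert.hyps by (simp add: sum.delta)
  finally have akk: "0 < a k k" .
  define b where "b = (\<lambda>i j. a i j - a i k * a j k / a k k)"
  have b0: "b k j = 0" "b j k = 0" if "j \<in> ?K" for j
    using akk insert.prems(1)[of k j] that by (auto simp: b_def)
  have bI: "(\<Sum>i\<in>?K. \<Sum>j\<in>?K. b i j * g i j) = (\<Sum>i\<in>I. \<Sum>j\<in>I. b i j * g i j)" for g
    using b0 by (simp add: split)
  have quad: "(\<Sum>i\<in>?K. \<Sum>j\<in>?K. a i j * g i j) =
      (\<Sum>i\<in>?K. \<Sum>j\<in>?K. b i j * g i j) + (\<Sum>i\<in>?K. \<Sum>j\<in>?K. g i j * a i k * a j k) / a k k" for g
    by (simp add: b_def sum_divide_distrib sum.distrib[symmetric] algebra_simps)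
  have "0 \<le> (\<Sum>i\<in>I. \<Sum>j\<in>I. b i j * h i j)"
  proof (rule insert.IH)
    show "b i j = b j i" if "i \<in> I" "j \<in> I" for i j
      using insert.prems(1)[of i j] that by (simp add: b_def)
    show "0 < (\<Sum>i\<in>I. \<Sum>j\<in>I. b i j * x i * x j)" if x: "\<exists>i\<in>I. x i \<noteq> 0" for x
    proof -
      \<comment> \<open>the value of the new variable for which the completed square vanishes\<close>
      define y where "y = x(k := - (\<Sum>i\<in>I. a i k * x i) / a k k)"
      have yI: "y i = x i" if "i \<in> I" for i using that insert.hyps by (auto simp: y_def)
      have "(\<Sum>i\<in>?K. y i * a i k) = y k * a k k + (\<Sum>i\<in>I. a i k * x i)"
        unfolding split using yI by (simp add: mult.commute cong: sum.cong)
      also have "\<dots> = 0" using akk by (simp add: y_def)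
      finally have z: "(\<Sum>i\<in>?K. y i * a i k) = 0" .
      have "(\<Sum>i\<in>?K. \<Sum>j\<in>?K. (y i * y j) * a i k * a j k)
          = (\<Sum>i\<in>?K. y i * a i k) * (\<Sum>j\<in>?K. y j * a j k)"
        unfolding sum_product by (intro sum.cong refl) (simp add: algebra_simps)
      then have "(\<Sum>i\<in>?K. \<Sum>j\<in>?K. (y i * y j) * a i k * a j k) = 0"
        by (simp only: z)
      then have "(\<Sum>i\<in>?K. \<Sum>j\<in>?K. a i j * (y i * y j)) = (\<Sum>i\<in>I. \<Sum>j\<in>I. b i j * (y i * y j))"
        using quad[of "\<lambda>i j. y i * y j"] bI[of "\<lambda>i j. y i * y j"] by simp
      also have "\<dots> = (\<Sum>i\<in>I. \<Sum>j\<in>I. b i j * x i * x j)"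
        by (intro sum.cong refl) (simp add: yI)
      finally have eq: "(\<Sum>i\<in>?K. \<Sum>j\<in>?K. a i j * y i * y j) = (\<Sum>i\<in>I. \<Sum>j\<in>I. b i j * x i * x j)"
        by (simp only: mult.assoc)
      have "\<exists>i\<in>?K. y i \<noteq> 0" using x yI by auto
      from insert.prems(2)[OF this] show ?thesis by (simp only: eq)
    qed
    show "0 \<le> (\<Sum>i\<in>I. \<Sum>j\<in>I. h i j * x i * x j)" for x
    proof -
      have "(\<Sum>i\<in>?K. \<Sum>j\<in>?K. h i j * (x(k := 0)) i * (x(k := 0)) j)
          = (\<Sum>i\<in>I. \<Sum>j\<in>I. h i j * (x(k := 0)) i * (x(k := 0)) j)"
        by (simp add: split)
      also have "\<dots> = (\<Sum>i\<in>I. \<Sum>j\<in>I. h i j * x i * x j)"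
        using insert.hyps by (intro sum.cong refl) auto
      finally show ?thesis using insert.prems(3)[of "x(k := 0)"] by simp
    qed
  qed
  moreover have "0 \<le> (\<Sum>i\<in>?K. \<Sum>j\<in>?K. h i j * a i k * a j k) / a k k"
    using insert.prems(3)[of "\<lambda>i. a i k"] akk by (intro divide_nonneg_pos) auto
  ultimately show ?case using quad[of h] bI[of h] by simp
qed

lemma second_derivative_nonneg_at_min:
  fixes g g' :: "real \<Rightarrow> real"
  assumes "0 < r"
    and g: "\<And>t. \<bar>t\<bar> < r \<Longrightarrow> (g has_real_derivative g' t) (at t)"
    and min: "\<And>t. \<bar>t\<bar> < r \<Longrightarrow> g 0 \<le> g t"
    and g'': "(g' has_real_derivative c) (at 0)"
  shows "0 \<le> c"
proof (rule ccontr)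
  assume "\<not> 0 \<le> c"
  then have "c < 0" by simp
  have "g' 0 = 0"
    using DERIV_local_min[OF g, of 0 r] min \<open>0 < r\<close> by auto
  obtain d where d: "0 < d" "\<And>t. 0 < t \<Longrightarrow> t < d \<Longrightarrow> g' t < g' 0"
    using has_real_derivative_neg_dec_right[OF g'' \<open>c < 0\<close>] by auto
  define s where "s = min d r / 2"
  have s: "0 < s" "s < d" "s < r" using d \<open>0 < r\<close> by (auto simp: s_def)
  obtain t where t: "0 < t" "t < s" "g s - g 0 = (s - 0) * g' t"
    using MVT2[of 0 s g g'] g s by auto
  have "g' t < 0" using d(2)[of t] t s \<open>g' 0 = 0\<close> by simp
  then have "g s < g 0" using t s by (simp add: mult_pos_neg) (smt (verit) mult_pos_neg)
  then show False using min[of s] s by simp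
qed

section \<open>Second-order operators built from vector fields\<close>

text \<open>The amount of regularity that makes the second-order operator linear: it is all that the minimum
  principle needs, and it is easier to verify for explicit functions than full \<open>C\<^sup>2\<close> regularity.\<close>

definition field_C2 :: "('m::finite \<Rightarrow> ('m, 'n::finite) vf) \<Rightarrow> ('m, 'n) pt set \<Rightarrow> (('m, 'n) pt \<Rightarrow> real) \<Rightarrow> bool" where
  "field_C2 X U f \<longleftrightarrow> (\<forall>x\<in>U. f differentiable (at x)) \<and>
     (\<forall>j. \<forall>x\<in>U. vf_apply (X j) f differentiable (at x))"

lemma frechet_derivative_lincomb:
  assumes "f differentiable (at x)" "g differentiable (at x)"
  shows "frechet_derivative (\<lambda>x. f x + c *\<^sub>R g x) (at x) = (\<lambda>w. frechet_derivative f (at x) w + c *\<^sub>R frechet_derivative g (at x) w)"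
  using assms
  by (intro frechet_derivative_at[symmetric] derivative_intros) (auto simp: frechet_derivative_works)

lemma vf_apply_cong_open:
  assumes "open U" "x \<in> U" "\<And>y. y \<in> U \<Longrightarrow> f y = g y" "g differentiable (at x)"
  shows "f differentiable (at x)" "vf_apply X f x = vf_apply X g x"
proof -
  have "(g has_derivative frechet_derivative g (at x)) (at x)"
    using assms(4) by (simp add: frechet_derivative_works)
  then have d: "(f has_derivative frechet_derivative g (at x)) (at x)"
    using has_derivative_transform_within_open[of g _ x UNIV U f] assms by auto
  then show "f differentiable (at x)" by (auto simp: differentiable_def)
  show "vf_apply X f x = vf_apply X g x"
    using frechet_derivative_at[OF d] by (simp add: vf_apply_def)
qed

lemma field_C2_lincomb:
  assumes U: "open U" and f: "field_C2 X U f" and g: "field_C2 X U g"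
  shows "field_C2 X U (\<lambda>x. f x + c * g x)"
    and "x \<in> U \<Longrightarrow> L_op X A (\<lambda>x. f x + c * g x) x = L_op X A f x + c * L_op X A g x"
proof -
  have first: "vf_apply (X j) (\<lambda>x. f x + c * g x) x = vf_apply (X j) f x + c * vf_apply (X j) g x"
    if "x \<in> U" for x j
    using frechet_derivative_lincomb[of f x g c] f g that
    by (simp add: vf_apply_def field_C2_def)
  have diff2: "(\<lambda>x. vf_apply (X j) f x + c * vf_apply (X j) g x) differentiable (at x)" if "x \<in> U" for x j
    using f g that by (auto simp: field_C2_def intro!: derivative_intros)
  show "field_C2 X U (\<lambda>x. f x + c * g x)"
    unfolding field_C2_def
  proof (intro conjI ballI allI)
    show "(\<lambda>x. f x + c * g x) differentiable (at x)" if "x \<in> U" for x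
      using f g that by (auto simp: field_C2_def intro!: derivative_intros)
    show "vf_apply (X j) (\<lambda>x. f x + c * g x) differentiable (at x)" if "x \<in> U" for x j
      by (rule vf_apply_cong_open(1)[OF U that first diff2[OF that]])
  qed
  show "L_op X A (\<lambda>x. f x + c * g x) x = L_op X A f x + c * L_op X A g x" if x: "x \<in> U"
  proof -
    have "vf_apply (X i) (vf_apply (X j) (\<lambda>x. f x + c * g x)) x
        = vf_apply (X i) (vf_apply (X j) f) x + c * vf_apply (X i) (vf_apply (X j) g) x" for i j
    proof -
      have "vf_apply (X i) (vf_apply (X j) (\<lambda>x. f x + c * g x)) x
          = vf_apply (X i) (\<lambda>x. vf_apply (X j) f x + c * vf_apply (X j) g x) x"
        by (rule vf_apply_cong_open(2)[OF U x first diff2[OF x]])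
      also have "\<dots> = vf_apply (X i) (vf_apply (X j) f) x + c * vf_apply (X i) (vf_apply (X j) g) x"
        using frechet_derivative_lincomb[of "vf_apply (X j) f" x "vf_apply (X j) g" c] f g x
        by (simp add: vf_apply_def[of "X i"] field_C2_def)
      finally show ?thesis .
    qed
    then show ?thesis
      by (simp add: L_op_def sum_distrib_left sum.distrib[symmetric] algebra_simps)
  qed
qed

lemma field_C2_sum:
  assumes U: "open U" and I: "finite I" and f: "\<And>i. i \<in> I \<Longrightarrow> field_C2 X U (f i)"
  shows "field_C2 X U (\<lambda>x. \<Sum>i\<in>I. c i * f i x) \<and>
    (\<forall>x\<in>U. L_op X A (\<lambda>x. \<Sum>i\<in>I. c i * f i x) x = (\<Sum>i\<in>I. c i * L_op X A (f i) x))"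
  using I f
proof (induction I rule: finite_induct)
  case empty
  have [simp]: "vf_apply Y (\<lambda>x. 0 :: real) = (\<lambda>x. 0)" for Y :: "('a,'b) vf"
    using frechet_derivative_const[of "0::real"] by (simp add: vf_apply_def fun_eq_iff)
  show ?case by (auto simp: field_C2_def L_op_def)
next
  case (insert k I)
  then have IH: "field_C2 X U (\<lambda>x. \<Sum>i\<in>I. c i * f i x)"
    "\<And>x. x \<in> U \<Longrightarrow> L_op X A (\<lambda>x. \<Sum>i\<in>I. c i * f i x) x = (\<Sum>i\<in>I. c i * L_op X A (f i) x)"
    and fk: "field_C2 X U (f k)" by auto
  have eq: "(\<lambda>x. \<Sum>i\<in>insert k I. c i * f i x) = (\<lambda>x. (\<Sum>i\<in>I. c i * f i x) + c k * f k x)"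
    using insert.hyps by (auto simp: fun_eq_iff)
  show ?case
    unfolding eq using field_C2_lincomb[OF U IH(1) fk, where c = "c k"] IH(2) insert.hyps
    by auto
qed

lemma field_C2_of_Ck:
  assumes "open U" and u: "Ck_on 2 U u" and X: "\<And>j x. x \<in> U \<Longrightarrow> X j differentiable (at x)"
  shows "field_C2 X U u"
  unfolding field_C2_def
proof (intro conjI ballI allI)
  have u1: "u differentiable (at x)" if "x \<in> U" for x using u that by (simp add: numeral_2_eq_2)
  have u2: "(\<lambda>x. frechet_derivative u (at x) w) differentiable (at x)" if "x \<in> U" for x w
    using u that unfolding numeral_2_eq_2 Ck_on.simps by blast
  show "u differentiable (at x)" if "x \<in> U" for x by (rule u1[OF that])
  show "vf_apply (X j) u differentiable (at x)" if x: "x \<in> U" for x j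
  proof (rule vf_apply_cong_open(1)[OF \<open>open U\<close> x])
    show "vf_apply (X j) u y = (\<Sum>b\<in>Basis. (X j y \<bullet> b) * frechet_derivative u (at y) b)"
      if "y \<in> U" for y
    proof -
      interpret bounded_linear "frechet_derivative u (at y)"
        using u1[OF that] by (metis frechet_derivative_works has_derivative_bounded_linear)
      have "frechet_derivative u (at y) (X j y)
          = frechet_derivative u (at y) (\<Sum>b\<in>Basis. (X j y \<bullet> b) *\<^sub>R b)"
        by (simp only: euclidean_representation)
      also have "\<dots> = (\<Sum>b\<in>Basis. (X j y \<bullet> b) * frechet_derivative u (at y) b)"
        by (simp only: sum scaleR) simp
      finally show ?thesis by (simp add: vf_apply_def)
    qed
    show "(\<lambda>y. \<Sum>b\<in>Basis. (X j y \<bullet> b) * frechet_derivative u (at y) b) differentiable (at x)"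
      using u2[OF x] X[OF x] by (intro differentiable_sum differentiable_mult differentiable_inner) auto
  qed
qed

section \<open>H-type groups in coordinates\<close>

text \<open>The coordinates in which the analysis is done.  The group law is
  \<open>(x\<^sub>1 + y\<^sub>1, x\<^sub>2 + y\<^sub>2 + \<beta> x\<^sub>1 y\<^sub>1)\<close>, the maps \<open>v\<close> and \<open>T\<close> are the coordinates with respect to orthonormal bases
  of the two layers, and the horizontal fields are \<open>x \<mapsto> (e\<^sub>i, \<beta> x\<^sub>1 e\<^sub>i)\<close>.  The bilinear map \<open>\<beta>\<close> is not assumed skew:
  only its skew part enters the Lie bracket, and the symmetric part is absorbed by the quadratic
  change of variables in the exponential coordinates.  The last hypothesis says \<open>|J\<^sub>z v| = |z| |v|\<close>.\<close>

locale htype_coordinates =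
  fixes \<beta> :: "real^'m::finite \<Rightarrow> real^'m \<Rightarrow> real^'n::finite"
    and v :: "real^'m \<Rightarrow> real^'m" and e :: "'m \<Rightarrow> real^'m" and T :: "real^'n \<Rightarrow> real^'n"
  assumes \<beta>: "bounded_bilinear \<beta>"
    and v: "bounded_linear v" and v_e: "v (e i) = axis i 1" and inj_v: "v s = 0 \<Longrightarrow> s = 0"
    and T: "bounded_linear T" and inj_T: "T c = 0 \<Longrightarrow> c = 0"
    and htype: "(\<Sum>i\<in>UNIV. (z \<bullet> T (\<beta> s (e i) - \<beta> (e i) s))\<^sup>2) = (norm z)\<^sup>2 * (norm (v s))\<^sup>2"
begin

sublocale \<beta>: bounded_bilinear \<beta> by (rule \<beta>)
sublocale v: bounded_linear v by (rule v)
sublocale T: bounded_linear T by (rule T)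

definition br :: "real^'m \<Rightarrow> real^'m \<Rightarrow> real^'n" where
  "br s t = T (\<beta> s t - \<beta> t s)"

definition J :: "real^'n \<Rightarrow> real^'m \<Rightarrow> real^'m" where
  "J z s = (\<chi> i. z \<bullet> br s (e i))"

lemma expand: "s = (\<Sum>i\<in>UNIV. v s $ i *\<^sub>R e i)"
proof -
  have "v (s - (\<Sum>i\<in>UNIV. v s $ i *\<^sub>R e i)) = 0"
    by (simp add: v.diff v.sum v.scaleR v_e vec_eq_iff axis_def if_distrib cong: if_cong)
  then show ?thesis using inj_v by force
qed

lemma br_simps:
  "br (s + s') t = br s t + br s' t" "br s (t + t') = br s t + br s t'"
  "br (c *\<^sub>R s) t = c *\<^sub>R br s t" "br s (c *\<^sub>R t) = c *\<^sub>R br s t"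
  by (simp_all add: br_def \<beta>.add_left \<beta>.add_right \<beta>.scaleR_left \<beta>.scaleR_right T.add T.diff T.scaleR algebra_simps)

lemma bounded_bilinear_br: "bounded_bilinear br"
  unfolding bilinear_conv_bounded_bilinear[symmetric] bilinear_def
  by (auto intro!: linearI simp: br_simps)

lemma br_sum: "br s (\<Sum>i\<in>I. f i) = (\<Sum>i\<in>I. br s (f i))"
  by (simp add: br_def \<beta>.sum_left \<beta>.sum_right T.diff T.sum sum_subtractf)

lemma br_self: "br s s = 0" by (simp add: br_def)
lemma br_skew: "br s t = - br t s" by (simp add: br_def T.diff)

lemma J_inner: "J z s \<bullet> v t = z \<bullet> br s t"
proof -
  have "z \<bullet> br s t = z \<bullet> br s (\<Sum>i\<in>UNIV. v t $ i *\<^sub>R e i)" using expand[of t] by simp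
  also have "\<dots> = (\<Sum>i\<in>UNIV. v t $ i * (z \<bullet> br s (e i)))"
    by (simp add: br_sum br_simps inner_sum_right)
  finally show ?thesis by (simp add: J_def inner_vec_def mult.commute)
qed

lemma norm_J: "(norm (J z s))\<^sup>2 = (norm z)\<^sup>2 * (norm (v s))\<^sup>2"
  using htype[of z s] by (simp add: J_def norm_vec_def L2_set_def sum_nonneg br_def)

lemma J_perp: "J z s \<bullet> v s = 0" by (simp add: J_inner br_self)

text \<open>The vectors \<open>v\<close> and \<open>J\<^sub>z v\<close>, with \<open>z\<close> the bracket itself, are orthogonal and have norms in the ratio
  \<open>1 : |z|\<close>; the claim is Bessel's inequality for this pair, obtained from the Cauchy-Schwarz inequality
  with the vector \<open>r\<close> below.\<close>

lemma inner_bracket_bound: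
  "(v s \<bullet> v t)\<^sup>2 + (norm (br s t))\<^sup>2 \<le> (norm (v s))\<^sup>2 * (norm (v t))\<^sup>2"
proof (cases "br s t = 0")
  case True
  then show ?thesis
    using Cauchy_Schwarz_ineq[of "v s" "v t"] by (simp add: power2_norm_eq_inner)
next
  case False
  define z where "z = br s t"
  define q where "q = (norm z)\<^sup>2"
  define a where "a = v s \<bullet> v t"
  have q: "0 < q" using False by (simp add: q_def z_def)
  define r where "r = (a * q) *\<^sub>R v s + q *\<^sub>R J z s"
  have Jt: "J z s \<bullet> v t = q" by (simp add: J_inner z_def q_def power2_norm_eq_inner)
  have rt: "r \<bullet> v t = q * (a\<^sup>2 + q)"
    by (simp add: r_def inner_add_left Jt a_def[symmetric] power2_eq_square algebra_simps)
  have "r \<bullet> r = (a * q)\<^sup>2 * (v s \<bullet> v s) + q\<^sup>2 * (J z s \<bullet> J z s)"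
    using J_perp[of z s]
    by (simp add: r_def inner_add_left inner_add_right inner_commute power2_eq_square algebra_simps)
  also have "J z s \<bullet> J z s = q * (v s \<bullet> v s)"
    using norm_J[of z s] by (simp add: power2_norm_eq_inner q_def)
  finally have rr: "r \<bullet> r = q\<^sup>2 * (a\<^sup>2 + q) * (v s \<bullet> v s)"
    by (simp add: power2_eq_square algebra_simps)
  have "(q * (a\<^sup>2 + q))\<^sup>2 \<le> (q\<^sup>2 * (a\<^sup>2 + q) * (v s \<bullet> v s)) * (v t \<bullet> v t)"
    using Cauchy_Schwarz_ineq[of r "v t"] by (simp only: rt rr)
  then have "(q\<^sup>2 * (a\<^sup>2 + q)) * (a\<^sup>2 + q) \<le> (q\<^sup>2 * (a\<^sup>2 + q)) * ((v s \<bullet> v s) * (v t \<bullet> v t))"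
    by (simp add: power2_eq_square algebra_simps)
  moreover have "0 < q\<^sup>2 * (a\<^sup>2 + q)" using q by (simp add: add_nonneg_pos)
  ultimately have "a\<^sup>2 + q \<le> (v s \<bullet> v s) * (v t \<bullet> v t)" by (simp only: mult_le_cancel_left_pos)
  then show ?thesis by (simp add: a_def q_def z_def power2_norm_eq_inner)
qed

definition gmul :: "('m, 'n) pt \<Rightarrow> ('m, 'n) pt \<Rightarrow> ('m, 'n) pt" where
  "gmul x y = (fst x + fst y, snd x + snd y + \<beta> (fst x) (fst y))"

definition ginv :: "('m, 'n) pt \<Rightarrow> ('m, 'n) pt" where
  "ginv x = (- fst x, - snd x + \<beta> (fst x) (fst x))"

text \<open>The vertical exponential coordinate.\<close>

definition zc :: "('m, 'n) pt \<Rightarrow> real^'n" where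
  "zc x = T (snd x - (1/2) *\<^sub>R \<beta> (fst x) (fst x))"

definition rho :: "('m, 'n) pt \<Rightarrow> real" where
  "rho x = (norm (v (fst x)))^4 + 16 * (norm (zc x))\<^sup>2"

definition hnorm :: "('m, 'n) pt \<Rightarrow> real" where
  "hnorm x = root 4 (rho x)"

definition gdist :: "('m, 'n) pt \<Rightarrow> ('m, 'n) pt \<Rightarrow> real" where
  "gdist y x = hnorm (gmul (ginv y) x)"

definition fld :: "'m \<Rightarrow> ('m, 'n) vf" where
  "fld i x = (e i, \<beta> (fst x) (e i))"

lemma gmul_ginv_cancel: "gmul y (gmul (ginv y) x) = x" "gmul (ginv y) (gmul y x) = x"
  by (auto simp: gmul_def ginv_def prod_eq_iff \<beta>.add_left \<beta>.add_right \<beta>.minus_left \<beta>.minus_right \<beta>.diff_right algebra_simps)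

lemma zc_gmul: "zc (gmul a b) = zc a + zc b + (1/2) *\<^sub>R br (fst a) (fst b)"
proof -
  have "snd a + snd b + \<beta> (fst a) (fst b) - (1/2) *\<^sub>R \<beta> (fst a + fst b) (fst a + fst b)
     = (snd a - (1/2) *\<^sub>R \<beta> (fst a) (fst a)) + (snd b - (1/2) *\<^sub>R \<beta> (fst b) (fst b))
       + (1/2) *\<^sub>R (\<beta> (fst a) (fst b) - \<beta> (fst b) (fst a))"
    by (simp only: vec_eq_iff \<beta>.add_left \<beta>.add_right vector_add_component vector_minus_component vector_scaleR_component) (simp add: field_simps)
  then show ?thesis
    by (simp only: zc_def gmul_def br_def T.add T.scaleR fst_conv snd_conv)
qed

lemma zc_ginv: "zc (ginv a) = - zc a"
proof -
  have "- snd a + \<beta> (fst a) (fst a) - (1/2) *\<^sub>R \<beta> (fst a) (fst a) = - (snd a - (1/2) *\<^sub>R \<beta> (fst a) (fst a))"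
    by (simp add: algebra_simps flip: scaleR_add_left)
  then show ?thesis
    by (simp only: zc_def ginv_def \<beta>.minus_left \<beta>.minus_right minus_minus T.neg fst_conv snd_conv)
qed

lemma rho_nonneg: "0 \<le> rho x" by (simp add: rho_def)
lemma hnorm_nonneg: "0 \<le> hnorm x" by (simp add: hnorm_def rho_nonneg)
lemma hnorm_power4: "hnorm x ^ 4 = rho x" by (simp add: hnorm_def rho_nonneg)

text \<open>This form of the gauge turns its triangle inequality into that of a Euclidean space.\<close>

lemma hnorm_power2: "(hnorm x)\<^sup>2 = norm ((norm (v (fst x)))\<^sup>2, 4 *\<^sub>R zc x)"
proof -
  have "((hnorm x)\<^sup>2)\<^sup>2 = (norm ((norm (v (fst x)))\<^sup>2, 4 *\<^sub>R zc x))\<^sup>2"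
    using hnorm_power4[of x] by (simp add: norm_Pair rho_def power_mult_distrib flip: power_mult)
  then show ?thesis by (simp only: power2_eq_iff_nonneg zero_le_power2 norm_ge_zero)
qed

lemma norm_v_le_hnorm: "norm (v (fst x)) \<le> hnorm x"
proof -
  have "(norm (v (fst x)))\<^sup>2 \<le> (hnorm x)\<^sup>2"
    unfolding hnorm_power2 by (simp add: norm_Pair real_le_rsqrt)
  then show ?thesis by (rule power2_le_imp_le) (rule hnorm_nonneg)
qed

text \<open>Cygan's inequality.  Under the identification of the square of the gauge with a norm, the product of
  two points corresponds to the sum of the two vectors and a mixed term, which the bracket inequality
  bounds by twice the product of the two gauges.\<close>

lemma hnorm_gmul_le: "hnorm (gmul a b) \<le> hnorm a + hnorm b"
proof -
  let ?s = "v (fst a)" and ?t = "v (fst b)"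
  let ?c = "(2 * (?s \<bullet> ?t), 2 *\<^sub>R br (fst a) (fst b))"
  have "((norm (v (fst (gmul a b))))\<^sup>2, 4 *\<^sub>R zc (gmul a b)) =
     ((norm ?s)\<^sup>2, 4 *\<^sub>R zc a) + ((norm ?t)\<^sup>2, 4 *\<^sub>R zc b) + ?c"
    unfolding zc_gmul
    by (simp add: gmul_def v.add power2_norm_eq_inner inner_add_left inner_add_right
        inner_commute scaleR_add_right)
  then have "(hnorm (gmul a b))\<^sup>2 \<le> (hnorm a)\<^sup>2 + (hnorm b)\<^sup>2 + norm ?c"
    unfolding hnorm_power2 by (simp only:) (intro norm_triangle_mono order_refl)
  also have "norm ?c \<le> 2 * (norm ?s * norm ?t)"
  proof -
    have "norm ?c = 2 * sqrt ((?s \<bullet> ?t)\<^sup>2 + (norm (br (fst a) (fst b)))\<^sup>2)"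
    proof -
      have "?c = 2 *\<^sub>R (?s \<bullet> ?t, br (fst a) (fst b))" by simp
      then show ?thesis by (simp only: norm_scaleR) (simp add: norm_Pair)
    qed
    also have "\<dots> \<le> 2 * sqrt ((norm ?s)\<^sup>2 * (norm ?t)\<^sup>2)"
      using inner_bracket_bound[of "fst a" "fst b"] by simp
    finally show ?thesis by (simp add: real_sqrt_mult)
  qed
  also have "norm ?s * norm ?t \<le> hnorm a * hnorm b"
    by (intro mult_mono norm_v_le_hnorm hnorm_nonneg) auto
  finally have "(hnorm (gmul a b))\<^sup>2 \<le> (hnorm a + hnorm b)\<^sup>2" by (simp add: power2_sum)
  then show ?thesis by (rule power2_le_imp_le) (simp add: hnorm_nonneg)
qed

lemma hnorm_ginv: "hnorm (ginv a) = hnorm a"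
  by (simp add: hnorm_def rho_def zc_ginv) (simp add: ginv_def v.neg)

lemma hnorm_eq_0_iff: "hnorm x = 0 \<longleftrightarrow> x = 0"
proof
  assume "hnorm x = 0"
  then have "rho x = 0" using hnorm_power4[of x] by simp
  then have "v (fst x) = 0" "zc x = 0" by (auto simp: rho_def add_nonneg_eq_0_iff)
  then have "fst x = 0" "snd x = 0" using inj_v[of "fst x"] inj_T[of "snd x"] by (auto simp: zc_def \<beta>.zero_left)
  then show "x = 0" by (simp add: prod_eq_iff)
qed (simp add: hnorm_def rho_def zc_def \<beta>.zero_left v.zero T.zero)

lemma gdist_nonneg: "0 \<le> gdist y x" by (simp add: gdist_def hnorm_nonneg)

lemma gdist_sym: "gdist y x = gdist x y"
proof -
  have "gmul (ginv x) y = ginv (gmul (ginv y) x)"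
    by (auto simp: gmul_def ginv_def prod_eq_iff \<beta>.add_left \<beta>.add_right \<beta>.minus_left \<beta>.minus_right \<beta>.diff_left \<beta>.diff_right algebra_simps)
  then show ?thesis by (simp add: gdist_def hnorm_ginv)
qed

lemma gdist_triangle: "gdist y x \<le> gdist y w + gdist w x"
proof -
  have "gmul (ginv y) x = gmul (gmul (ginv y) w) (gmul (ginv w) x)"
    by (auto simp: gmul_def ginv_def prod_eq_iff \<beta>.add_left \<beta>.add_right \<beta>.minus_left \<beta>.minus_right \<beta>.diff_left \<beta>.diff_right algebra_simps)
  then show ?thesis by (simp add: gdist_def hnorm_gmul_le)
qed

lemma gdist_eq_0_iff: "gdist y x = 0 \<longleftrightarrow> y = x"
proof -
  have "gmul (ginv y) x = 0 \<longleftrightarrow> y = x"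
    using gmul_ginv_cancel(1)[of y x]
    by (auto simp: gmul_def ginv_def prod_eq_iff \<beta>.minus_left \<beta>.zero_left \<beta>.zero_right)
  then show ?thesis by (simp add: gdist_def hnorm_eq_0_iff)
qed

lemma continuous_gdist [continuous_intros]:
  assumes "continuous_on S f" "continuous_on S g"
  shows "continuous_on S (\<lambda>x. gdist (f x) (g x))"
  unfolding gdist_def hnorm_def rho_def zc_def gmul_def ginv_def fst_conv snd_conv
  by (intro continuous_intros assms \<beta>.continuous_on v.continuous_on T.continuous_on)
end

section \<open>The kernel and the Landis condition\<close>

context htype_coordinates begin

text \<open>The coordinates of the left translate \<open>y\<^sup>-\<^sup>1 x\<close>, as functions of \<open>x\<close>.\<close>

definition vrel :: "('m, 'n) pt \<Rightarrow> ('m, 'n) pt \<Rightarrow> real^'m" where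
  "vrel y x = v (fst (gmul (ginv y) x))"

definition zrel :: "('m, 'n) pt \<Rightarrow> ('m, 'n) pt \<Rightarrow> real^'n" where
  "zrel y x = zc (gmul (ginv y) x)"

lemma rho_rel: "rho (gmul (ginv y) x) = (vrel y x \<bullet> vrel y x)\<^sup>2 + 16 * (zrel y x \<bullet> zrel y x)"
  by (simp add: rho_def vrel_def zrel_def power4_eq_xxxx power2_eq_square dot_square_norm)

lemma vrel_alt: "vrel y x = v (fst x - fst y)"
  by (simp add: vrel_def gmul_def ginv_def)

lemma zrel_alt: "zrel y x = T (snd x - snd y + \<beta> (fst y) (fst y) - \<beta> (fst y) (fst x)
    - (1/2) *\<^sub>R \<beta> (fst x - fst y) (fst x - fst y))"
proof -
  have "snd (gmul (ginv y) x) = snd x - snd y + \<beta> (fst y) (fst y) - \<beta> (fst y) (fst x)"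
    by (simp add: gmul_def ginv_def \<beta>.minus_left)
  moreover have "fst (gmul (ginv y) x) = fst x - fst y" by (simp add: gmul_def ginv_def)
  ultimately show ?thesis by (simp only: zrel_def zc_def)
qed

lemma vrel_has_derivative: "(vrel y has_derivative (\<lambda>h. v (fst h))) (at x)"
  unfolding vrel_alt[abs_def]
  by (rule v.has_derivative) (auto intro!: derivative_eq_intros)

lemma zrel_has_derivative:
  "(zrel y has_derivative (\<lambda>h. T (snd h - \<beta> (fst y) (fst h)
      - (1/2) *\<^sub>R (\<beta> (fst x - fst y) (fst h) + \<beta> (fst h) (fst x - fst y))))) (at x)"
  unfolding zrel_alt[abs_def]
  by (rule T.has_derivative)
    (auto intro!: derivative_eq_intros \<beta>.FDERIV bounded_linear.has_derivative[OF \<beta>.bounded_linear_right])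

lemma v_fld: "v (fst (fld i x)) = axis i 1"
  by (simp add: fld_def v_e)

text \<open>The value of the derivative of the vertical coordinate on a horizontal field: this is where the
  symmetric part of \<open>\<beta>\<close> cancels, so that the horizontal derivatives of the gauge depend on the bracket
  only.\<close>

lemma zrel_fld:
  fixes i x y defines "h \<equiv> fld i x"
  shows "T (snd h - \<beta> (fst y) (fst h) - (1/2) *\<^sub>R (\<beta> (fst x - fst y) (fst h) + \<beta> (fst h) (fst x - fst y)))
    = (1/2) *\<^sub>R br (fst x - fst y) (e i)"
proof -
  let ?w = "fst x - fst y"
  have "snd h - \<beta> (fst y) (fst h) = \<beta> ?w (e i)" by (simp add: h_def fld_def \<beta>.diff_left)
  moreover have "fst h = e i" by (simp add: h_def fld_def)
  ultimately have "snd h - \<beta> (fst y) (fst h) - (1/2) *\<^sub>R (\<beta> ?w (fst h) + \<beta> (fst h) ?w)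
     = \<beta> ?w (e i) - (1/2) *\<^sub>R (\<beta> ?w (e i) + \<beta> (e i) ?w)" by simp
  also have "\<dots> = (1/2) *\<^sub>R (\<beta> ?w (e i) - \<beta> (e i) ?w)"
    by (simp only: vec_eq_iff vector_add_component vector_minus_component vector_scaleR_component)
      (simp add: field_simps)
  finally show ?thesis by (simp only: br_def T.scaleR)
qed

text \<open>The fourth power of the distance, which is a polynomial, and its horizontal derivatives of first and
  second order.\<close>

definition quart :: "('m, 'n) pt \<Rightarrow> ('m, 'n) pt \<Rightarrow> real" where
  "quart y x = (vrel y x \<bullet> vrel y x)\<^sup>2 + 16 * (zrel y x \<bullet> zrel y x)"

definition quart1 :: "'m \<Rightarrow> ('m, 'n) pt \<Rightarrow> ('m, 'n) pt \<Rightarrow> real" where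
  "quart1 i y x = 4 * (vrel y x \<bullet> vrel y x) * vrel y x $ i + 16 * (zrel y x \<bullet> br (fst x - fst y) (e i))"

definition quart2 :: "'m \<Rightarrow> 'm \<Rightarrow> ('m, 'n) pt \<Rightarrow> ('m, 'n) pt \<Rightarrow> real" where
  "quart2 j i y x = 8 * vrel y x $ j * vrel y x $ i + 4 * (vrel y x \<bullet> vrel y x) * (if i = j then 1 else 0)
     + 8 * (br (fst x - fst y) (e j) \<bullet> br (fst x - fst y) (e i)) + 16 * (zrel y x \<bullet> br (e j) (e i))"

lemma quart_has_derivative:
  obtains D where "(quart y has_derivative D) (at x)" "\<And>i. D (fld i x) = quart1 i y x"
proof
  let ?Z' = "\<lambda>h. T (snd h - \<beta> (fst y) (fst h) - (1/2) *\<^sub>R (\<beta> (fst x - fst y) (fst h) + \<beta> (fst h) (fst x - fst y)))"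
  show "(quart y has_derivative (\<lambda>h. 4 * (vrel y x \<bullet> vrel y x) * (vrel y x \<bullet> v (fst h)) + 32 * (zrel y x \<bullet> ?Z' h))) (at x)"
    unfolding quart_def[abs_def]
    by (rule derivative_eq_intros vrel_has_derivative zrel_has_derivative refl)+
      (simp add: fun_eq_iff inner_commute algebra_simps)
  show "4 * (vrel y x \<bullet> vrel y x) * (vrel y x \<bullet> v (fst (fld i x))) + 32 * (zrel y x \<bullet> ?Z' (fld i x)) = quart1 i y x" for i
    unfolding v_fld zrel_fld by (simp add: quart1_def inner_axis)
qed

lemma quart1_has_derivative:
  obtains D where "(quart1 i y has_derivative D) (at x)" "\<And>j. D (fld j x) = quart2 j i y x"
proof
  let ?Z' = "\<lambda>h. T (snd h - \<beta> (fst y) (fst h) - (1/2) *\<^sub>R (\<beta> (fst x - fst y) (fst h) + \<beta> (fst h) (fst x - fst y)))"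
  let ?D = "\<lambda>h. 8 * (vrel y x \<bullet> v (fst h)) * vrel y x $ i + 4 * (vrel y x \<bullet> vrel y x) * v (fst h) $ i
      + 16 * (?Z' h \<bullet> br (fst x - fst y) (e i)) + 16 * (zrel y x \<bullet> br (fst h) (e i))"
  have b: "((\<lambda>x. br (fst x - fst y) (e i)) has_derivative (\<lambda>h. br (fst h) (e i))) (at x)"
    by (rule bounded_linear.has_derivative[OF bounded_bilinear.bounded_linear_left[OF bounded_bilinear_br]])
      (auto intro!: derivative_eq_intros)
  show "(quart1 i y has_derivative ?D) (at x)"
    unfolding quart1_def[abs_def]
    by (rule derivative_eq_intros vrel_has_derivative zrel_has_derivative b
         bounded_linear.has_derivative[OF bounded_linear_vec_nth] refl)+
      (simp add: fun_eq_iff inner_commute algebra_simps)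
  show "?D (fld j x) = quart2 j i y x" for j
  proof -
    have "(axis j 1 :: real^'m) $ i = (if i = j then 1 else 0)" by (simp add: axis_def)
    then show ?thesis unfolding v_fld zrel_fld by (simp add: quart2_def inner_axis fld_def)
  qed
qed

text \<open>The kernel is the power \<open>-4 s\<close> of the distance; \<open>4 s = Q - \<delta>\<close> will be used.\<close>

definition kernel :: "real \<Rightarrow> ('m, 'n) pt \<Rightarrow> ('m, 'n) pt \<Rightarrow> real" where
  "kernel s y x = quart y x powr (- s)"

lemma quart_eq_gdist: "quart y x = gdist y x ^ 4"
  by (simp add: quart_def gdist_def hnorm_power4 rho_rel)

lemma quart_pos: "x \<noteq> y \<Longrightarrow> 0 < quart y x"
  using gdist_nonneg[of y x] gdist_eq_0_iff[of y x] by (auto simp: quart_eq_gdist less_le)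

lemma kernel_first:
  assumes "x \<noteq> y"
  shows "kernel s y differentiable (at x)"
    and "vf_apply (fld i) (kernel s y) x = - s * quart y x powr (- s - 1) * quart1 i y x"
proof -
  obtain D where D: "(quart y has_derivative D) (at x)" "\<And>i. D (fld i x) = quart1 i y x"
    by (rule quart_has_derivative[of y x]) blast
  have "((\<lambda>r. r powr (- s)) has_real_derivative (- s * quart y x powr (- s - 1))) (at (quart y x))"
    using quart_pos[OF assms] by (auto intro!: derivative_eq_intros)
  from has_derivative_compose[OF D(1) this[unfolded has_field_derivative_def]]
  have "(kernel s y has_derivative (\<lambda>h. - s * quart y x powr (- s - 1) * D h)) (at x)"
    by (simp add: kernel_def[abs_def])
  then have K: "(kernel s y has_derivative (\<lambda>h. - s * quart y x powr (- s - 1) * D h)) (at x)" .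
  then show "kernel s y differentiable (at x)" by (rule differentiableI)
  show "vf_apply (fld i) (kernel s y) x = - s * quart y x powr (- s - 1) * quart1 i y x"
    unfolding vf_apply_def frechet_derivative_at[OF K, symmetric] by (simp add: D(2))
qed

lemma kernel_second:
  assumes "x \<noteq> y"
  shows "vf_apply (fld i) (kernel s y) differentiable (at x)"
    and "vf_apply (fld j) (vf_apply (fld i) (kernel s y)) x =
      s * quart y x powr (- s - 2) * ((s + 1) * (quart1 j y x * quart1 i y x) - quart y x * quart2 j i y x)"
proof -
  let ?g = "\<lambda>x. - s * quart y x powr (- s - 1) * quart1 i y x"
  obtain D where D: "(quart y has_derivative D) (at x)" "\<And>i. D (fld i x) = quart1 i y x"
    by (rule quart_has_derivative[of y x]) blast
  obtain D' where D': "(quart1 i y has_derivative D') (at x)" "\<And>j. D' (fld j x) = quart2 j i y x"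
    by (rule quart1_has_derivative[of i y x]) blast
  have pos: "0 < quart y x" by (rule quart_pos[OF assms])
  have "((\<lambda>r. r powr (- s - 1)) has_real_derivative ((- s - 1) * quart y x powr (- s - 2))) (at (quart y x))"
  proof -
    have "- s - 1 - 1 = - s - 2" by simp
    then show ?thesis using has_real_derivative_powr[OF pos, of "- s - 1"] by (simp only:)
  qed
  from has_derivative_compose[OF D(1) this[unfolded has_field_derivative_def]]
  have P: "((\<lambda>x. quart y x powr (- s - 1)) has_derivative (\<lambda>h. (- s - 1) * quart y x powr (- s - 2) * D h)) (at x)"
    by simp
  have G: "(?g has_derivative (\<lambda>h. - s * (quart y x powr (- s - 1) * D' h
      + (- s - 1) * quart y x powr (- s - 2) * D h * quart1 i y x))) (at x)"
    by (rule derivative_eq_intros P D'(1) refl)+ (simp add: algebra_simps)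
  have U: "open (- {y})" "x \<in> - {y}" using assms by auto
  have eq: "vf_apply (fld i) (kernel s y) z = ?g z" if "z \<in> - {y}" for z
    using kernel_first(2)[of z y i s] that by auto
  have Gd: "?g differentiable (at x)" using G by (auto simp: differentiable_def)
  show "vf_apply (fld i) (kernel s y) differentiable (at x)"
    by (rule vf_apply_cong_open(1)[OF U eq Gd])
  have "vf_apply (fld j) (vf_apply (fld i) (kernel s y)) x = vf_apply (fld j) ?g x"
    by (rule vf_apply_cong_open(2)[OF U eq Gd])
  also have "\<dots> = - s * (quart y x powr (- s - 1) * quart2 j i y x
      + (- s - 1) * quart y x powr (- s - 2) * quart1 j y x * quart1 i y x)"
    unfolding vf_apply_def[of "fld j"] frechet_derivative_at[OF G, symmetric] by (simp add: D(2) D'(2))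
  also have "quart y x powr (- s - 1) = quart y x powr (- s - 2) * quart y x"
  proof -
    have "- s - 1 = (- s - 2) + 1" by simp
    then show ?thesis using powr_one[OF less_imp_le[OF pos]] by (simp only: powr_add)
  qed
  finally show "vf_apply (fld j) (vf_apply (fld i) (kernel s y)) x =
      s * quart y x powr (- s - 2) * ((s + 1) * (quart1 j y x * quart1 i y x) - quart y x * quart2 j i y x)"
    by (simp add: algebra_simps)
qed

lemma field_C2_kernel: "y \<notin> U \<Longrightarrow> field_C2 fld U (kernel s y)"
  unfolding field_C2_def by (metis kernel_first(1) kernel_second(1))

definition qf :: "real^'m^'m \<Rightarrow> (real^'m) \<Rightarrow> real" where "qf M x = (M *v x) \<bullet> x"

lemma qf_sum: "qf M x = (\<Sum>i\<in>UNIV. \<Sum>j\<in>UNIV. M $ i $ j * (x $ i * x $ j))"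
  by (simp add: qf_def matrix_vector_mult_def inner_vec_def sum_distrib_right sum_distrib_left algebra_simps)

lemma quart1_eq: "quart1 i y x = ((4 * (vrel y x \<bullet> vrel y x)) *\<^sub>R vrel y x + 16 *\<^sub>R J (zrel y x) (fst x - fst y)) $ i"
  by (simp add: quart1_def J_def)

text \<open>The horizontal gradient of the fourth power of the distance consists of two orthogonal parts, along
  \<open>v\<close> and along \<open>J\<^sub>z v\<close>.\<close>

lemma norm_quart1:
  fixes x y defines "w \<equiv> (4 * (vrel y x \<bullet> vrel y x)) *\<^sub>R vrel y x + 16 *\<^sub>R J (zrel y x) (fst x - fst y)"
  shows "(norm w)\<^sup>2 = 16 * (vrel y x \<bullet> vrel y x) * quart y x"
proof -
  have "vrel y x = v (fst x - fst y)" by (rule vrel_alt)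
  then have J: "J (zrel y x) (fst x - fst y) \<bullet> J (zrel y x) (fst x - fst y) = (zrel y x \<bullet> zrel y x) * (vrel y x \<bullet> vrel y x)"
    "J (zrel y x) (fst x - fst y) \<bullet> vrel y x = 0"
    using norm_J[of "zrel y x" "fst x - fst y"] J_perp[of "zrel y x" "fst x - fst y"]
    by (simp_all add: power2_norm_eq_inner)
  show ?thesis
    unfolding w_def power2_norm_eq_inner quart_def
    using J by (simp add: inner_add_left inner_add_right inner_commute power2_eq_square algebra_simps)
qed

text \<open>The Landis condition is what makes a power of the distance a subsolution off its pole.  For a
  function \<open>\<rho>\<^sup>-\<^sup>s\<close> one has to compare \<open>\<rho> L\<rho>\<close> with \<open>(s + 1) \<langle>A\<nabla>\<rho>, \<nabla>\<rho>\<rangle>\<close>.  With \<open>\<rho>\<close> the fourth power of the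
  distance, the gradient term is at least \<open>16 lo |v|\<^sup>2 \<rho>\<close>, while \<open>L\<rho>\<close> is at most \<open>4 |v|\<^sup>2\<close> times the
  left-hand side of the Landis condition: the vertical part contributes one form value \<open>\<langle>A J\<^sub>z v, J\<^sub>z v\<rangle>\<close> for
  each vector \<open>z\<close> of an orthonormal basis of the center, and the antisymmetric part of the second
  derivatives disappears because the matrix is symmetric.\<close>

lemma kernel_subsolution:
  fixes M :: "real^'m^'m"
  assumes sym: "transpose M = M"
    and lo: "\<And>x. lo * (norm x)\<^sup>2 \<le> qf M x" and hi: "\<And>x. qf M x \<le> hi * (norm x)\<^sup>2"
    and landis: "trace M + (2 * real CARD('n) + 2) * hi \<le> 4 * (s + 1) * lo"
    and "0 \<le> s" "x \<noteq> y"
  shows "0 \<le> (\<Sum>i\<in>UNIV. \<Sum>j\<in>UNIV. M $ i $ j * vf_apply (fld i) (vf_apply (fld j) (kernel s y)) x)"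
proof -
  define w where "w = (4 * (vrel y x \<bullet> vrel y x)) *\<^sub>R vrel y x + 16 *\<^sub>R J (zrel y x) (fst x - fst y)"
  define p where "p = fst x - fst y"
  have Vp: "vrel y x = v p" by (simp add: vrel_alt p_def)
  define q where "q = vrel y x \<bullet> vrel y x"
  have q: "0 \<le> q" by (simp add: q_def)
  have pos: "0 < quart y x" by (rule quart_pos) fact
  have symc: "M $ i $ j = M $ j $ i" for i j
    using sym by (simp add: transpose_def vec_eq_iff)
  have anti: "(\<Sum>i\<in>UNIV. \<Sum>j\<in>UNIV. M $ i $ j * (zrel y x \<bullet> br (e i) (e j))) = 0" (is "?S = 0")
  proof -
    have "?S = (\<Sum>j\<in>UNIV. \<Sum>i\<in>UNIV. M $ i $ j * (zrel y x \<bullet> br (e i) (e j)))" by (rule sum.swap)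
    also have "\<dots> = (\<Sum>j\<in>UNIV. \<Sum>i\<in>UNIV. - (M $ j $ i * (zrel y x \<bullet> br (e j) (e i))))"
      by (intro sum.cong refl) (subst br_skew, simp add: symc)
    also have "\<dots> = - ?S" by (simp add: sum_negf)
    finally show ?thesis by simp
  qed
  have J_comp: "J (axis k 1) p $ i = br p (e i) $ k" for k i
    by (simp add: J_def inner_axis' )
  have "(\<Sum>i\<in>UNIV. \<Sum>j\<in>UNIV. M $ i $ j * (br p (e i) \<bullet> br p (e j)))
     = (\<Sum>i\<in>UNIV. \<Sum>j\<in>UNIV. \<Sum>k\<in>UNIV. M $ i $ j * (J (axis k 1) p $ i * J (axis k 1) p $ j))"
    by (simp add: inner_vec_def sum_distrib_left J_comp)
  also have "\<dots> = (\<Sum>i\<in>UNIV. \<Sum>k\<in>UNIV. \<Sum>j\<in>UNIV. M $ i $ j * (J (axis k 1) p $ i * J (axis k 1) p $ j))"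
    by (intro sum.cong refl sum.swap)
  also have "\<dots> = (\<Sum>k\<in>UNIV. qf M (J (axis k 1) p))"
    unfolding qf_sum by (rule sum.swap)
  also have "\<dots> \<le> (\<Sum>k\<in>(UNIV :: 'n set). hi * q)"
    by (intro sum_mono order_trans[OF hi]) (simp add: norm_J Vp q_def flip: power2_norm_eq_inner)
  finally have vert: "(\<Sum>i\<in>UNIV. \<Sum>j\<in>UNIV. M $ i $ j * (br p (e i) \<bullet> br p (e j))) \<le> real CARD('n) * (hi * q)"
    by simp
  have diag: "(\<Sum>i\<in>UNIV. \<Sum>j\<in>UNIV. M $ i $ j * (if j = i then 1 else 0)) = trace M"
    by (simp add: trace_def if_distrib cong: if_cong)
  have "(\<Sum>i\<in>UNIV. \<Sum>j\<in>UNIV. M $ i $ j * quart2 i j y x)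
      = 8 * qf M (vrel y x) + 4 * q * (\<Sum>i\<in>UNIV. \<Sum>j\<in>UNIV. M $ i $ j * (if j = i then 1 else 0))
        + 8 * (\<Sum>i\<in>UNIV. \<Sum>j\<in>UNIV. M $ i $ j * (br p (e i) \<bullet> br p (e j))) + 16 * ?S"
    unfolding qf_sum sum_distrib_left sum.distrib[symmetric]
    by (intro sum.cong refl) (simp add: quart2_def p_def q_def algebra_simps)
  also have "\<dots> \<le> 8 * (hi * q) + 4 * q * trace M + 8 * (real CARD('n) * (hi * q))"
    using hi[of "vrel y x"] vert unfolding anti diag by (simp add: q_def power2_norm_eq_inner)
  also have "\<dots> = 4 * q * (trace M + (2 * real CARD('n) + 2) * hi)" by (simp add: algebra_simps)
  also have "\<dots> \<le> 4 * q * (4 * (s + 1) * lo)" using landis q by (intro mult_left_mono) auto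
  finally have second: "(\<Sum>i\<in>UNIV. \<Sum>j\<in>UNIV. M $ i $ j * quart2 i j y x) \<le> 16 * (s + 1) * lo * q"
    by (simp add: algebra_simps)
  have "(\<Sum>i\<in>UNIV. \<Sum>j\<in>UNIV. M $ i $ j * (quart1 i y x * quart1 j y x)) = qf M w"
    unfolding qf_sum by (simp add: quart1_eq w_def)
  moreover have "lo * (16 * q * quart y x) \<le> qf M w"
    using lo[of w] norm_quart1[of y x] by (simp add: w_def q_def)
  ultimately have first: "lo * (16 * q * quart y x) \<le> (\<Sum>i\<in>UNIV. \<Sum>j\<in>UNIV. M $ i $ j * (quart1 i y x * quart1 j y x))"
    by simp
  have "(\<Sum>i\<in>UNIV. \<Sum>j\<in>UNIV. M $ i $ j * vf_apply (fld i) (vf_apply (fld j) (kernel s y)) x)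
      = s * quart y x powr (- s - 2) * ((s + 1) * (\<Sum>i\<in>UNIV. \<Sum>j\<in>UNIV. M $ i $ j * (quart1 i y x * quart1 j y x))
          - quart y x * (\<Sum>i\<in>UNIV. \<Sum>j\<in>UNIV. M $ i $ j * quart2 i j y x))"
    unfolding sum_distrib_left sum_subtractf[symmetric] kernel_second(2)[OF \<open>x \<noteq> y\<close>]
    by (intro sum.cong refl) (simp add: algebra_simps)
  also have "\<dots> \<ge> 0"
  proof (intro mult_nonneg_nonneg)
    have "quart y x * (\<Sum>i\<in>UNIV. \<Sum>j\<in>UNIV. M $ i $ j * quart2 i j y x) \<le> quart y x * (16 * (s + 1) * lo * q)"
      using second pos by (intro mult_left_mono) auto
    also have "\<dots> = (s + 1) * (lo * (16 * q * quart y x))" by simp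
    also have "\<dots> \<le> (s + 1) * (\<Sum>i\<in>UNIV. \<Sum>j\<in>UNIV. M $ i $ j * (quart1 i y x * quart1 j y x))"
      using first \<open>0 \<le> s\<close> by (intro mult_left_mono) auto
    finally show "0 \<le> (s + 1) * (\<Sum>i\<in>UNIV. \<Sum>j\<in>UNIV. M $ i $ j * (quart1 i y x * quart1 j y x))
          - quart y x * (\<Sum>i\<in>UNIV. \<Sum>j\<in>UNIV. M $ i $ j * quart2 i j y x)" by simp
  qed (use \<open>0 \<le> s\<close> in auto)
  finally show ?thesis .
qed
end

section \<open>A minimum principle\<close>

context htype_coordinates begin

lemma fld_differentiable: "fld i differentiable (at x)"
proof -
  have "(fld i has_derivative (\<lambda>h. (0, \<beta> (fst h) (e i)))) (at x)"
    unfolding fld_def[abs_def]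
    by (auto intro!: derivative_eq_intros bounded_linear.has_derivative[OF \<beta>.bounded_linear_left])
  then show ?thesis by (rule differentiableI)
qed

text \<open>The integral curve of the field \<open>\<Sum> c\<^sub>i X\<^sub>i\<close> with \<open>a = \<Sum> c\<^sub>i e\<^sub>i\<close> starting in \<open>p\<close>.\<close>

definition line :: "('m, 'n) pt \<Rightarrow> real^'m \<Rightarrow> real \<Rightarrow> ('m, 'n) pt" where
  "line p a t = (fst p + t *\<^sub>R a, snd p + t *\<^sub>R \<beta> (fst p) a + (t\<^sup>2 / 2) *\<^sub>R \<beta> a a)"

lemma line_0: "line p a 0 = p" by (simp add: line_def)

lemma line_has_derivative:
  fixes c :: "'m \<Rightarrow> real"
  defines "a \<equiv> \<Sum>i\<in>UNIV. c i *\<^sub>R e i"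
  shows "(line p a has_derivative (\<lambda>h. h *\<^sub>R (\<Sum>i\<in>UNIV. c i *\<^sub>R fld i (line p a t)))) (at t)"
proof -
  have "(\<Sum>i\<in>UNIV. c i *\<^sub>R fld i (line p a t)) = (a, \<beta> (fst p + t *\<^sub>R a) a)"
    unfolding a_def fld_def line_def
    by (simp add: prod_eq_iff fst_sum snd_sum \<beta>.sum_right \<beta>.scaleR_right)
  also have "\<dots> = (a, \<beta> (fst p) a + t *\<^sub>R \<beta> a a)" by (simp add: \<beta>.add_left \<beta>.scaleR_left)
  finally have w: "(\<Sum>i\<in>UNIV. c i *\<^sub>R fld i (line p a t)) = (a, \<beta> (fst p) a + t *\<^sub>R \<beta> a a)" .
  show ?thesis
    unfolding w unfolding line_def[abs_def]
    by (auto intro!: derivative_eq_intros simp: fun_eq_iff scaleR_add_right power2_eq_square)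
qed

lemma derivative_along_line:
  fixes c :: "'m \<Rightarrow> real" and f :: "('m, 'n) pt \<Rightarrow> real"
  defines "a \<equiv> \<Sum>i\<in>UNIV. c i *\<^sub>R e i"
  assumes "f differentiable (at (line p a t))"
  shows "((\<lambda>t. f (line p a t)) has_real_derivative (\<Sum>j\<in>UNIV. c j * vf_apply (fld j) f (line p a t))) (at t)"
proof -
  have f: "(f has_derivative frechet_derivative f (at (line p a t))) (at (line p a t))"
    using assms by (simp add: frechet_derivative_works)
  interpret D: bounded_linear "frechet_derivative f (at (line p a t))"
    using f by (rule has_derivative_bounded_linear)
  have "((\<lambda>t. f (line p a t)) has_derivative
      (\<lambda>h. frechet_derivative f (at (line p a t)) (h *\<^sub>R (\<Sum>i\<in>UNIV. c i *\<^sub>R fld i (line p a t))))) (at t)"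
    using has_derivative_compose[OF line_has_derivative[of p c t, folded a_def] f] .
  then show ?thesis
    by (simp add: has_field_derivative_def D.scaleR D.sum vf_apply_def mult_commute_abs)
qed

text \<open>Along the integral curves of the horizontal fields the function has a one-dimensional minimum, so
  that the quadratic form of its horizontal second derivatives is nonnegative; pairing with a positive
  definite matrix keeps the sign.\<close>

lemma second_order_nonneg_at_min:
  fixes M :: "real^'m^'m"
  assumes U: "open U" "p \<in> U" and h: "field_C2 fld U h" and min: "\<And>x. x \<in> U \<Longrightarrow> h p \<le> h x"
    and sym: "transpose M = M" and pd: "\<And>x. x \<noteq> 0 \<Longrightarrow> 0 < qf M x"
  shows "0 \<le> (\<Sum>i\<in>UNIV. \<Sum>j\<in>UNIV. M $ i $ j * vf_apply (fld i) (vf_apply (fld j) h) p)"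
proof (rule definite_pairing_nonneg)
  show "M $ i $ j = M $ j $ i" for i j
    using sym by (simp add: transpose_def vec_eq_iff)
  show "0 < (\<Sum>i\<in>UNIV. \<Sum>j\<in>UNIV. M $ i $ j * x i * x j)" if "\<exists>i\<in>UNIV. x i \<noteq> 0" for x
    using pd[of "\<chi> i. x i"] that by (simp add: qf_sum vec_eq_iff mult.assoc)
  show "0 \<le> (\<Sum>i\<in>UNIV. \<Sum>j\<in>UNIV. vf_apply (fld i) (vf_apply (fld j) h) p * c i * c j)" for c
  proof -
    define a where "a = (\<Sum>i\<in>UNIV. c i *\<^sub>R e i)"
    have "isCont (line p a) 0"
      using line_has_derivative[of p c 0, folded a_def] by (rule has_derivative_continuous)
    then have "\<forall>\<^sub>F t in at 0. line p a t \<in> U"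
      using U by (auto simp: isCont_def line_0 intro: topological_tendstoD)
    then obtain r where r: "0 < r" "\<And>t. t \<noteq> 0 \<Longrightarrow> \<bar>t\<bar> < r \<Longrightarrow> line p a t \<in> U"
      by (auto simp: eventually_at)
    have inU: "line p a t \<in> U" if "\<bar>t\<bar> < r" for t
      using r(2)[of t] that U by (cases "t = 0") (auto simp: line_0)
    let ?g' = "\<lambda>t. \<Sum>j\<in>UNIV. c j * vf_apply (fld j) h (line p a t)"
    have "0 \<le> (\<Sum>j\<in>UNIV. c j * (\<Sum>i\<in>UNIV. c i * vf_apply (fld i) (vf_apply (fld j) h) (line p a 0)))"
    proof (rule second_derivative_nonneg_at_min[of r "\<lambda>t. h (line p a t)" ?g'])
      show "((\<lambda>t. h (line p a t)) has_real_derivative ?g' t) (at t)" if "\<bar>t\<bar> < r" for t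
        unfolding a_def by (rule derivative_along_line)
          (use h inU[OF that] in \<open>auto simp: field_C2_def a_def\<close>)
      show "h (line p a 0) \<le> h (line p a t)" if "\<bar>t\<bar> < r" for t
        using min[OF inU[OF that]] by (simp add: line_0)
      show "(?g' has_real_derivative (\<Sum>j\<in>UNIV. c j *
          (\<Sum>i\<in>UNIV. c i * vf_apply (fld i) (vf_apply (fld j) h) (line p a 0)))) (at 0)"
        unfolding a_def
        by (intro DERIV_sum DERIV_cmult derivative_along_line)
          (use h U in \<open>auto simp: field_C2_def line_0\<close>)
    qed (rule r)
    also have "\<dots> = (\<Sum>j\<in>UNIV. \<Sum>i\<in>UNIV. vf_apply (fld i) (vf_apply (fld j) h) p * c i * c j)"
      by (simp add: line_0 sum_distrib_left algebra_simps)
    also have "\<dots> = (\<Sum>i\<in>UNIV. \<Sum>j\<in>UNIV. vf_apply (fld i) (vf_apply (fld j) h) p * c i * c j)"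
      by (rule sum.swap)
    finally show ?thesis .
  qed
qed simp

text \<open>A function, bounded on compact sets, whose image under the operator is strictly positive.\<close>

definition barrier :: "('m, 'n) pt \<Rightarrow> real" where
  "barrier x = v (fst x) \<bullet> v (fst x)"

lemma field_C2_barrier: "field_C2 fld U barrier"
  and L_op_barrier: "L_op fld A barrier x = 2 * trace (A x)"
proof -
  have b: "(barrier has_derivative (\<lambda>h. 2 * (v (fst x) \<bullet> v (fst h)))) (at x)" for x
    unfolding barrier_def[abs_def]
    by (auto intro!: derivative_eq_intros v.has_derivative simp: inner_commute)
  have b1: "vf_apply (fld i) barrier = (\<lambda>x. 2 * v (fst x) $ i)" for i
    unfolding vf_apply_def frechet_derivative_at[OF b, symmetric]
    by (simp add: v_fld inner_axis)
  have b2: "((\<lambda>x. 2 * v (fst x) $ i) has_derivative (\<lambda>h. 2 * v (fst h) $ i)) (at x)" for i and x :: "('m, 'n) pt"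
    by (auto intro!: derivative_eq_intros v.has_derivative bounded_linear.has_derivative[OF bounded_linear_vec_nth])
  have b3: "vf_apply (fld j) (\<lambda>x. 2 * v (fst x) $ i) x = 2 * (if j = i then 1 else 0)" for i j x
    unfolding vf_apply_def frechet_derivative_at[OF b2, symmetric] v_fld by (simp add: axis_def)
  show "field_C2 fld U barrier"
    unfolding field_C2_def b1 using differentiableI[OF b] differentiableI[OF b2] by blast
  show "L_op fld A barrier x = 2 * trace (A x)"
    unfolding L_op_def b1 b3
    by (simp add: trace_def if_distrib sum_distrib_left mult.commute cong: if_cong)
qed

text \<open>Subtracting a small multiple of the barrier makes the supersolution inequality strict and hence
  excludes interior minima below the boundary values.\<close>

lemma minimum_principle:
  assumes K: "compact K" and U: "open U" "U \<subseteq> K"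
    and h: "continuous_on K h" "field_C2 fld U h"
    and A: "\<And>x. x \<in> U \<Longrightarrow> transpose (A x) = A x" "\<And>x y. x \<in> U \<Longrightarrow> y \<noteq> 0 \<Longrightarrow> 0 < qf (A x) y"
    and super: "\<And>x. x \<in> U \<Longrightarrow> L_op fld A h x \<le> 0"
    and bdry: "\<And>x. x \<in> K - U \<Longrightarrow> b \<le> h x"
    and p: "p \<in> K"
  shows "b \<le> h p"
proof (rule ccontr)
  assume "\<not> b \<le> h p"
  then have hp: "0 < b - h p" by simp
  have cb: "continuous_on K barrier"
    unfolding barrier_def[abs_def] by (intro continuous_intros v.continuous_on)
  have b0: "0 \<le> barrier x" for x by (simp add: barrier_def)
  obtain B where B: "\<And>x. x \<in> K \<Longrightarrow> barrier x \<le> B"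
    using continuous_attains_sup[OF K _ cb] p by blast
  \<comment> \<open>small enough for \<open>\<tau>\<close> times the barrier not to make up the deficit \<open>b - h p\<close>\<close>
  define \<tau> where "\<tau> = (b - h p) / (2 * (B + 1))"
  have "0 \<le> B" using B[OF p] b0[of p] by linarith
  then have "0 < \<tau>" and eq: "\<tau> * (2 * (B + 1)) = b - h p"
    using hp by (auto simp: \<tau>_def field_simps)
  then have "0 \<le> \<tau> * B" using \<open>0 \<le> B\<close> by simp
  then have \<tau>: "0 < \<tau>" "\<tau> * B < b - h p"
    using \<open>0 < \<tau>\<close> eq by (auto simp: algebra_simps)
  let ?h = "\<lambda>x. h x + (- \<tau>) * barrier x"
  have "continuous_on K ?h" by (intro continuous_intros h cb)
  then obtain q where q: "q \<in> K" "\<And>x. x \<in> K \<Longrightarrow> ?h q \<le> ?h x"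
    using continuous_attains_inf[OF K] p by blast
  have hq: "?h q \<le> h p" using q(2)[OF p] b0[of p] \<tau> mult_nonneg_nonneg[of \<tau> "barrier p"] by linarith
  have qU: "q \<in> U"
  proof (rule ccontr)
    assume "q \<notin> U"
    then have "b \<le> h q" using bdry q by auto
    moreover have "\<tau> * barrier q \<le> \<tau> * B" using B[OF q(1)] \<tau> by simp
    ultimately show False using hq \<tau> by simp
  qed
  have C2: "field_C2 fld U ?h" and L: "L_op fld A ?h q = L_op fld A h q + (- \<tau>) * L_op fld A barrier q"
    using field_C2_lincomb[OF U(1) h(2) field_C2_barrier, where c = "- \<tau>"] qU by blast+
  have "0 < trace (A q)"
    unfolding trace_def
  proof (rule sum_pos)
    show "0 < A q $ i $ i" for i
    proof -
      have "(axis i 1 :: real^'m) \<noteq> 0" by (simp add: axis_eq_0_iff)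
      from A(2)[OF qU this] show ?thesis
        by (simp add: qf_def inner_axis matrix_vector_mul_component)
    qed
  qed auto
  then have "L_op fld A ?h q < 0"
    unfolding L L_op_barrier using super[OF qU] \<tau>(1) mult_pos_pos[of \<tau> "2 * trace (A q)"] by linarith
  moreover have "0 \<le> L_op fld A ?h q"
    unfolding L_op_def
    by (rule second_order_nonneg_at_min[OF U(1) qU C2 _ A(1)[OF qU] A(2)[OF qU]])
      (use q(2) U in auto)
  ultimately show False by simp
qed

end

section \<open>Weighted sums of inverse powers\<close>

text \<open>The contributions of the dyadic shells form a geometric series because \<open>\<alpha> < q\<close>.  The sum is the potential
  of finitely many point masses, and the bound does not depend on their number, so that it can be
  applied to arbitrarily fine discretisations of a measure.\<close>

lemma weighted_inverse_power_sum_le: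
  fixes c d :: "'i \<Rightarrow> real" and q \<alpha> :: real
  assumes I: "finite I" and c: "\<And>i. i \<in> I \<Longrightarrow> 0 \<le> c i"
    and d: "\<And>i. i \<in> I \<Longrightarrow> 0 < d i" "\<And>i. i \<in> I \<Longrightarrow> d i \<le> D"
    and growth: "\<And>r. 0 < r \<Longrightarrow> (\<Sum>i\<in>{i \<in> I. d i \<le> r}. c i) \<le> C * r powr q"
    and "0 < D" "0 \<le> C" and \<alpha>: "0 \<le> \<alpha>" "\<alpha> < q"
  shows "(\<Sum>i\<in>I. c i * d i powr - \<alpha>) \<le> C * 2 powr \<alpha> * D powr (q - \<alpha>) / (1 - 2 powr (\<alpha> - q))"
proof -
  define \<theta> :: real where "\<theta> = 2 powr (\<alpha> - q)"
  have \<theta>: "0 < \<theta>" "\<theta> < 1" using \<alpha> by (auto simp: \<theta>_def powr_less_one)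
  \<comment> \<open>the index of the dyadic shell: \<open>D / 2\<^sup>k\<^sup>+\<^sup>1 < d i \<le> D / 2\<^sup>k\<close>\<close>
  define k where "k = (\<lambda>i. LEAST n. D < d i * 2 ^ Suc n)"
  have k: "D < d i * 2 ^ Suc (k i)" "d i * 2 ^ k i \<le> D" if "i \<in> I" for i
  proof -
    obtain n where "D / d i < 2 ^ n" using real_arch_pow[of 2 "D / d i"] by auto
    also have "(2::real) ^ n \<le> 2 ^ Suc n" by simp
    finally have n: "D < d i * 2 ^ Suc n" using d(1)[OF that] by (simp add: field_simps)
    show "D < d i * 2 ^ Suc (k i)" unfolding k_def by (rule LeastI) (rule n)
    show "d i * 2 ^ k i \<le> D"
    proof (cases "k i")
      case 0
      then show ?thesis using d(2)[OF that] by simp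
    next
      case (Suc m)
      then have "\<not> D < d i * 2 ^ Suc m" using not_less_Least[of m "\<lambda>n. D < d i * 2 ^ Suc n"] by (simp add: k_def)
      then show ?thesis using Suc by simp
    qed
  qed
  have shell: "(\<Sum>i\<in>{i \<in> I. k i = n}. c i * d i powr - \<alpha>) \<le> C * 2 powr \<alpha> * D powr (q - \<alpha>) * \<theta> ^ n" for n
  proof -
    let ?r = "D / 2 ^ n"
    have r: "0 < ?r" using \<open>0 < D\<close> by simp
    have "(\<Sum>i\<in>{i \<in> I. k i = n}. c i * d i powr - \<alpha>) \<le> (\<Sum>i\<in>{i \<in> I. k i = n}. c i * (?r / 2) powr - \<alpha>)"
    proof (intro sum_mono mult_left_mono)
      fix i assume "i \<in> {i \<in> I. k i = n}"
      then have i: "i \<in> I" "k i = n" by auto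
      show "0 \<le> c i" by (rule c[OF i(1)])
      have "?r / 2 \<le> d i" using k(1)[OF i(1)] i(2) by (simp add: field_simps)
      then show "d i powr - \<alpha> \<le> (?r / 2) powr - \<alpha>"
        using r \<alpha> by (intro powr_mono2') auto
    qed
    also have "\<dots> = (?r / 2) powr - \<alpha> * (\<Sum>i\<in>{i \<in> I. k i = n}. c i)"
      by (simp add: sum_distrib_right mult.commute)
    also have "(\<Sum>i\<in>{i \<in> I. k i = n}. c i) \<le> (\<Sum>i\<in>{i \<in> I. d i \<le> ?r}. c i)"
    proof (rule sum_mono2)
      show "{i \<in> I. k i = n} \<subseteq> {i \<in> I. d i \<le> ?r}"
        using k(2) by (auto simp: field_simps)
    qed (use I c in auto)
    also have "\<dots> \<le> C * ?r powr q" by (rule growth[OF r])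
    finally have "(\<Sum>i\<in>{i \<in> I. k i = n}. c i * d i powr - \<alpha>) \<le> (?r / 2) powr - \<alpha> * (C * ?r powr q)"
      by (simp add: mult_left_mono)
    also have "(?r / 2) powr - \<alpha> = 2 powr \<alpha> * ?r powr - \<alpha>"
      using r by (simp add: powr_divide powr_minus powr_mult field_simps)
    also have "2 powr \<alpha> * ?r powr - \<alpha> * (C * ?r powr q) = C * 2 powr \<alpha> * ?r powr (q - \<alpha>)"
      by (simp add: powr_diff powr_minus field_simps)
    also have "?r powr (q - \<alpha>) = D powr (q - \<alpha>) * \<theta> ^ n"
    proof -
      have "(2 ^ n) powr (\<alpha> - q) = \<theta> ^ n"
        by (simp add: \<theta>_def powr_powr mult.commute flip: powr_realpow)
      moreover have "(2 ^ n :: real) powr (\<alpha> - q) = inverse ((2 ^ n) powr (q - \<alpha>))"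
        by (simp flip: powr_minus)
      ultimately show ?thesis using \<open>0 < D\<close> by (simp add: powr_divide field_simps)
    qed
    finally show ?thesis by (simp add: mult.assoc)
  qed
  let ?B = "C * 2 powr \<alpha> * D powr (q - \<alpha>)"
  have B: "0 \<le> ?B" using \<open>0 \<le> C\<close> by simp
  have "(\<Sum>i\<in>I. c i * d i powr - \<alpha>) = (\<Sum>n\<in>k ` I. \<Sum>i\<in>{i \<in> I. k i = n}. c i * d i powr - \<alpha>)"
    by (rule sum.image_gen[OF I])
  also have "\<dots> \<le> (\<Sum>n\<in>k ` I. ?B * \<theta> ^ n)" by (intro sum_mono shell)
  also have "\<dots> = ?B * (\<Sum>n\<in>k ` I. \<theta> ^ n)" by (simp add: sum_distrib_left)
  also have "(\<Sum>n\<in>k ` I. \<theta> ^ n) \<le> (\<Sum>n. \<theta> ^ n)"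
    using I \<theta> by (intro sum_le_suminf summable_geometric) auto
  also have "\<dots> = 1 / (1 - \<theta>)" using \<theta> by (intro suminf_geometric) auto
  finally show ?thesis using B by (simp add: \<theta>_def mult_left_mono)
qed

section \<open>Volumes of balls\<close>

lemma dil_eq_sum_Basis:
  fixes x :: "('m::finite, 'n::finite) pt"
  shows "dil r x = 0 + (\<Sum>j\<in>Basis. ((if snd j = 0 then r else r\<^sup>2) * (x \<bullet> j)) *\<^sub>R j)"
proof -
  have inj: "inj_on (\<lambda>u::real^'m. (u, 0 :: real^'n)) Basis" "inj_on (\<lambda>u::real^'n. (0 :: real^'m, u)) Basis"
    by (auto intro: inj_onI)
  have disj: "(\<lambda>u::real^'m. (u, 0 :: real^'n)) ` Basis \<inter> (\<lambda>u::real^'n. (0 :: real^'m, u)) ` Basis = {}"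
    by auto
  have "(\<Sum>j\<in>Basis. ((if snd j = 0 then r else r\<^sup>2) * (x \<bullet> j)) *\<^sub>R j)
     = (\<Sum>u\<in>Basis. (r * (fst x \<bullet> u)) *\<^sub>R (u, 0)) + (\<Sum>u\<in>Basis. (r\<^sup>2 * (snd x \<bullet> u)) *\<^sub>R (0, u))"
    unfolding Basis_prod_def
    by (subst sum.union_disjoint) (auto simp: disj sum.reindex inj inner_Pair_0 intro!: sum.cong)
  also have "\<dots> = dil r x"
    by (simp add: dil_def prod_eq_iff fst_sum snd_sum euclidean_representation flip: scaleR_scaleR scaleR_sum_right)
  finally show ?thesis by simp
qed

lemma emeasure_dil_vimage:
  fixes S :: "('m::finite, 'n::finite) pt set"
  assumes "0 < r" and S: "S \<in> sets borel"
  shows "emeasure lborel S = ennreal (r ^ (CARD('m) + 2 * CARD('n))) * emeasure lborel (dil r -` S)"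
proof -
  define c :: "('m, 'n) pt \<Rightarrow> real" where "c j = (if snd j = 0 then r else r\<^sup>2)" for j
  have inj: "inj_on (\<lambda>u::real^'m. (u, 0 :: real^'n)) Basis" "inj_on (\<lambda>u::real^'n. (0 :: real^'m, u)) Basis"
    by (auto intro: inj_onI)
  have disj: "(\<lambda>u::real^'m. (u, 0 :: real^'n)) ` Basis \<inter> (\<lambda>u::real^'n. (0 :: real^'m, u)) ` Basis = {}"
    by auto
  have "(\<Prod>j\<in>Basis. \<bar>c j\<bar>) = (\<Prod>u\<in>(Basis :: (real^'m) set). \<bar>c (u, 0)\<bar>) * (\<Prod>u\<in>(Basis :: (real^'n) set). \<bar>c (0, u)\<bar>)"
    unfolding Basis_prod_def
    by (subst prod.union_disjoint) (simp_all add: disj prod.reindex inj)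
  also have "(\<Prod>u\<in>(Basis :: (real^'m) set). \<bar>c (u, 0)\<bar>) = (\<Prod>u\<in>(Basis :: (real^'m) set). r)"
    using \<open>0 < r\<close> by (intro prod.cong refl) (simp add: c_def)
  also have "(\<Prod>u\<in>(Basis :: (real^'n) set). \<bar>c (0, u)\<bar>) = (\<Prod>u\<in>(Basis :: (real^'n) set). r\<^sup>2)"
    using \<open>0 < r\<close> by (intro prod.cong refl) (auto simp add: c_def)
  also have "(\<Prod>u\<in>(Basis :: (real^'m) set). r) * (\<Prod>u\<in>(Basis :: (real^'n) set). r\<^sup>2) = r ^ (CARD('m) + 2 * CARD('n))"
    by (simp add: power_add power_mult)
  finally have prod: "(\<Prod>j\<in>Basis. \<bar>c j\<bar>) = r ^ (CARD('m) + 2 * CARD('n))" .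
  have c: "c j \<noteq> 0" for j using \<open>0 < r\<close> by (simp add: c_def)
  have m: "dil r \<in> borel \<rightarrow>\<^sub>M (borel :: ('m, 'n) pt measure)"
    unfolding dil_def[abs_def] by (intro borel_measurable_continuous_onI continuous_intros)
  have D: "dil r = (\<lambda>x. 0 + (\<Sum>j\<in>Basis. (c j * (x \<bullet> j)) *\<^sub>R j))"
    by (rule ext) (simp only: dil_eq_sum_Basis c_def)
  have "(lborel :: ('m, 'n) pt measure) = density (distr lborel borel (dil r)) (\<lambda>_. ennreal (\<Prod>j\<in>Basis. \<bar>c j\<bar>))"
    unfolding D by (rule lborel_affine_euclidean) (rule c)
  from arg_cong[OF this, of "\<lambda>M. emeasure M S"]
  have "emeasure lborel S = emeasure (density (distr lborel borel (dil r)) (\<lambda>_. ennreal (\<Prod>j\<in>Basis. \<bar>c j\<bar>))) S" .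
  also have "\<dots> = ennreal (\<Prod>j\<in>Basis. \<bar>c j\<bar>) * emeasure lborel (dil r -` S)"
    using S m by (subst emeasure_density) (auto simp: nn_integral_cmult emeasure_distr)
  finally show ?thesis unfolding prod .
qed

context htype_coordinates begin

text \<open>A left translation maps every vertical slice to a translate of another vertical slice, hence the
  claim follows from Fubini's theorem.\<close>

lemma emeasure_gmul_vimage:
  assumes S: "S \<in> sets borel"
  shows "emeasure lborel (gmul y -` S) = emeasure lborel S"
proof -
  have S': "S \<in> sets (lborel \<Otimes>\<^sub>M lborel)" using S by (simp only: lborel_prod sets_lborel)
  have "continuous_on UNIV (gmul y)"
    unfolding gmul_def[abs_def]
    by (intro continuous_intros \<beta>.continuous_on)
  then have "gmul y -` S \<in> sets borel"
    using measurable_sets[OF borel_measurable_continuous_onI S] by simp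
  then have "emeasure lborel (gmul y -` S)
      = (\<integral>\<^sup>+s. emeasure lborel (Pair s -` (gmul y -` S)) \<partial>lborel)"
    unfolding lborel_prod[symmetric]
    by (intro lborel.emeasure_pair_measure_alt) (simp only: lborel_prod sets_lborel)
  also have "\<dots> = (\<integral>\<^sup>+s. emeasure lborel (Pair (fst y + s) -` S) \<partial>lborel)"
  proof (intro nn_integral_cong)
    fix s :: "real^'m"
    let ?t = "snd y + \<beta> (fst y) s"
    have "Pair (fst y + s) -` S \<in> sets borel"
      using measurable_sets[OF borel_measurable_continuous_onI S, of "Pair (fst y + s)"]
      by (simp add: continuous_on_Pair)
    moreover have "Pair s -` (gmul y -` S) = (+) ?t -` (Pair (fst y + s) -` S)"
      by (auto simp: gmul_def algebra_simps)
    ultimately show "emeasure lborel (Pair s -` (gmul y -` S)) = emeasure lborel (Pair (fst y + s) -` S)"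
      using emeasure_distr[of "(+) ?t" lborel borel "Pair (fst y + s) -` S"] by (simp add: lborel_distr_plus)
  qed
  also have "\<dots> = (\<integral>\<^sup>+s. emeasure lborel (Pair s -` S) \<partial>distr lborel borel ((+) (fst y)))"
  proof (rule nn_integral_distr[symmetric])
    show "(\<lambda>s. emeasure lborel (Pair s -` S)) \<in> borel_measurable (distr lborel borel ((+) (fst y)))"
      using lborel.measurable_emeasure_Pair[OF S'] by simp
  qed simp
  also have "\<dots> = emeasure (lborel \<Otimes>\<^sub>M lborel) S"
    by (simp only: lborel.emeasure_pair_measure_alt[OF S'] lborel_distr_plus)
  finally show ?thesis by (simp add: lborel_prod)
qed

lemma hnorm_dil: "0 \<le> r \<Longrightarrow> hnorm (dil r x) = r * hnorm x"
proof -
  assume r: "0 \<le> r"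
  have "rho (dil r x) = r ^ 4 * rho x"
  proof -
    have "zc (dil r x) = r\<^sup>2 *\<^sub>R zc x"
      by (simp add: zc_def dil_def \<beta>.scaleR_left \<beta>.scaleR_right T.scaleR T.diff power2_eq_square algebra_simps)
    then show ?thesis
      by (simp add: rho_def dil_def v.scaleR power_mult_distrib algebra_simps flip: power_mult)
  qed
  then show ?thesis using r by (simp add: hnorm_def real_root_mult real_root_power_cancel)
qed

lemma compact_hnorm_le: "compact {x. hnorm x \<le> r}"
proof -
  have cont: "continuous_on UNIV hnorm"
    unfolding hnorm_def[abs_def] rho_def zc_def
    by (intro continuous_intros \<beta>.continuous_on v.continuous_on T.continuous_on)
  obtain a where a: "0 < a" "\<And>s. a * norm s \<le> norm (v s)"
    using linear_inj_bounded_below_pos[of v] inj_v v.linear_axioms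
    by (auto simp: linear_injective_0)
  obtain b where b: "0 < b" "\<And>s. b * norm s \<le> norm (T s)"
    using linear_inj_bounded_below_pos[of T] inj_T T.linear_axioms
    by (auto simp: linear_injective_0)
  obtain k where k: "\<And>s t. norm (\<beta> s t) \<le> norm s * norm t * k" "0 < k" using \<beta>.pos_bounded by blast
  have "norm x \<le> r / a + (r\<^sup>2 / (4 * b) + (r / a) * (r / a) * k)" if x: "hnorm x \<le> r" for x
  proof -
    have r: "0 \<le> r" using hnorm_nonneg[of x] x by simp
    have 1: "norm (fst x) \<le> r / a"
      using a(2)[of "fst x"] norm_v_le_hnorm[of x] x a(1) by (simp add: field_simps)
    have "norm (4 *\<^sub>R zc x) \<le> (hnorm x)\<^sup>2"
      unfolding hnorm_power2 by (simp add: norm_Pair) (simp add: real_le_rsqrt power_mult_distrib)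
    also have "\<dots> \<le> r\<^sup>2" using x hnorm_nonneg by (intro power_mono) auto
    finally have z: "norm (zc x) \<le> r\<^sup>2 / 4" by simp
    let ?w = "snd x - (1/2) *\<^sub>R \<beta> (fst x) (fst x)"
    have 2: "norm ?w \<le> r\<^sup>2 / (4 * b)"
      using b(2)[of ?w] z b(1) by (simp add: zc_def field_simps)
    have "norm (\<beta> (fst x) (fst x)) \<le> norm (fst x) * norm (fst x) * k" by (rule k(1))
    also have "\<dots> \<le> (r / a) * (r / a) * k" using 1 k(2) r a by (intro mult_mono) auto
    finally have 3: "norm (\<beta> (fst x) (fst x)) \<le> (r / a) * (r / a) * k" .
    have "norm (snd x) \<le> norm ?w + norm ((1/2) *\<^sub>R \<beta> (fst x) (fst x))" 
      using norm_triangle_ineq[of ?w "(1/2) *\<^sub>R \<beta> (fst x) (fst x)"] by simp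
    also have "norm ((1/2) *\<^sub>R \<beta> (fst x) (fst x)) \<le> norm (\<beta> (fst x) (fst x))" by simp
    finally have "norm (snd x) \<le> r\<^sup>2 / (4 * b) + (r / a) * (r / a) * k" using 2 3 by linarith
    then show ?thesis using 1 norm_Pair_le[of "fst x" "snd x"] by simp
  qed
  then have "bounded {x. hnorm x \<le> r}" by (auto simp: bounded_iff)
  moreover have "closed {x. hnorm x \<le> r}" by (intro closed_Collect_le cont continuous_intros)
  ultimately show ?thesis by (simp add: compact_eq_bounded_closed)
qed

lemma continuous_gdist1: "continuous_on S (gdist y)" "continuous_on S (\<lambda>x. gdist x y)"
  using continuous_gdist[of S "\<lambda>_. y" "\<lambda>x. x"] continuous_gdist[of S "\<lambda>x. x" "\<lambda>_. y"] by auto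

lemma compact_gdist_le: "compact {x. gdist y x \<le> r}"
proof -
  have "{x. gdist y x \<le> r} = gmul y ` {x. hnorm x \<le> r}"
  proof (intro set_eqI iffI)
    fix x assume "x \<in> {x. gdist y x \<le> r}"
    then show "x \<in> gmul y ` {x. hnorm x \<le> r}"
      by (intro image_eqI[of _ _ "gmul (ginv y) x"]) (auto simp: gmul_ginv_cancel gdist_def)
  qed (auto simp: gmul_ginv_cancel gdist_def)
  moreover have "continuous_on {x. hnorm x \<le> r} (gmul y)"
    unfolding gmul_def[abs_def] by (intro continuous_intros \<beta>.continuous_on)
  ultimately show ?thesis by (simp add: compact_continuous_image compact_hnorm_le)
qed

lemma open_gdist_less: "open {x. gdist y x < r}"
  by (intro open_Collect_less continuous_gdist1 continuous_intros)

lemma lmeasurable_gdist_less: "{x. gdist y x < r} \<in> lmeasurable"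
proof (rule lmeasurable_open[OF _ open_gdist_less])
  show "bounded {x. gdist y x < r}"
    by (rule bounded_subset[OF compact_imp_bounded[OF compact_gdist_le[of y r]]]) auto
qed

definition ball_vol :: real where "ball_vol = measure lebesgue {x. hnorm x < 1}"

lemma gdist_0: "gdist 0 = hnorm"
  by (simp add: fun_eq_iff gdist_def gmul_def ginv_def \<beta>.zero_left)

lemma ball_vol_pos: "0 < ball_vol"
proof -
  have lm: "{x. hnorm x < 1} \<in> lmeasurable" using lmeasurable_gdist_less[of 0 1] by (simp add: gdist_0)
  have "open {x. hnorm x < 1}" using open_gdist_less[of 0 1] by (simp add: gdist_0)
  moreover have "0 \<in> {x. hnorm x < 1}" using hnorm_eq_0_iff[of 0] by simp
  ultimately have "\<not> negligible {x. hnorm x < 1}" using open_not_negligible by blast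
  then have "ball_vol \<noteq> 0" using lm by (simp add: ball_vol_def negligible_iff_measure0)
  then show ?thesis by (simp add: ball_vol_def less_le)
qed

lemma measure_gdist_less:
  assumes "0 < r"
  shows "measure lebesgue {x. gdist y x < r} = r ^ (CARD('m) + 2 * CARD('n)) * ball_vol"
proof -
  have hnorm: "{x. hnorm x < s} \<in> sets borel" for s
    using open_gdist_less[of 0 s] by (simp add: gdist_0)
  have "{x. gdist y x < r} = gmul (ginv y) -` {x. hnorm x < r}" by (auto simp: gdist_def)
  then have "emeasure lborel {x. gdist y x < r} = emeasure lborel {x. hnorm x < r}"
    by (simp only: emeasure_gmul_vimage[OF hnorm])
  also have "\<dots> = ennreal (r ^ (CARD('m) + 2 * CARD('n))) * emeasure lborel (dil r -` {x. hnorm x < r})"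
    by (rule emeasure_dil_vimage[OF assms hnorm])
  also have "dil r -` {x. hnorm x < r} = {x. hnorm x < 1}"
    using assms by (auto simp: hnorm_dil)
  finally have "measure lborel {x. gdist y x < r} = r ^ (CARD('m) + 2 * CARD('n)) * measure lborel {x. hnorm x < 1}"
    using assms by (simp add: measure_def enn2real_mult)
  then show ?thesis using hnorm[of 1] open_gdist_less[of y r] by (simp add: ball_vol_def measure_completion)
qed

end

section \<open>Discretisation of the potential\<close>

lemma disjoint_pieces_of_cover:
  assumes "finite I" "F \<in> lmeasurable" "F \<subseteq> (\<Union>i\<in>I. B i)" "\<And>i. i \<in> I \<Longrightarrow> B i \<in> sets lebesgue"
  shows "\<exists>P. (\<forall>i\<in>I. P i \<in> lmeasurable \<and> P i \<subseteq> B i) \<and> disjoint_family_on P I \<and> (\<Union>i\<in>I. P i) = F"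
  using assms
proof (induction I arbitrary: F rule: finite_induct)
  case empty
  then show ?case by (auto simp: disjoint_family_on_def)
next
  case (insert k I)
  have "F - B k \<in> lmeasurable" "F \<inter> B k \<in> lmeasurable"
    using insert.prems by (auto intro: fmeasurable_Diff fmeasurable_Int_fmeasurable)
  have sub: "F - B k \<subseteq> (\<Union>i\<in>I. B i)" using insert.prems(2) by auto
  with \<open>F - B k \<in> lmeasurable\<close>
  obtain P where P: "\<forall>i\<in>I. P i \<in> lmeasurable \<and> P i \<subseteq> B i" "disjoint_family_on P I"
    "(\<Union>i\<in>I. P i) = F - B k"
    using insert.IH[of "F - B k"] sub insert.prems(3) by blast
  let ?P = "P(k := F \<inter> B k)"
  have "(\<forall>i\<in>insert k I. ?P i \<in> lmeasurable \<and> ?P i \<subseteq> B i) \<and> disjoint_family_on ?P (insert k I)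
      \<and> (\<Union>i\<in>insert k I. ?P i) = F"
  proof (intro conjI)
    show "\<forall>i\<in>insert k I. ?P i \<in> lmeasurable \<and> ?P i \<subseteq> B i"
      using P \<open>F \<inter> B k \<in> lmeasurable\<close> by auto
    have I: "?P i = P i" if "i \<in> I" for i using that insert.hyps by auto
    show "(\<Union>i\<in>insert k I. ?P i) = F"
      using P(3) I by (auto simp del: fun_upd_apply simp add: fun_upd_same)
    have k: "P i \<inter> B k = {}" if "i \<in> I" for i using P(3) that by blast
    show "disjoint_family_on ?P (insert k I)"
      unfolding disjoint_family_on_def
    proof (intro ballI impI)
      fix i j assume ij: "i \<in> insert k I" "j \<in> insert k I" "i \<noteq> j"
      show "?P i \<inter> ?P j = {}"
      proof (cases "i = k \<or> j = k")
        case True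
        then show ?thesis using ij k[of i] k[of j] I[of i] I[of j] by auto
      next
        case False
        then show ?thesis using ij P(2) I[of i] I[of j] by (auto simp: disjoint_family_on_def)
      qed
    qed
  qed
  then show ?case by blast
qed

lemma M_class_form_bounds:
  fixes M :: "real^'m::finite^'m"
  assumes M: "M \<in> M_class lam Lam"
  shows "(INF \<xi>\<in>{\<xi>. norm \<xi> = 1}. (M *v \<xi>) \<bullet> \<xi>) * (norm x)\<^sup>2 \<le> (M *v x) \<bullet> x"
    and "(M *v x) \<bullet> x \<le> (SUP \<xi>\<in>{\<xi>. norm \<xi> = 1}. (M *v \<xi>) \<bullet> \<xi>) * (norm x)\<^sup>2"
proof -
  let ?f = "\<lambda>\<xi>. (M *v \<xi>) \<bullet> \<xi>" and ?S = "{\<xi>::real^'m. norm \<xi> = 1}"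
  have "lam \<le> ?f \<xi>" "?f \<xi> \<le> Lam" if "\<xi> \<in> ?S" for \<xi>
    using M that by (auto simp: M_class_def dest!: spec[of _ \<xi>])
  then have bdd: "bdd_below (?f ` ?S)" "bdd_above (?f ` ?S)" by (auto intro!: bdd_belowI2 bdd_aboveI2)
  have "(INF \<xi>\<in>?S. ?f \<xi>) * (norm x)\<^sup>2 \<le> ?f x \<and> ?f x \<le> (SUP \<xi>\<in>?S. ?f \<xi>) * (norm x)\<^sup>2"
  proof (cases "x = 0")
    case False
    define y where "y = x /\<^sub>R norm x"
    have y: "y \<in> ?S" and "x = norm x *\<^sub>R y" using False by (simp_all add: y_def)
    then have "?f x = ?f (norm x *\<^sub>R y)" by simp
    also have "\<dots> = (norm x)\<^sup>2 * ?f y"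
      by (simp only: matrix_vector_mult_scaleR inner_scaleR_left inner_scaleR_right power2_eq_square mult.assoc)
    finally have fx: "?f x = ?f y * (norm x)\<^sup>2" by simp
    show ?thesis
      unfolding fx using cINF_lower[OF bdd(1) y] cSUP_upper[OF y bdd(2)]
      by (intro conjI mult_right_mono) auto
  qed (simp add: matrix_vector_mult_0_right)
  then show "(INF \<xi>\<in>?S. ?f \<xi>) * (norm x)\<^sup>2 \<le> ?f x" "?f x \<le> (SUP \<xi>\<in>?S. ?f \<xi>) * (norm x)\<^sup>2" by auto
qed

lemma compact_sublevel:
  fixes f :: "'a::t2_space \<Rightarrow> real"
  assumes "compact B" "continuous_on B f"
  shows "compact {x \<in> B. f x \<le> c}" "compact {x \<in> B. c \<le> f x}"
proof -
  have "closed (B \<inter> f -` {..c})" "closed (B \<inter> f -` {c..})"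
    using assms by (auto intro!: continuous_closed_preimage simp: compact_imp_closed)
  then have "compact (B \<inter> (B \<inter> f -` {..c}))" "compact (B \<inter> (B \<inter> f -` {c..}))"
    using compact_Int_closed[OF assms(1)] by blast+
  moreover have "B \<inter> (B \<inter> f -` {..c}) = {x \<in> B. f x \<le> c}" "B \<inter> (B \<inter> f -` {c..}) = {x \<in> B. c \<le> f x}" by auto
  ultimately show "compact {x \<in> B. f x \<le> c}" "compact {x \<in> B. c \<le> f x}" by auto
qed

context htype_coordinates begin

text \<open>A sum of kernels over finitely many points can be differentiated termwise, which avoids
  differentiation under an integral.  The set \<open>F\<close> is cut into pieces of diameter comparable to its distance
  from \<open>K\<close>, and the mass of each piece is moved to one point; seen from \<open>K\<close>, distances change at most by a
  factor 2, so that the growth of the mass of balls is preserved.\<close>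

lemma discretised_measure:
  assumes F: "compact F" and K: "compact K" and disj: "F \<inter> K = {}"
  obtains I c where "finite I" "I \<subseteq> F" "\<And>i. i \<in> I \<Longrightarrow> 0 \<le> c i"
    "sum c I = measure lebesgue F"
    "\<And>x r. x \<in> K \<Longrightarrow> 0 < r \<Longrightarrow> (\<Sum>i\<in>{i \<in> I. gdist i x \<le> r}. c i) \<le> measure lebesgue {y. gdist x y < 2 * r}"
proof -
  obtain \<sigma> where \<sigma>: "0 < \<sigma>" "\<And>y x. y \<in> F \<Longrightarrow> x \<in> K \<Longrightarrow> \<sigma> \<le> gdist y x"
  proof (cases "F \<times> K = {}")
    case True
    then show ?thesis using that[of 1] by auto
  next
    case False
    have "continuous_on (F \<times> K) (\<lambda>p. gdist (fst p) (snd p))" by (intro continuous_intros)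
    then obtain p where p: "p \<in> F \<times> K" "\<And>p'. p' \<in> F \<times> K \<Longrightarrow> gdist (fst p) (snd p) \<le> gdist (fst p') (snd p')"
      using continuous_attains_inf[OF compact_Times[OF F K] False] by blast
    show ?thesis
    proof (rule that[of "gdist (fst p) (snd p)"])
      have "fst p \<noteq> snd p" using p(1) disj by (auto simp: mem_Times_iff)
      then show "0 < gdist (fst p) (snd p)" using gdist_nonneg gdist_eq_0_iff by (simp add: less_le)
      show "gdist (fst p) (snd p) \<le> gdist y x" if "y \<in> F" "x \<in> K" for y x
        using p(2)[of "(y, x)"] that by simp
    qed
  qed
  let ?B = "\<lambda>y. {x. gdist y x < \<sigma>}"
  have "F \<subseteq> (\<Union>y\<in>F. ?B y)"
  proof
    fix y assume "y \<in> F"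
    moreover have "gdist y y = 0" by (simp only: gdist_eq_0_iff)
    ultimately show "y \<in> (\<Union>y\<in>F. ?B y)" using \<sigma>(1) by (intro UN_I[of y]) auto
  qed
  then obtain I where I: "I \<subseteq> F" "finite I" "F \<subseteq> (\<Union>y\<in>I. ?B y)"
    by (rule compactE_image[OF F open_gdist_less])
  have FL: "F \<in> lmeasurable" using F by (rule lmeasurable_compact)
  have BL: "?B i \<in> sets lebesgue" for i by (rule fmeasurableD[OF lmeasurable_gdist_less])
  obtain P where P': "\<forall>i\<in>I. P i \<in> lmeasurable \<and> P i \<subseteq> ?B i"
    and P3: "disjoint_family_on P I" "(\<Union>i\<in>I. P i) = F"
    using disjoint_pieces_of_cover[OF I(2) FL I(3) BL] by blast
  have P: "\<And>i. i \<in> I \<Longrightarrow> P i \<in> lmeasurable" "\<And>i. i \<in> I \<Longrightarrow> P i \<subseteq> ?B i"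
    "disjoint_family_on P I" "(\<Union>i\<in>I. P i) = F"
    using P' P3 by blast+
  define c where "c i = measure lebesgue (P i)" for i
  have sum: "sum c J = measure lebesgue (\<Union>i\<in>J. P i)" if "J \<subseteq> I" for J
    unfolding c_def
  proof (rule measure_finite_Union[symmetric])
    show "finite J" using that I(2) by (rule finite_subset)
    show "disjoint_family_on P J" using P(3) that by (rule disjoint_family_on_mono[rotated])
    have "P i \<in> lmeasurable" if "i \<in> J" for i using P(1)[of i] that \<open>J \<subseteq> I\<close> by blast
    from fmeasurableD[OF this] fmeasurableD2[OF this]
    show "P ` J \<subseteq> sets lebesgue" "\<And>i. i \<in> J \<Longrightarrow> emeasure lebesgue (P i) \<noteq> \<infinity>"
      unfolding infinity_ennreal_def by blast+
  qed
  show ?thesis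
  proof (rule that[of I c])
    show "sum c I = measure lebesgue F" using sum[of I] P(4) by simp
    show "(\<Sum>i\<in>{i \<in> I. gdist i x \<le> r}. c i) \<le> measure lebesgue {y. gdist x y < 2 * r}"
      if x: "x \<in> K" and r: "0 < r" for x r
    proof -
      let ?J = "{i \<in> I. gdist i x \<le> r}"
      have "(\<Sum>i\<in>?J. c i) = measure lebesgue (\<Union>i\<in>?J. P i)" by (rule sum) auto
      also have "\<dots> \<le> measure lebesgue {y. gdist x y < 2 * r}"
      proof (rule measure_mono_fmeasurable)
        show "(\<Union>i\<in>?J. P i) \<subseteq> {y. gdist x y < 2 * r}"
        proof clarify
          fix i y assume i: "i \<in> I" "gdist i x \<le> r" "y \<in> P i"
          have "\<sigma> \<le> r" using \<sigma>(2)[of i x] i x I(1) by force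
          moreover have "gdist i y < \<sigma>" using P(2)[OF i(1)] i(3) by auto
          ultimately show "gdist x y < 2 * r"
            using gdist_triangle[of x y i] i(2) gdist_sym[of x i] by simp
        qed
        show "(\<Union>i\<in>?J. P i) \<in> sets lebesgue"
          using P(1) I(2) by (intro sets.finite_UN) (auto simp: fmeasurable_def)
        show "{y. gdist x y < 2 * r} \<in> lmeasurable" by (rule lmeasurable_gdist_less)
      qed
      finally show ?thesis .
    qed
  qed (use I in \<open>auto simp: c_def\<close>)
qed

definition "homogeneous_dim = real CARD('m) + 2 * real CARD('n)"

lemma kernel_gdist: "kernel (\<alpha> / 4) y x = gdist y x powr - \<alpha>"
proof (cases "gdist y x = 0")
  case False
  then have "0 < gdist y x" using gdist_nonneg[of y x] by simp
  then have "gdist y x ^ 4 = gdist y x powr 4" by (simp add: powr_numeral)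
  then have "kernel (\<alpha> / 4) y x = gdist y x powr (4 * - (\<alpha> / 4))"
    by (simp only: kernel_def quart_eq_gdist powr_powr)
  then show ?thesis by simp
qed (simp add: kernel_def quart_eq_gdist)

lemma measure_gdist_less_powr:
  "0 < r \<Longrightarrow> measure lebesgue {x. gdist y x < r} = r powr homogeneous_dim * ball_vol"
proof -
  assume r: "0 < r"
  have "homogeneous_dim = real (CARD('m) + 2 * CARD('n))" by (simp add: homogeneous_dim_def)
  then show ?thesis using r by (simp only: measure_gdist_less powr_realpow)
qed

lemma kernel_L_op_nonneg:
  assumes "A x \<in> M_class lam Lam" and landis: "landis_condition \<delta> \<Omega> A" and "x \<in> \<Omega>"
    and "\<delta> \<le> homogeneous_dim" "x \<noteq> y"
  shows "0 \<le> L_op fld A (kernel ((homogeneous_dim - \<delta>) / 4) y) x"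
  unfolding L_op_def
proof (rule kernel_subsolution)
  let ?lo = "INF \<xi>\<in>{\<xi>. norm \<xi> = 1}. (A x *v \<xi>) \<bullet> \<xi>" and ?hi = "SUP \<xi>\<in>{\<xi>. norm \<xi> = 1}. (A x *v \<xi>) \<bullet> \<xi>"
  show "?lo * (norm \<xi>)\<^sup>2 \<le> qf (A x) \<xi>" "qf (A x) \<xi> \<le> ?hi * (norm \<xi>)\<^sup>2" for \<xi>
    unfolding qf_def by (rule M_class_form_bounds[OF assms(1)])+
  show "trace (A x) + (2 * real CARD('n) + 2) * ?hi \<le> 4 * ((homogeneous_dim - \<delta>) / 4 + 1) * ?lo"
  proof -
    have "real (hom_dim TYPE(('m, 'n) pt)) + 2 - real CARD('m) = 2 * real CARD('n) + 2"
      "real (hom_dim TYPE(('m, 'n) pt)) + 4 - \<delta> = 4 * ((homogeneous_dim - \<delta>) / 4 + 1)"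
      by (simp_all add: hom_dim_def homogeneous_dim_def)
    then show ?thesis using landis \<open>x \<in> \<Omega>\<close> by (simp only: landis_condition_def)
  qed
  show "transpose (A x) = A x" using assms(1) by (simp add: M_class_def)
qed (use assms in auto)

section \<open>Lower bounds for supersolutions\<close>

text \<open>The value that the comparison argument yields after all powers of the radius and the volume of the
  unit ball have cancelled.  The minimum with \<open>1/2\<close> covers the points at which \<open>u\<close> is not small.\<close>

definition "growth_const \<delta> =
  min (1/2) ((1 - 3 powr - (homogeneous_dim - \<delta>)) * (1 - 2 powr - \<delta>) / (4 * 2 powr homogeneous_dim * 2 powr (homogeneous_dim - \<delta>) * 12 powr \<delta>))"

text \<open>If the value of \<open>u\<close> at \<open>p\<close> is at most \<open>1/2\<close>, let \<open>F\<close> be the part of \<open>{u \<ge> 1}\<close> in the small closed ball around \<open>p\<close>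
  of radius \<open>R/4\<close>; it contains at least half of that ball in measure.  The potential \<open>w\<close> of the
  discretised measure on \<open>F\<close> is compared with \<open>u\<close> on the region where \<open>u \<le> 1/2\<close> inside the ball of radius
  \<open>3R/2\<close>.  All of \<open>F\<close> lies within \<open>R/4\<close> of \<open>p\<close> and at distance at least \<open>3R/4\<close> from the outer sphere, so that the
  value of \<open>w\<close> at \<open>p\<close> exceeds its bound \<open>M\<close> on the sphere by a fixed factor, whatever the mass of \<open>F\<close>.\<close>

lemma supersolution_lower_bound:
  fixes u :: "('m, 'n) pt \<Rightarrow> real"
  assumes "0 < lam" "0 < \<delta>" "\<delta> < homogeneous_dim"
    and A: "\<And>x. x \<in> \<Omega> \<Longrightarrow> A x \<in> M_class lam Lam" and landis: "landis_condition \<delta> \<Omega> A"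
    and R: "0 < R" and V: "open V" "V \<subseteq> \<Omega>" "{x. gdist x0 x < 2 * R} \<subseteq> V"
    and u: "Ck_on 2 V u" "\<And>x. x \<in> V \<Longrightarrow> 0 \<le> u x" "\<And>x. x \<in> V \<Longrightarrow> L_op fld A u x \<le> 0"
    and dens: "(1 - (1/4) powr homogeneous_dim / 2) * measure lebesgue {x. gdist x0 x < R}
       \<le> measure lebesgue {x \<in> {x. gdist x0 x < R}. 1 \<le> u x}"
    and p: "gdist x0 p < R / 2"
  shows "growth_const \<delta> \<le> u p"
proof (cases "u p \<le> 1/2")
  case False
  then show ?thesis by (simp add: growth_const_def)
next
  case up: True
  define \<alpha> where "\<alpha> = homogeneous_dim - \<delta>"
  have \<alpha>: "0 < \<alpha>" "\<alpha> < homogeneous_dim" using assms by (auto simp: \<alpha>_def)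
  have C2u: "field_C2 fld V u" by (rule field_C2_of_Ck[OF V(1) u(1) fld_differentiable])
  have cu: "continuous_on V u"
    using C2u by (intro continuous_at_imp_continuous_on) (auto simp: field_C2_def intro: differentiable_imp_continuous_within)
  define F where "F = {x \<in> {x. gdist p x \<le> R / 4}. 1 \<le> u x}"
  define K where "K = {x \<in> {x. gdist x0 x \<le> 3 * R / 2}. u x \<le> 1/2}"
  have pF: "gdist x0 x \<le> 3 * R / 4" if "gdist p x \<le> R / 4" for x
    using gdist_triangle[of x0 x p] that p by simp
  have FV: "{x. gdist p x \<le> R / 4} \<subseteq> V" and KV: "{x. gdist x0 x \<le> 3 * R / 2} \<subseteq> V"
    using pF V(3) R by force+
  have F: "compact F" unfolding F_def
    by (intro compact_sublevel compact_gdist_le continuous_on_subset[OF cu FV])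
  have K: "compact K" unfolding K_def
    by (intro compact_sublevel compact_gdist_le continuous_on_subset[OF cu KV])
  have FK: "F \<inter> K = {}" by (auto simp: F_def K_def)
  have pK: "p \<in> K" using p up R by (auto simp: K_def)
  define mF where "mF = measure lebesgue F"
  have mF: "(R / 4) powr homogeneous_dim / 2 * ball_vol \<le> mF"
  proof -
    let ?E = "{x \<in> {x. gdist x0 x < R}. 1 \<le> u x}" and ?B = "{x. gdist x0 x < R}"
    have BV: "?B \<subseteq> V" using V(3) R by auto
    have "open {x \<in> ?B. u x < 1}"
      using continuous_open_preimage[OF continuous_on_subset[OF cu BV] open_gdist_less, of "{..<1}"]
      by (simp add: vimage_def Int_def conj_commute)
    then have "{x \<in> ?B. u x < 1} \<in> sets lebesgue" by simp
    then have "?B - {x \<in> ?B. u x < 1} \<in> lmeasurable"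
      using lmeasurable_gdist_less by (intro fmeasurable_Diff)
    moreover have "?B - {x \<in> ?B. u x < 1} = ?E" by auto
    ultimately have E: "?E \<in> lmeasurable" by simp
    have FL: "F \<in> lmeasurable" using F by (rule lmeasurable_compact)
    have BE: "?B - ?E \<in> lmeasurable" by (intro fmeasurable_Diff lmeasurable_gdist_less fmeasurableD[OF E])
    \<comment> \<open>the part of the small ball outside \<open>F\<close> lies in the exceptional set, which has at most half its measure\<close>
    have "(R / 4) powr homogeneous_dim * ball_vol = measure lebesgue {x. gdist p x < R / 4}"
      using R by (intro measure_gdist_less_powr[symmetric]) simp
    also have "\<dots> \<le> measure lebesgue (F \<union> (?B - ?E))"
    proof (rule measure_mono_fmeasurable)
      show "{x. gdist p x < R / 4} \<subseteq> F \<union> (?B - ?E)"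
      proof
        fix x assume "x \<in> {x. gdist p x < R / 4}"
        then have "gdist p x \<le> R / 4" by simp
        moreover from pF[OF this] have "gdist x0 x < R" using R by simp
        ultimately show "x \<in> F \<union> (?B - ?E)" by (auto simp: F_def)
      qed
    qed (intro fmeasurable.Un FL BE fmeasurableD[OF lmeasurable_gdist_less])+
    also have "\<dots> \<le> mF + measure lebesgue (?B - ?E)"
      unfolding mF_def by (intro measure_Un_le fmeasurableD[OF FL] fmeasurableD[OF BE])
    also have "measure lebesgue (?B - ?E) = measure lebesgue ?B - measure lebesgue ?E"
      by (intro measurable_measure_Diff lmeasurable_gdist_less fmeasurableD[OF E]) auto
    also have "\<dots> \<le> (1/4) powr homogeneous_dim / 2 * measure lebesgue ?B" using dens by (simp add: algebra_simps)
    also have "\<dots> = (R / 4) powr homogeneous_dim / 2 * ball_vol"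
      using R by (simp add: measure_gdist_less_powr powr_divide)
    finally show ?thesis by simp
  qed
  have mF_pos: "0 < mF"
    using mF ball_vol_pos R by (smt (verit) divide_pos_pos mult_pos_pos powr_gt_zero)
  obtain I c where I: "finite I" "I \<subseteq> F" "\<And>i. i \<in> I \<Longrightarrow> 0 \<le> c i" "sum c I = mF"
    "\<And>x r. x \<in> K \<Longrightarrow> 0 < r \<Longrightarrow> (\<Sum>i\<in>{i \<in> I. gdist i x \<le> r}. c i) \<le> measure lebesgue {y. gdist x y < 2 * r}"
    by (rule discretised_measure[OF F K FK, folded mF_def]) blast
  define w where "w x = (\<Sum>i\<in>I. c i * kernel (\<alpha> / 4) i x)" for x
  define S where "S = 2 powr homogeneous_dim * ball_vol * 2 powr \<alpha> * (3 * R) powr \<delta> / (1 - 2 powr - \<delta>)"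
  define M where "M = (3 * R / 4) powr - \<alpha> * mF"
  have d2: "2 powr - \<delta> < (1::real)" using \<open>0 < \<delta>\<close> by (simp add: powr_less_one)
  have S: "0 < S" using ball_vol_pos R d2 by (simp add: S_def)
  have dpos: "0 < gdist i x" if "i \<in> I" "x \<in> K" for i x
  proof -
    have "i \<noteq> x" using that I(2) FK by auto
    then show ?thesis using gdist_nonneg[of i x] gdist_eq_0_iff[of i x] by simp
  qed
  have wS: "w x \<le> S" if x: "x \<in> K" for x
  proof -
    have "(\<Sum>i\<in>I. c i * gdist i x powr - \<alpha>) \<le> (2 powr homogeneous_dim * ball_vol) * 2 powr \<alpha> * (3 * R) powr (homogeneous_dim - \<alpha>) / (1 - 2 powr (\<alpha> - homogeneous_dim))"
    proof (rule weighted_inverse_power_sum_le[OF I(1) I(3) dpos])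
      show "gdist i x \<le> 3 * R" if "i \<in> I" for i
      proof -
        have "gdist p i \<le> R / 4" using that I(2) by (auto simp: F_def)
        then show ?thesis
          using pF[of i] x gdist_triangle[of i x x0] gdist_sym[of i x0] R by (simp add: K_def)
      qed
      show "(\<Sum>i\<in>{i \<in> I. gdist i x \<le> r}. c i) \<le> 2 powr homogeneous_dim * ball_vol * r powr homogeneous_dim" if "0 < r" for r
        using I(5)[OF x that] that by (simp add: measure_gdist_less_powr powr_mult algebra_simps)
    qed (use x R \<alpha> ball_vol_pos in auto)
    then show ?thesis by (simp add: w_def S_def kernel_gdist \<alpha>_def)
  qed
  have w_outer: "w x \<le> M" if "gdist x0 x = 3 * R / 2" "x \<in> K" for x
  proof -
    have "w x \<le> (\<Sum>i\<in>I. c i * (3 * R / 4) powr - \<alpha>)"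
      unfolding w_def kernel_gdist
    proof (intro sum_mono mult_left_mono I(3))
      fix i assume i: "i \<in> I"
      have "gdist p i \<le> R / 4" using i I(2) by (auto simp: F_def)
      then have "3 * R / 4 \<le> gdist i x"
        using pF[of i] that(1) gdist_triangle[of x0 x i] by simp
      then show "gdist i x powr - \<alpha> \<le> (3 * R / 4) powr - \<alpha>"
        using R \<alpha> by (intro powr_mono2') auto
    qed
    also have "\<dots> = M" by (simp add: M_def I(4)[symmetric] sum_distrib_right mult.commute)
    finally show ?thesis .
  qed
  have w_inner: "(R / 4) powr - \<alpha> * mF \<le> w p"
  proof -
    have "(R / 4) powr - \<alpha> * mF = (\<Sum>i\<in>I. c i * (R / 4) powr - \<alpha>)"
      by (simp add: I(4)[symmetric] sum_distrib_right mult.commute)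
    also have "\<dots> \<le> w p"
      unfolding w_def kernel_gdist
    proof (intro sum_mono mult_left_mono I(3))
      fix i assume i: "i \<in> I"
      have "gdist i p \<le> R / 4" using i I(2) gdist_sym[of p i] by (auto simp: F_def)
      then show "(R / 4) powr - \<alpha> \<le> gdist i p powr - \<alpha>"
        using dpos[OF i pK] \<alpha> by (intro powr_mono2') auto
    qed
    finally show ?thesis .
  qed
  define U where "U = {x. gdist x0 x < 3 * R / 2} \<inter> {x \<in> V. u x < 1/2}"
  have U: "open U" "U \<subseteq> K" "U \<subseteq> V"
  proof -
    have "open {x \<in> V. u x < 1/2}"
      using continuous_open_preimage[OF cu V(1), of "{..<1/2}"]
      by (simp add: vimage_def Int_def conj_commute)
    then show "open U" unfolding U_def using open_gdist_less by (intro open_Int)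
  qed (auto simp: U_def K_def)
  have IK: "i \<notin> K" if "i \<in> I" for i using that I(2) FK by auto
  have w_C2: "field_C2 fld U w" and w_L: "\<And>x. x \<in> U \<Longrightarrow> L_op fld A w x = (\<Sum>i\<in>I. c i * L_op fld A (kernel (\<alpha> / 4) i) x)"
  proof -
    have "field_C2 fld U (kernel (\<alpha> / 4) i)" if "i \<in> I" for i
      using IK[OF that] U(2) by (intro field_C2_kernel) auto
    from field_C2_sum[OF U(1) I(1) this, where c = c and A = A]
    show "field_C2 fld U w" "\<And>x. x \<in> U \<Longrightarrow> L_op fld A w x = (\<Sum>i\<in>I. c i * L_op fld A (kernel (\<alpha> / 4) i) x)"
      by (auto simp: w_def[abs_def])
  qed
  have w_cont: "continuous_on K w"
  proof -
    have "continuous_on K (kernel (\<alpha> / 4) i)" if "i \<in> I" for i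
      using IK[OF that]
      by (intro continuous_at_imp_continuous_on ballI differentiable_imp_continuous_within kernel_first) auto
    then show ?thesis unfolding w_def[abs_def] by (intro continuous_intros)
  qed
  have w_sub: "0 \<le> L_op fld A w x" if x: "x \<in> U" for x
    unfolding w_L[OF x]
  proof (intro sum_nonneg mult_nonneg_nonneg I(3))
    fix i assume i: "i \<in> I"
    have "x \<noteq> i" using IK[OF i] x U(2) by auto
    then show "0 \<le> L_op fld A (kernel (\<alpha> / 4) i) x"
      unfolding \<alpha>_def using x U(3) V(2) assms(3)
      by (intro kernel_L_op_nonneg[OF A landis]) auto
  qed
  define \<kappa> where "\<kappa> = 1 / (2 * S)"
  have \<kappa>: "0 < \<kappa>" "\<kappa> * S = 1/2" using S by (auto simp: \<kappa>_def)
  let ?h = "\<lambda>x. u x + (- \<kappa>) * w x"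
  have C2uU: "field_C2 fld U u" using C2u U(3) by (auto simp: field_C2_def)
  have M0: "0 \<le> M" using mF_pos by (simp add: M_def)
  have "- (\<kappa> * M) \<le> ?h p"
  proof (rule minimum_principle[OF K U(1,2) _ _ _ _ _ _ pK])
    show "continuous_on K ?h"
      using KV by (intro continuous_intros w_cont continuous_on_subset[OF cu]) (auto simp: K_def)
    show "field_C2 fld U ?h" by (rule field_C2_lincomb(1)[OF U(1) C2uU w_C2])
    show "L_op fld A ?h x \<le> 0" if x: "x \<in> U" for x
    proof -
      have "L_op fld A ?h x = L_op fld A u x + (- \<kappa>) * L_op fld A w x"
        by (rule field_C2_lincomb(2)[OF U(1) C2uU w_C2 x])
      moreover have "0 \<le> \<kappa> * L_op fld A w x" using w_sub[OF x] \<kappa> by simp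
      ultimately show ?thesis using u(3)[of x] x U(3) by auto
    qed
    show "transpose (A x) = A x" if "x \<in> U" for x
      using A[of x] that U(3) V(2) by (auto simp: M_class_def)
    show "0 < qf (A x) y" if "x \<in> U" "y \<noteq> 0" for x y
    proof -
      have "0 < lam * (norm y)\<^sup>2" using \<open>0 < lam\<close> that by simp
      also have "\<dots> \<le> qf (A x) y" using A[of x] that U(3) V(2) by (auto simp: M_class_def qf_def)
      finally show ?thesis .
    qed
    show "- (\<kappa> * M) \<le> ?h x" if x: "x \<in> K - U" for x
    proof -
      have xV: "x \<in> V" using x KV by (auto simp: K_def)
      consider "gdist x0 x = 3 * R / 2" | "u x = 1/2"
        using x xV by (force simp: K_def U_def)
      then show ?thesis
      proof cases
        case 1
        then have "\<kappa> * w x \<le> \<kappa> * M" using w_outer[OF 1] x \<kappa> by simp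
        then show ?thesis using u(2)[OF xV] by simp
      next
        case 2
        have "\<kappa> * w x \<le> \<kappa> * S" using wS[of x] x \<kappa> by simp
        moreover have "0 \<le> \<kappa> * M" using M0 \<kappa> by simp
        ultimately show ?thesis using 2 \<kappa>(2) by simp
      qed
    qed
  qed
  then have "\<kappa> * (w p - M) \<le> u p" by (simp add: algebra_simps)
  moreover have "\<kappa> * (((R / 4) powr - \<alpha> - (3 * R / 4) powr - \<alpha>) * mF) \<le> \<kappa> * (w p - M)"
    using w_inner \<kappa>(1) by (intro mult_left_mono) (auto simp: M_def algebra_simps)
  moreover have "(1 - 3 powr - \<alpha>) * (1 - 2 powr - \<delta>) / (4 * 2 powr homogeneous_dim * 2 powr \<alpha> * 12 powr \<delta>)
      \<le> \<kappa> * (((R / 4) powr - \<alpha> - (3 * R / 4) powr - \<alpha>) * mF)"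
  proof -
    let ?a = "(1 - 3 powr - \<alpha>) * (R / 4) powr - \<alpha>"
    have split: "(3 * R / 4) powr - \<alpha> = 3 powr - \<alpha> * (R / 4) powr - \<alpha>"
      using R powr_mult[of 3 "R / 4" "- \<alpha>"] by simp
    have a: "(R / 4) powr - \<alpha> - (3 * R / 4) powr - \<alpha> = ?a" unfolding split by (simp add: algebra_simps)
    have "3 powr - \<alpha> < (1::real)" using \<alpha> by (simp add: powr_less_one)
    then have "0 \<le> \<kappa> * ?a" using \<kappa> by simp
    then have "(\<kappa> * ?a) * ((R / 4) powr homogeneous_dim / 2 * ball_vol) \<le> (\<kappa> * ?a) * mF"
      using mF by (rule mult_left_mono[rotated])
    \<comment> \<open>the powers of the radius combine to exponent zero\<close>
    moreover have "(\<kappa> * ?a) * ((R / 4) powr homogeneous_dim / 2 * ball_vol)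
       = (1 - 3 powr - \<alpha>) * (1 - 2 powr - \<delta>) / (4 * 2 powr homogeneous_dim * 2 powr \<alpha> * 12 powr \<delta>)"
    proof -
      have e1: "(R / 4) powr - \<alpha> * (R / 4) powr homogeneous_dim = (R / 4) powr \<delta>"
        using R by (simp add: \<alpha>_def flip: powr_add)
      have e2: "(3 * R) powr \<delta> = 12 powr \<delta> * (R / 4) powr \<delta>"
        using R powr_mult[of 12 "R / 4" \<delta>] by simp
      have "(\<kappa> * ?a) * ((R / 4) powr homogeneous_dim / 2 * ball_vol)
        = \<kappa> * (1 - 3 powr - \<alpha>) * ((R / 4) powr - \<alpha> * (R / 4) powr homogeneous_dim) * ball_vol / 2" by simp
      also have "\<dots> = (1 - 3 powr - \<alpha>) * (R / 4) powr \<delta> * ball_vol / (4 * S)"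
        unfolding e1 by (simp add: \<kappa>_def)
      also have "\<dots> = (1 - 3 powr - \<alpha>) * (1 - 2 powr - \<delta>) / (4 * 2 powr homogeneous_dim * 2 powr \<alpha> * 12 powr \<delta>)"
      proof -
        have "(R / 4) powr \<delta> \<noteq> 0" "ball_vol \<noteq> 0" "1 - 2 powr - \<delta> \<noteq> 0"
          using R ball_vol_pos d2 by auto
        then show ?thesis unfolding S_def e2 by (simp add: divide_simps)
      qed
      finally show ?thesis .
    qed
    moreover have "\<kappa> * (?a * mF) = (\<kappa> * ?a) * mF" by simp
    ultimately show ?thesis unfolding a by linarith
  qed
  ultimately show ?thesis by (simp add: growth_const_def \<alpha>_def)
qed

end

section \<open>Smooth and homogeneous vector fields\<close>

lemma smooth_on_imp_differentiable: "smooth_on S f \<Longrightarrow> x \<in> S \<Longrightarrow> f differentiable (at x)"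
  unfolding smooth_on_def by (drule spec[of _ "Suc 0"]) simp

lemma smooth_on_frechet_derivative: "smooth_on S f \<Longrightarrow> smooth_on S (\<lambda>x. frechet_derivative f (at x) w)"
  unfolding smooth_on_def
proof
  fix k assume "\<forall>k. Ck_on k S f"
  then have "Ck_on (Suc k) S f" by blast
  then show "Ck_on k S (\<lambda>x. frechet_derivative f (at x) w)" by (simp only: Ck_on.simps)
qed

lemma Ck_on_UNIV_compose_linear:
  fixes L :: "'a::euclidean_space \<Rightarrow> 'b::euclidean_space"
  assumes L: "bounded_linear L"
  shows "Ck_on k UNIV f \<Longrightarrow> Ck_on k UNIV (\<lambda>x. f (L x))"
proof (induction k arbitrary: f)
  case 0
  then show ?case
    using continuous_on_compose2[of UNIV f UNIV L] bounded_linear.continuous_on[OF L continuous_on_id]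
    by simp
next
  case (Suc k)
  have f: "(f has_derivative frechet_derivative f (at (L x))) (at (L x))" for x
    using Suc.prems by (simp add: frechet_derivative_works)
  have fL: "((\<lambda>x. f (L x)) has_derivative (\<lambda>h. frechet_derivative f (at (L x)) (L h))) (at x)" for x
    by (rule has_derivative_compose[OF bounded_linear.has_derivative[OF L has_derivative_ident] f])
  show ?case
    unfolding Ck_on.simps
  proof (intro conjI ballI allI)
    show "(\<lambda>x. f (L x)) differentiable (at x)" for x using fL by (rule differentiableI)
    have "Ck_on k UNIV (\<lambda>x. frechet_derivative f (at x) (L w))" for w
      using Suc.prems by (simp only: Ck_on.simps)
    then show "Ck_on k UNIV (\<lambda>x. frechet_derivative (\<lambda>x. f (L x)) (at x) w)" for w
      unfolding frechet_derivative_at[OF fL, symmetric] by (rule Suc.IH)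
  qed
qed

lemma dil_0_limit: "((\<lambda>r. dil r p) \<longlongrightarrow> 0) (at_right 0)"
proof -
  have "((\<lambda>r. dil r p) \<longlongrightarrow> (0 *\<^sub>R fst p, 0\<^sup>2 *\<^sub>R snd p)) (at_right 0)"
    unfolding dil_def[abs_def] by (intro tendsto_intros)
  then show ?thesis by (simp add: zero_prod_def)
qed

text \<open>Letting the dilation parameter tend to 0, the horizontal components, being constant along dilation
  orbits, equal their value at the origin, and the vertical components, being homogeneous of degree 1,
  equal their own derivative at the origin.\<close>

lemma dil_homogeneous_1_form:
  fixes X :: "('m::finite, 'n::finite) vf"
  assumes hom: "dil_homogeneous 1 X" and diff: "X differentiable (at 0)"
  obtains B where "linear B" "\<And>p. X p = (fst (X 0), B (fst p))"
proof -
  let ?D = "frechet_derivative X (at 0)"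
  have D: "(X has_derivative ?D) (at 0)" using diff by (simp add: frechet_derivative_works)
  have h: "fst (X (dil r p)) = fst (X p)" "snd (X (dil r p)) = r *\<^sub>R snd (X p)" if "0 < r" for r p
  proof -
    have "dil r (X p) = r *\<^sub>R X (dil r p)"
      using hom that unfolding dil_homogeneous_def power_one_right by blast
    then have "r *\<^sub>R fst (X (dil r p)) = r *\<^sub>R fst (X p)" "r *\<^sub>R snd (X (dil r p)) = r *\<^sub>R (r *\<^sub>R snd (X p))"
      by (auto simp: dil_def prod_eq_iff power2_eq_square)
    then show "fst (X (dil r p)) = fst (X p)" "snd (X (dil r p)) = r *\<^sub>R snd (X p)"
      using scaleR_left_imp_eq[of r] that by (metis less_irrefl)+
  qed
  have cont: "isCont X 0" using D by (rule has_derivative_continuous)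
  have lim: "((\<lambda>r. X (dil r p)) \<longlongrightarrow> X 0) (at_right 0)" for p
    by (rule isCont_tendsto_compose[OF cont dil_0_limit])
  have X1: "fst (X p) = fst (X 0)" for p
  proof (rule tendsto_unique[OF _ _ tendsto_fst[OF lim]])
    show "((\<lambda>r. fst (X (dil r p))) \<longlongrightarrow> fst (X p)) (at_right 0)"
      by (rule tendsto_eventually) (auto simp: eventually_at_right_field h intro!: exI[of _ 1])
  qed simp
  have X20: "snd (X 0) = 0"
    using h(2)[of 2 0] by (simp add: dil_def zero_prod_def[symmetric] scaleR_2)
  have X2: "snd (X p) = snd (?D (fst p, 0))" for p
  proof (rule vector_derivative_unique_within_closed_interval[of 0 1 0 "\<lambda>r. snd (X (dil r p))"])
    have l: "((\<lambda>r. dil r p) has_vector_derivative (fst p, 0)) (at 0)"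
      unfolding dil_def[abs_def] has_vector_derivative_def
      by (auto intro!: derivative_eq_intros simp: fun_eq_iff)
    have "dil 0 p = 0" by (simp add: dil_def zero_prod_def)
    then have "((\<lambda>r. X (dil r p)) has_derivative (\<lambda>h. ?D (h *\<^sub>R (fst p, 0)))) (at 0)"
      using has_derivative_compose[OF l[unfolded has_vector_derivative_def], of X ?D] D by simp
    then have "((\<lambda>r. snd (X (dil r p))) has_derivative (\<lambda>h. snd (?D (h *\<^sub>R (fst p, 0))))) (at 0)"
      by (rule has_derivative_snd)
    moreover have "linear ?D" using D by (rule has_derivative_linear)
    ultimately have "((\<lambda>r. snd (X (dil r p))) has_vector_derivative snd (?D (fst p, 0))) (at 0)"
      by (simp add: has_vector_derivative_def linear_cmul del: scaleR_Pair)
    then show "((\<lambda>r. snd (X (dil r p))) has_vector_derivative snd (?D (fst p, 0))) (at 0 within cbox 0 1)"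
      by (rule has_vector_derivative_at_within)
    show "((\<lambda>r. snd (X (dil r p))) has_vector_derivative snd (X p)) (at 0 within cbox 0 1)"
    proof (rule has_vector_derivative_transform)
      show "((\<lambda>r. r *\<^sub>R snd (X p)) has_vector_derivative snd (X p)) (at 0 within cbox 0 1)"
        by (auto intro!: derivative_eq_intros)
      show "snd (X (dil r p)) = r *\<^sub>R snd (X p)" if "r \<in> cbox 0 1" for r
        using that h(2)[of r p] X20 \<open>dil 0 p = 0\<close> by (cases "r = 0") auto
    qed simp
  qed auto
  show ?thesis
  proof
    have D_linear: "linear ?D" using D by (rule has_derivative_linear)
    show "linear (\<lambda>s. snd (?D (s, 0)))"
    proof (rule linearI)
      show "snd (?D (s + t, 0)) = snd (?D (s, 0)) + snd (?D (t, 0))" for s t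
        using linear_add[OF D_linear, of "(s, 0)" "(t, 0)"] by simp
      show "snd (?D (c *\<^sub>R s, 0)) = c *\<^sub>R snd (?D (s, 0))" for c s
        using linear_cmul[OF D_linear, of c "(s, 0)"] by simp
    qed
    show "X p = (fst (X 0), snd (?D (fst p, 0)))" for p
      using X1[of p] X2[of p] by (simp add: prod_eq_iff)
  qed
qed

lemma dil_homogeneous_2_form:
  fixes Z :: "('m::finite, 'n::finite) vf"
  assumes hom: "dil_homogeneous 2 Z" and cont: "isCont Z 0"
  shows "Z p = (0, snd (Z 0))"
proof -
  have lim: "((\<lambda>r. Z (dil r p)) \<longlongrightarrow> Z 0) (at_right 0)"
    by (rule isCont_tendsto_compose[OF cont dil_0_limit])
  have h: "fst (Z p) = r *\<^sub>R fst (Z (dil r p))" "snd (Z (dil r p)) = snd (Z p)" if "0 < r" for r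
  proof -
    have "dil r (Z p) = r\<^sup>2 *\<^sub>R Z (dil r p)"
      using hom that unfolding dil_homogeneous_def by blast
    then have "r *\<^sub>R fst (Z p) = r *\<^sub>R (r *\<^sub>R fst (Z (dil r p)))" "r\<^sup>2 *\<^sub>R snd (Z (dil r p)) = r\<^sup>2 *\<^sub>R snd (Z p)"
      by (auto simp: dil_def prod_eq_iff power2_eq_square)
    then show "fst (Z p) = r *\<^sub>R fst (Z (dil r p))" "snd (Z (dil r p)) = snd (Z p)"
      using scaleR_left_imp_eq[of r] scaleR_left_imp_eq[of "r\<^sup>2"] that by (metis less_irrefl zero_less_power)+
  qed
  have ev: "\<forall>\<^sub>F r in at_right 0. (0::real) < r" by (simp add: eventually_at_right_less)
  have "((\<lambda>r. r *\<^sub>R fst (Z (dil r p))) \<longlongrightarrow> 0 *\<^sub>R fst (Z 0)) (at_right 0)"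
    by (intro tendsto_intros lim)
  moreover have "((\<lambda>r. r *\<^sub>R fst (Z (dil r p))) \<longlongrightarrow> fst (Z p)) (at_right 0)"
    by (rule tendsto_eventually, rule eventually_mono[OF ev]) (simp add: h(1)[symmetric])
  ultimately have "fst (Z p) = 0" using tendsto_unique[of "at_right (0::real)"] by fastforce
  moreover have "((\<lambda>r. snd (Z (dil r p))) \<longlongrightarrow> snd (Z p)) (at_right 0)"
    by (rule tendsto_eventually, rule eventually_mono[OF ev]) (simp add: h(2))
  then have "snd (Z p) = snd (Z 0)"
    using tendsto_unique[of "at_right (0::real)" _ "snd (Z p)" "snd (Z 0)"] tendsto_snd[OF lim] by force
  ultimately show ?thesis by (simp add: prod_eq_iff)
qed

section \<open>Integral curves\<close>

lemma affine_integral_curve: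
  fixes \<gamma> :: "real \<Rightarrow> ('m::finite, 'n::finite) pt"
  assumes B: "linear B" and \<gamma>: "\<And>t. (\<gamma> has_vector_derivative (a, B (fst (\<gamma> t)) + c)) (at t)"
  shows "\<gamma> t = (fst (\<gamma> 0) + t *\<^sub>R a, snd (\<gamma> 0) + t *\<^sub>R B (fst (\<gamma> 0)) + (t\<^sup>2 / 2) *\<^sub>R B a + t *\<^sub>R c)"
proof -
  have const: "f t = f 0" if "\<And>t. (f has_vector_derivative 0) (at t)" for f :: "real \<Rightarrow> 'e::real_normed_vector" and t
    using has_derivative_zero_constant[of UNIV f] that
    by (force simp: has_vector_derivative_def)
  have fst: "fst (\<gamma> t) = fst (\<gamma> 0) + t *\<^sub>R a" for t
  proof -
    have "((\<lambda>t. fst (\<gamma> t) - t *\<^sub>R a) has_vector_derivative 0) (at t)" for t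
    proof -
      have l: "((\<lambda>t. t *\<^sub>R a) has_derivative (\<lambda>h. h *\<^sub>R a)) (at t)"
        by (auto intro!: derivative_eq_intros)
      show ?thesis
        using has_derivative_diff[OF has_derivative_fst[OF \<gamma>[unfolded has_vector_derivative_def, of t]] l]
        unfolding has_vector_derivative_def by simp
    qed
    from const[OF this, of t] show ?thesis by (simp add: algebra_simps)
  qed
  have "((\<lambda>t. snd (\<gamma> t) - (t *\<^sub>R B (fst (\<gamma> 0)) + (t\<^sup>2 / 2) *\<^sub>R B a + t *\<^sub>R c)) has_vector_derivative 0) (at t)" for t
  proof -
    have m: "B (fst (\<gamma> t)) + c = B (fst (\<gamma> 0)) + t *\<^sub>R B a + c"
      unfolding fst[of t] by (simp only: linear_add[OF B] linear_cmul[OF B])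
    have l: "((\<lambda>t. t *\<^sub>R B (fst (\<gamma> 0)) + (t\<^sup>2 / 2) *\<^sub>R B a + t *\<^sub>R c) has_derivative
        (\<lambda>h. h *\<^sub>R (B (fst (\<gamma> 0)) + t *\<^sub>R B a + c))) (at t)"
      by (auto intro!: derivative_eq_intros simp: fun_eq_iff algebra_simps)
    show ?thesis
      using has_derivative_diff[OF has_derivative_snd[OF \<gamma>[unfolded has_vector_derivative_def, of t]] l]
      unfolding has_vector_derivative_def by (simp add: m)
  qed
  from const[OF this, of t]
  have "snd (\<gamma> t) = snd (\<gamma> 0) + t *\<^sub>R B (fst (\<gamma> 0)) + (t\<^sup>2 / 2) *\<^sub>R B a + t *\<^sub>R c"
    by (simp add: algebra_simps)
  then show ?thesis using fst[of t] by (simp only: prod_eq_iff fst_conv snd_conv)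
qed

section \<open>Orthonormal bases\<close>

lemma inner_product_on_sum_left:
  assumes ip: "inner_product_on g ip" and g: "subspace g" and "finite A" and "\<And>a. a \<in> A \<Longrightarrow> f a \<in> g" and "W \<in> g"
  shows "ip (\<Sum>a\<in>A. c a *\<^sub>R f a) W = (\<Sum>a\<in>A. c a * ip (f a) W)"
proof -
  have lin: "ip (a *\<^sub>R X + b *\<^sub>R Y) W = a * ip X W + b * ip Y W" if "X \<in> g" "Y \<in> g" for a b X Y
    using ip that \<open>W \<in> g\<close> by (simp add: inner_product_on_def)
  show ?thesis
    using \<open>finite A\<close> \<open>\<And>a. a \<in> A \<Longrightarrow> f a \<in> g\<close>
  proof (induction A rule: finite_induct)
    case empty
    show ?case using lin[OF subspace_0[OF g] subspace_0[OF g], of 0 0] by simp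
  next
    case (insert k A)
    have "(\<Sum>a\<in>A. c a *\<^sub>R f a) \<in> g"
      using insert.prems g by (intro subspace_sum) (auto intro: subspace_scale)
    with insert lin[of "f k" "\<Sum>a\<in>A. c a *\<^sub>R f a" "c k" 1] show ?case by simp
  qed
qed

lemma orthonormal_spanning_set:
  assumes ip: "inner_product_on g ip" and g: "subspace g" and "finite B" "B \<subseteq> g"
  shows "\<exists>E. finite E \<and> E \<subseteq> g \<and> span E = span B \<and> (\<forall>a\<in>E. \<forall>b\<in>E. ip a b = (if a = b then 1 else 0))"
  using \<open>finite B\<close> \<open>B \<subseteq> g\<close>
proof (induction B rule: finite_induct)
  case empty
  then show ?case by (intro exI[of _ "{}"]) auto
next
  case (insert x B)
  then obtain E where E: "finite E" "E \<subseteq> g" "span E = span B"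
    "\<And>a b. a \<in> E \<Longrightarrow> b \<in> E \<Longrightarrow> ip a b = (if a = b then 1 else 0)" by auto
  have x: "x \<in> g" using insert.prems by simp
  have sym: "ip a b = ip b a" if "a \<in> g" "b \<in> g" for a b using ip that by (simp add: inner_product_on_def)
  have lin: "ip (a *\<^sub>R X + b *\<^sub>R Y) W = a * ip X W + b * ip Y W" if "X \<in> g" "Y \<in> g" "W \<in> g" for a b X Y W
    using ip that by (simp add: inner_product_on_def)
  define s where "s = (\<Sum>a\<in>E. ip x a *\<^sub>R a)"
  define y where "y = x - s"
  have s: "s \<in> span E" unfolding s_def by (intro span_sum span_scale span_base)
  have sg: "s \<in> g" using s E(2) g by (meson span_minimal subsetD)
  have yg: "y \<in> g" unfolding y_def using x sg g by (simp add: subspace_diff)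
  have perp: "ip y b = 0" if "b \<in> E" for b
  proof -
    have b: "b \<in> g" using that E(2) by auto
    have "ip s b = (\<Sum>a\<in>E. ip x a * ip a b)"
      unfolding s_def using inner_product_on_sum_left[OF ip g E(1) _ b, of "\<lambda>a. a"] E(2) by auto
    also have "\<dots> = (\<Sum>a\<in>E. if a = b then ip x a else 0)" by (intro sum.cong refl) (simp add: E(4) that)
    also have "\<dots> = ip x b" using that E(1) by simp
    finally show ?thesis using lin[OF x sg b, of 1 "-1"] by (simp add: y_def)
  qed
  have spanx: "span (insert y E) = span (insert x B)"
  proof -
    have "span (insert y E) = span (insert x E)"
      unfolding y_def using s by (metis eq_span_insert_eq diff_diff_eq2 add_diff_cancel_left' minus_diff_eq span_neg)
    also have "\<dots> = span (insert x B)" using E(3) by (metis span_insert)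
    finally show ?thesis .
  qed
  show ?case
  proof (cases "y = 0")
    case True
    then have "span E = span (insert x B)" using spanx by (metis span_insert_0)
    then show ?thesis using E by (intro exI[of _ E]) simp
  next
    case False
    then have pos: "0 < ip y y" using ip yg by (simp add: inner_product_on_def)
    let ?k = "1 / sqrt (ip y y)"
    define w where "w = ?k *\<^sub>R y"
    have wg: "w \<in> g" unfolding w_def using yg g by (simp add: subspace_scale)
    have ipw: "ip w b = ?k * ip y b" if "b \<in> g" for b
      using lin[OF yg yg that, of ?k 0] by (simp add: w_def)
    have "ip w w = ?k * (?k * ip y y)" using ipw[OF wg] ipw[OF yg] sym[OF wg yg] by simp
    also have "\<dots> = 1" using pos by (simp add: field_simps)
    finally have ww: "ip w w = 1" .
    have wE: "ip w b = 0" "ip b w = 0" if "b \<in> E" for b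
      using ipw[of b] perp[OF that] that E(2) sym[of b w] wg by auto
    have span_w: "span (insert w E) = span (insert y E)"
    proof -
      have "w \<in> span (insert y E)" unfolding w_def by (intro span_scale span_base) simp
      moreover have "y = sqrt (ip y y) *\<^sub>R w" using pos by (simp add: w_def)
      then have "y \<in> span (insert w E)" by (metis insertI1 span_base span_scale)
      ultimately show ?thesis
        unfolding span_eq by (auto intro: span_base)
    qed
    have "\<forall>a\<in>insert w E. \<forall>b\<in>insert w E. ip a b = (if a = b then 1 else 0)"
    proof (intro ballI)
      fix a b assume ab: "a \<in> insert w E" "b \<in> insert w E"
      have "w \<notin> E" using wE(1)[of w] ww by auto
      then show "ip a b = (if a = b then 1 else 0)" using ab E(4)[of a b] ww wE by auto
    qed
    moreover have "finite (insert w E)" "insert w E \<subseteq> g" using E(1,2) wg by auto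
    moreover have "span (insert w E) = span (insert x B)" by (simp only: span_w spanx)
    ultimately show ?thesis by (intro exI[of _ "insert w E"] conjI)
  qed
qed

section \<open>The group structure determined by the Lie algebra\<close>

text \<open>Every H-type group is described by the coordinates of the analytic part: homogeneity determines the
  left-invariant fields, and these determine the group law.\<close>

locale htype_group =
  fixes mul :: "('m::finite, 'n::finite) pt \<Rightarrow> ('m, 'n) pt \<Rightarrow> ('m, 'n) pt"
    and ginv :: "('m, 'n) pt \<Rightarrow> ('m, 'n) pt"
    and ip :: "('m, 'n) vf \<Rightarrow> ('m, 'n) vf \<Rightarrow> real"
    and X :: "'m \<Rightarrow> ('m, 'n) vf"
  assumes H: "H_type_group mul ginv ip" and onb: "horizontal_orthonormal_basis mul ip X"
begin

abbreviation "lie \<equiv> left_invariant_fields mul"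
abbreviation "hor \<equiv> horizontal_layer mul ip"
abbreviation "ver \<equiv> vertical_layer mul"

lemma group: "group mul 0 ginv" using H by (simp add: H_type_group_def homogeneous_lie_group_def)

lemma mul_assoc: "mul (mul x y) z = mul x (mul y z)"
  by (rule semigroup.assoc[OF group.axioms(1)[OF group]])
lemma mul_0_left [simp]: "mul 0 x = x" using group by (rule group.group_left_neutral)
lemma mul_ginv_left: "mul (ginv x) x = 0" using group by (rule group.left_inverse)
lemma mul_0_right [simp]: "mul x 0 = x"
proof -
  have "mul (ginv x) (mul x 0) = mul (ginv x) x" by (metis mul_assoc mul_ginv_left mul_0_left)
  then show ?thesis using group.left_cancel[OF group] by blast
qed

lemma smooth_mul: "smooth_on UNIV (\<lambda>(x, y). mul x y)"
  using H by (simp add: H_type_group_def homogeneous_lie_group_def)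

lemma mul_has_derivative:
  "(mul x has_derivative (\<lambda>h. frechet_derivative (\<lambda>(x, y). mul x y) (at (x, y)) (0, h))) (at y)"
proof -
  have "((\<lambda>(x, y). mul x y) has_derivative frechet_derivative (\<lambda>(x, y). mul x y) (at (x, y))) (at (x, y))"
    using smooth_on_imp_differentiable[OF smooth_mul] by (simp add: frechet_derivative_works)
  from has_derivative_compose[OF has_derivative_Pair[OF has_derivative_const has_derivative_ident] this]
  show ?thesis by simp
qed

lemma mul_differentiable: "mul x differentiable (at y)"
  using mul_has_derivative by (rule differentiableI)

lemma invariant_field_mul: "W \<in> lie \<Longrightarrow> frechet_derivative (mul x) (at y) (W y) = W (mul x y)"
  unfolding left_invariant_fields_def by blast

lemma invariant_field_value: "W \<in> lie \<Longrightarrow> W x = frechet_derivative (mul x) (at 0) (W 0)"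
  using invariant_field_mul[of W x 0] by simp

lemma invariant_field_eqI: "W \<in> lie \<Longrightarrow> W' \<in> lie \<Longrightarrow> W 0 = W' 0 \<Longrightarrow> W = W'"
  by (rule ext) (metis invariant_field_value)

text \<open>Left translation of a tangent vector at the origin; the smoothness of the group law makes the field
  smooth, and the chain rule applied to associativity makes it invariant.\<close>

lemma invariant_field_exists:
  obtains W where "W \<in> lie" "W 0 = w"
proof
  let ?W = "\<lambda>x. frechet_derivative (mul x) (at 0) w"
  have "smooth_on UNIV (\<lambda>p. frechet_derivative (\<lambda>(x, y). mul x y) (at p) (0, w))"
    by (rule smooth_on_frechet_derivative[OF smooth_mul])
  moreover have "bounded_linear (\<lambda>x :: ('m, 'n) pt. (x, 0 :: ('m, 'n) pt))"
    by (intro bounded_linear_Pair bounded_linear_ident bounded_linear_zero)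
  ultimately have "smooth_on UNIV (\<lambda>x. frechet_derivative (\<lambda>(x, y). mul x y) (at (x, 0)) (0, w))"
    unfolding smooth_on_def using Ck_on_UNIV_compose_linear by blast
  then have smooth: "smooth_on UNIV ?W"
    unfolding frechet_derivative_at[OF mul_has_derivative, symmetric] .
  have D: "(mul x has_derivative frechet_derivative (mul x) (at y)) (at y)" for x y
    using mul_differentiable by (simp add: frechet_derivative_works)
  have inv: "frechet_derivative (mul x) (at y) (?W y) = ?W (mul x y)" for x y
  proof -
    have "(mul x has_derivative frechet_derivative (mul x) (at y)) (at (mul y 0))" using D by simp
    from has_derivative_compose[OF D this]
    have "((\<lambda>z. mul x (mul y z)) has_derivative (\<lambda>h. frechet_derivative (mul x) (at y) (frechet_derivative (mul y) (at 0) h))) (at 0)" .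
    then have "(mul (mul x y) has_derivative (\<lambda>h. frechet_derivative (mul x) (at y) (frechet_derivative (mul y) (at 0) h))) (at 0)"
      by (simp add: mul_assoc[symmetric])
    from frechet_derivative_at[OF this] show ?thesis by (rule fun_cong)
  qed
  show "?W \<in> lie" unfolding left_invariant_fields_def using smooth inv by blast
  have "mul 0 = (\<lambda>x. x)" by (rule ext) simp
  then have "(mul 0 has_derivative (\<lambda>h. h)) (at 0)" by (simp add: has_derivative_ident)
  from frechet_derivative_at[OF this] show "?W 0 = w" by (metis)
qed

lemma algebra: "H_type_algebra lie vf_bracket ip" using H by (simp add: H_type_group_def)
lemma lie_algebra: "lie_algebra_on lie vf_bracket" using algebra by (simp add: H_type_algebra_def)
lemma ip: "inner_product_on lie ip" using algebra by (simp add: H_type_algebra_def)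
lemma subspace_lie: "subspace lie" using lie_algebra by (simp add: lie_algebra_on_def)

lemma ip_sym: "V \<in> lie \<Longrightarrow> W \<in> lie \<Longrightarrow> ip V W = ip W V"
  using ip by (simp add: inner_product_on_def)
lemma ip_pos: "V \<in> lie \<Longrightarrow> V \<noteq> 0 \<Longrightarrow> 0 < ip V V"
  using ip by (simp add: inner_product_on_def)
lemma ip_lin: "V \<in> lie \<Longrightarrow> V' \<in> lie \<Longrightarrow> W \<in> lie \<Longrightarrow> ip (a *\<^sub>R V + b *\<^sub>R V') W = a * ip V W + b * ip V' W"
  using ip by (simp add: inner_product_on_def)
lemma ip_diff: "V \<in> lie \<Longrightarrow> V' \<in> lie \<Longrightarrow> W \<in> lie \<Longrightarrow> ip (V - V') W = ip V W - ip V' W"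
  using ip_lin[of V V' W 1 "-1"] by simp

lemma ver_lie: "Z \<in> ver \<Longrightarrow> Z \<in> lie" by (simp add: vertical_layer_def lie_center_def)
lemma hor_lie: "V \<in> hor \<Longrightarrow> V \<in> lie" by (simp add: horizontal_layer_def center_perp_def)

lemma hor_span: "hor = span (range X)" using onb by (simp add: horizontal_orthonormal_basis_def)
lemma X_hor: "X i \<in> hor" unfolding hor_span by (intro span_base) simp
lemma X_ip: "ip (X i) (X j) = (if i = j then 1 else 0)"
  using onb by (simp add: horizontal_orthonormal_basis_def)

lemma subspace_ver: "subspace ver"
proof -
  have lin: "vf_bracket (a *\<^sub>R V + b *\<^sub>R V') W = a *\<^sub>R vf_bracket V W + b *\<^sub>R vf_bracket V' W"
    if "V \<in> lie" "V' \<in> lie" "W \<in> lie" for a b V V' W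
  proof -
    have "\<forall>X\<in>lie. \<forall>Y\<in>lie. \<forall>W\<in>lie. \<forall>a b. vf_bracket (a *\<^sub>R X + b *\<^sub>R Y) W = a *\<^sub>R vf_bracket X W + b *\<^sub>R vf_bracket Y W"
      using lie_algebra unfolding lie_algebra_on_def by (elim conjE)
    then show ?thesis using that by simp
  qed
  show ?thesis
  proof (rule subspaceI)
    show "0 \<in> ver"
      using lin[OF subspace_0[OF subspace_lie] subspace_0[OF subspace_lie], of _ 0 0] subspace_0[OF subspace_lie]
      by (simp add: vertical_layer_def lie_center_def)
    show "V + V' \<in> ver" if "V \<in> ver" "V' \<in> ver" for V V'
      using lin[of V V' _ 1 1] that subspace_add[OF subspace_lie]
      by (simp add: vertical_layer_def lie_center_def)
    show "a *\<^sub>R V \<in> ver" if "V \<in> ver" for a V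
      using lin[of V V _ a 0] that subspace_scale[OF subspace_lie]
      by (simp add: vertical_layer_def lie_center_def)
  qed
qed

lemma ver_basis:
  obtains E where "finite E" "E \<subseteq> ver" "span E = ver" "\<And>Z Z'. Z \<in> E \<Longrightarrow> Z' \<in> E \<Longrightarrow> ip Z Z' = (if Z = Z' then 1 else 0)"
proof -
  have "\<exists>G. finite G \<and> span G = lie" using lie_algebra unfolding lie_algebra_on_def by (elim conjE)
  then obtain G where G: "finite G" "span G = lie" by blast
  obtain B where B: "B \<subseteq> ver" "independent B" "ver \<subseteq> span B" by (rule basis_exists[of ver]) blast
  have "B \<subseteq> span G" using B(1) ver_lie G(2) by auto
  then have "finite B" using independent_span_bound[OF G(1) B(2)] by blast
  moreover have "B \<subseteq> lie" using B(1) ver_lie by blast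
  ultimately have "\<exists>E. finite E \<and> E \<subseteq> lie \<and> span E = span B \<and> (\<forall>a\<in>E. \<forall>b\<in>E. ip a b = (if a = b then 1 else 0))"
    by (rule orthonormal_spanning_set[OF ip subspace_lie])
  then obtain E where E: "finite E" "E \<subseteq> lie" "span E = span B"
    "\<forall>a\<in>E. \<forall>b\<in>E. ip a b = (if a = b then 1 else 0)"
    by (elim exE conjE)
  have "span B = ver" using B(3) span_minimal[OF B(1) subspace_ver] by (rule subset_antisym[rotated])
  then have "span E = ver" using E(3) by simp
  then show ?thesis using that[OF E(1)] E(4) span_superset[of E] by simp
qed

lemma decompose:
  assumes W: "W \<in> lie"
  obtains V Z where "V \<in> hor" "Z \<in> ver" "W = V + Z"
proof -
  obtain E where E: "finite E" "E \<subseteq> ver" "span E = ver" "\<And>Z Z'. Z \<in> E \<Longrightarrow> Z' \<in> E \<Longrightarrow> ip Z Z' = (if Z = Z' then 1 else 0)"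
    using ver_basis by blast
  define Z where "Z = (\<Sum>a\<in>E. ip W a *\<^sub>R a)"
  have Z: "Z \<in> ver" unfolding Z_def using E(2) subspace_ver by (intro subspace_sum subspace_scale) auto
  have WZ: "W - Z \<in> lie" using W ver_lie[OF Z] subspace_lie by (simp add: subspace_diff)
  have perp: "ip (W - Z) b = 0" if "b \<in> E" for b
  proof -
    have b: "b \<in> lie" using that E(2) ver_lie by blast
    have "ip Z b = (\<Sum>a\<in>E. ip W a * ip a b)"
      unfolding Z_def
      using inner_product_on_sum_left[OF ip subspace_lie E(1) _ b, of "\<lambda>a. a" "ip W"] E(2) ver_lie by blast
    also have "\<dots> = (\<Sum>a\<in>E. if a = b then ip W a else 0)"
      by (intro sum.cong refl) (simp add: E(4) that)
    also have "\<dots> = ip W b" using that E(1) by simp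
    finally show ?thesis using ip_diff[OF W ver_lie[OF Z] b] by simp
  qed
  have "ip (W - Z) Y = 0" if Y: "Y \<in> ver" for Y
  proof -
    obtain c where c: "Y = (\<Sum>a\<in>E. c a *\<^sub>R a)"
      using Y unfolding E(3)[symmetric] span_finite[OF E(1)] by auto
    have El: "a \<in> lie" if "a \<in> E" for a using that E(2) ver_lie by blast
    have "ip (W - Z) Y = ip Y (W - Z)" by (rule ip_sym[OF WZ ver_lie[OF Y]])
    also have "\<dots> = (\<Sum>a\<in>E. c a * ip a (W - Z))"
      unfolding c using inner_product_on_sum_left[OF ip subspace_lie E(1) _ WZ, where f = "\<lambda>a. a"] El by blast
    also have "\<dots> = 0" using perp ip_sym[OF WZ] El by (intro sum.neutral) auto
    finally show ?thesis .
  qed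
  then have "W - Z \<in> hor" using WZ by (simp add: horizontal_layer_def center_perp_def vertical_layer_def)
  then show ?thesis using that[of "W - Z" Z] Z by simp
qed

lemma lie_differentiable: "W \<in> lie \<Longrightarrow> W differentiable (at x)"
  by (rule smooth_on_imp_differentiable[of UNIV]) (auto simp: left_invariant_fields_def)

lemma hor_form:
  assumes "V \<in> hor"
  obtains B where "linear B" "\<And>p. V p = (fst (V 0), B (fst p))"
proof -
  have "dil_homogeneous 1 V" using H assms by (simp add: H_type_group_def)
  from dil_homogeneous_1_form[OF this lie_differentiable[OF hor_lie[OF assms]]] that show ?thesis by blast
qed

lemma ver_form: "Z \<in> ver \<Longrightarrow> Z p = (0, snd (Z 0))"
proof -
  assume Z: "Z \<in> ver"
  have "dil_homogeneous 2 Z" using H Z by (simp add: H_type_group_def)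
  moreover have "isCont Z 0"
    using lie_differentiable[OF ver_lie[OF Z]] by (rule differentiable_imp_continuous_within)
  ultimately show ?thesis by (rule dil_homogeneous_2_form)
qed

text \<open>The constant vertical fields; they turn out to be the vertical layer.\<close>

definition cf :: "real^'n \<Rightarrow> ('m, 'n) vf" where "cf c = (\<lambda>p. (0, c))"

text \<open>The two layers together exhaust the tangent space at the origin, because the Lie algebra does.  A
  field with vertical value at the origin has no horizontal part, since a horizontal field vanishing
  at the origin vanishes identically.\<close>

lemma cf_ver: "cf c \<in> ver"
proof -
  obtain W where W: "W \<in> lie" "W 0 = (0, c)" by (rule invariant_field_exists)
  obtain V Z where VZ: "V \<in> hor" "Z \<in> ver" "W = V + Z" by (rule decompose[OF W(1)])
  obtain B where B: "linear B" "\<And>p. V p = (fst (V 0), B (fst p))" by (rule hor_form[OF VZ(1)]) blast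
  have "fst (V 0) + fst (Z 0) = 0" using W(2) VZ(3) by (simp add: prod_eq_iff)
  moreover have "fst (Z 0) = 0" using ver_form[OF VZ(2), of 0] by (metis fst_conv)
  moreover have "snd (V 0) = 0" using B(2)[of 0] linear_0[OF B(1)] by (metis snd_conv fst_zero)
  ultimately have "V 0 = 0 0" by (simp add: prod_eq_iff)
  then have "V = 0" using invariant_field_eqI[OF hor_lie[OF VZ(1)] subspace_0[OF subspace_lie]] by simp
  then have "W = Z" using VZ(3) by simp
  then have "W = cf c" unfolding cf_def using ver_form[OF VZ(2)] W(2) by (metis snd_conv)
  then show ?thesis using VZ(2) \<open>W = Z\<close> by simp
qed

lemma ver_cf: "Z \<in> ver \<Longrightarrow> Z = cf (snd (Z 0))"
  unfolding cf_def by (rule ext) (rule ver_form)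

lemma cf_lin: "cf (a *\<^sub>R c + b *\<^sub>R d) = a *\<^sub>R cf c + b *\<^sub>R cf d"
  by (simp add: cf_def fun_eq_iff scaleR_fun_def)

definition e :: "'m \<Rightarrow> real^'m" where "e i = fst (X i 0)"
definition B :: "'m \<Rightarrow> real^'m \<Rightarrow> real^'n" where "B i s = snd (X i (s, 0))"

lemma X_eq: "X i p = (e i, B i (fst p))" and linear_B: "linear (B i)"
proof -
  obtain B' where B': "linear B'" "\<And>p. X i p = (fst (X i 0), B' (fst p))" by (rule hor_form[OF X_hor[of i]]) blast
  have "B i = B'" by (rule ext) (metis B_def B'(2) snd_conv fst_conv)
  then show "X i p = (e i, B i (fst p))" "linear (B i)"
    using B'(1) B'(2)[of p] by (simp_all only: e_def)
qed

text \<open>The change from coordinates with respect to the orthonormal basis to the given ones; \<open>v\<close> below is its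
  inverse.\<close>

definition em :: "real^'m \<Rightarrow> real^'m" where "em t = (\<Sum>i\<in>UNIV. t $ i *\<^sub>R e i)"

lemma linear_em: "linear em"
  unfolding em_def by (intro linearI) (simp_all add: scaleR_add_left sum.distrib scaleR_sum_right)

lemma comb_apply: "(\<Sum>i\<in>UNIV. c i *\<^sub>R X i) p = ((\<Sum>i\<in>UNIV. c i *\<^sub>R e i), (\<Sum>i\<in>UNIV. c i *\<^sub>R B i (fst p)))"
proof -
  have "(\<Sum>i\<in>I. f i) p = (\<Sum>i\<in>I. f i p)" if "finite I" for I and f :: "'m \<Rightarrow> ('m, 'n) vf"
    using that by induction (simp_all add: zero_fun_apply)
  then have "(\<Sum>i\<in>UNIV. c i *\<^sub>R X i) p = (\<Sum>i\<in>UNIV. c i *\<^sub>R X i p)" by (simp add: scaleR_fun_def)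
  also have "\<dots> = (\<Sum>i\<in>UNIV. (c i *\<^sub>R e i, c i *\<^sub>R B i (fst p)))"
    by (intro sum.cong refl) (simp only: X_eq[of _ p] scaleR_Pair)
  also have "\<dots> = ((\<Sum>i\<in>UNIV. c i *\<^sub>R e i), (\<Sum>i\<in>UNIV. c i *\<^sub>R B i (fst p)))"
    by (simp add: prod_eq_iff fst_sum snd_sum)
  finally show ?thesis .
qed

lemma comb_hor: "(\<Sum>i\<in>UNIV. c i *\<^sub>R X i) \<in> hor"
  unfolding hor_span by (intro span_sum span_scale span_base) auto

lemma ip_comb: "W \<in> lie \<Longrightarrow> ip (\<Sum>i\<in>UNIV. c i *\<^sub>R X i) W = (\<Sum>i\<in>UNIV. c i * ip (X i) W)"
  by (rule inner_product_on_sum_left[OF ip subspace_lie]) (auto intro: hor_lie X_hor)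

lemma ip_comb_comb: "ip (\<Sum>i\<in>UNIV. c i *\<^sub>R X i) (\<Sum>i\<in>UNIV. d i *\<^sub>R X i) = (\<Sum>i\<in>UNIV. c i * d i)"
proof -
  have "ip (X i) (\<Sum>i\<in>UNIV. d i *\<^sub>R X i) = d i" for i
  proof -
    have "ip (X i) (\<Sum>i\<in>UNIV. d i *\<^sub>R X i) = ip (\<Sum>i\<in>UNIV. d i *\<^sub>R X i) (X i)"
      by (intro ip_sym hor_lie X_hor comb_hor)
    also have "\<dots> = d i" by (simp add: ip_comb hor_lie X_hor X_ip if_distrib cong: if_cong)
    finally show ?thesis .
  qed
  then show ?thesis by (simp add: ip_comb hor_lie comb_hor)
qed

text \<open>An invariant field is determined by its value at the origin, so that the orthonormal fields have
  linearly independent values there.\<close>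

lemma inj_em: "inj em"
  unfolding linear_injective_0[OF linear_em]
proof (intro allI impI)
  fix t :: "real^'m" assume t: "em t = 0"
  let ?V = "\<Sum>i\<in>UNIV. t $ i *\<^sub>R X i"
  have "?V 0 = 0 0" using t unfolding comb_apply by (simp add: em_def linear_0[OF linear_B] zero_prod_def)
  then have "?V = 0" by (intro invariant_field_eqI hor_lie comb_hor subspace_0 subspace_lie)
  then have "ip ?V ?V = ip 0 0" by simp
  moreover have "ip 0 0 = 0"
    using ip_lin[of 0 0 0 0 0] subspace_0[OF subspace_lie] by simp
  ultimately have "(\<Sum>i\<in>UNIV. t $ i * t $ i) = 0" unfolding ip_comb_comb by simp
  then show "t = 0" by (simp add: sum_nonneg_eq_0_iff vec_eq_iff)
qed

definition v :: "real^'m \<Rightarrow> real^'m" where "v = inv em"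

lemma em_v: "em (v s) = s" and v_em: "v (em t) = t"
proof -
  have "surj em" by (rule linear_injective_imp_surjective[OF linear_em inj_em]) simp
  then show "em (v s) = s" by (simp add: v_def surj_f_inv_f)
  show "v (em t) = t" by (simp add: v_def inj_em)
qed

lemma linear_v: "linear v"
  by (rule linearI; rule injD[OF inj_em]; simp add: em_v linear_add[OF linear_em] linear_cmul[OF linear_em])

lemma v_e: "v (e i) = axis i 1"
proof -
  have "em (axis i 1) = e i" by (simp add: em_def axis_def if_distrib[of "\<lambda>x. x *\<^sub>R _"] cong: if_cong)
  then show ?thesis by (metis v_em)
qed

definition \<beta> :: "real^'m \<Rightarrow> real^'m \<Rightarrow> real^'n" where "\<beta> s t = (\<Sum>i\<in>UNIV. v t $ i *\<^sub>R B i s)"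

lemma bilinear_\<beta>: "bilinear \<beta>"
  unfolding bilinear_def \<beta>_def
  by (auto intro!: linearI simp: linear_add[OF linear_B] linear_cmul[OF linear_B] linear_add[OF linear_v]
      linear_cmul[OF linear_v] scaleR_add_left scaleR_add_right sum.distrib scaleR_sum_right mult.commute)

lemma X_fld: "X i p = (e i, \<beta> (fst p) (e i))"
  by (simp add: X_eq[of i p] \<beta>_def v_e axis_def if_distrib[of "\<lambda>x. x *\<^sub>R _"] cong: if_cong)

text \<open>The horizontal field with a given value at the origin.\<close>

definition vfield :: "real^'m \<Rightarrow> ('m, 'n) vf" where "vfield s = (\<Sum>i\<in>UNIV. v s $ i *\<^sub>R X i)"

lemma vfield_apply: "vfield s p = (s, \<beta> (fst p) s)"
  using em_v[of s] by (simp add: vfield_def comb_apply \<beta>_def em_def)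

lemma vfield_hor: "vfield s \<in> hor" unfolding vfield_def by (rule comb_hor)

lemma hor_vfield: "V \<in> hor \<Longrightarrow> V = vfield (fst (V 0))"
proof (rule invariant_field_eqI)
  assume V: "V \<in> hor"
  obtain B' where B': "linear B'" "\<And>p. V p = (fst (V 0), B' (fst p))" by (rule hor_form[OF V]) blast
  have "snd (V 0) = 0" using B'(2)[of 0] linear_0[OF B'(1)] by (metis snd_conv fst_zero)
  moreover have "\<beta> 0 s = 0" for s using bilinear_lzero[OF bilinear_\<beta>] .
  ultimately show "V 0 = vfield (fst (V 0)) 0" by (simp add: vfield_apply prod_eq_iff)
qed (auto intro: hor_lie vfield_hor)

lemma ip_vfield: "ip (vfield s) (vfield t) = v s \<bullet> v t"
  unfolding vfield_def ip_comb_comb by (simp add: inner_vec_def)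

text \<open>The constant fields have dimension \<open>CARD('n)\<close>, so that an orthonormal basis of the vertical layer can be
  indexed by \<open>'n\<close>.\<close>

lemma exists_vertical_coordinates:
  "\<exists>f :: 'n \<Rightarrow> ('m, 'n) vf. (\<forall>k. f k \<in> ver) \<and> (\<forall>Z\<in>ver. Z = (\<Sum>k\<in>UNIV. ip Z (f k) *\<^sub>R f k))
     \<and> (\<forall>k l. ip (f k) (f l) = (if k = l then 1 else 0))"
proof -
  obtain E where E: "finite E" "E \<subseteq> ver" "span E = ver" "\<And>Z Z'. Z \<in> E \<Longrightarrow> Z' \<in> E \<Longrightarrow> ip Z Z' = (if Z = Z' then 1 else 0)"
    using ver_basis by blast
  have El: "a \<in> lie" if "a \<in> E" for a using that E(2) ver_lie by blast
  have coef: "ip (\<Sum>a\<in>E. c a *\<^sub>R a) b = c b" if "b \<in> E" for c b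
  proof -
    have "ip (\<Sum>a\<in>E. c a *\<^sub>R a) b = (\<Sum>a\<in>E. c a * ip a b)"
      using inner_product_on_sum_left[OF ip subspace_lie E(1) _ El[OF that], where f = "\<lambda>a. a"] El by blast
    also have "\<dots> = (\<Sum>a\<in>E. if a = b then c a else 0)" by (intro sum.cong refl) (simp add: E(4) that)
    also have "\<dots> = c b" using that E(1) by simp
    finally show ?thesis .
  qed
  have indE: "independent E"
  proof (rule independent_if_scalars_zero[OF E(1)])
    fix c a assume "(\<Sum>a\<in>E. c a *\<^sub>R a) = 0" "a \<in> E"
    then show "c a = 0" using coef[of a c] ip_lin[of 0 0 a 0 0] El[of a] subspace_0[OF subspace_lie] by simp
  qed
  have lin: "linear cf" using cf_lin[of 1 _ 1] cf_lin[of _ _ 0] by (intro linearI) (simp_all)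
  have inj: "inj cf" by (auto simp: inj_def cf_def fun_eq_iff)
  let ?C = "cf ` (Basis :: (real^'n) set)"
  have spanC: "span ?C = ver"
  proof -
    have "span ?C = range cf" using linear_span_image[OF lin, of Basis] by simp
    also have "\<dots> = ver" using cf_ver ver_cf by auto
    finally show ?thesis .
  qed
  have indC: "independent ?C"
    by (rule linear_independent_injective_image[OF lin independent_Basis]) (use inj in \<open>auto simp: inj_on_def\<close>)
  have cardC: "card ?C = CARD('n)" using card_image[OF inj_on_subset[OF inj]] by simp
  have "card E \<le> card ?C" using independent_span_bound[of ?C E] indE E(2) spanC by simp
  moreover have "card ?C \<le> card E" using independent_span_bound[of E ?C] indC E(1,3) spanC span_superset[of ?C] by simp
  ultimately have "card (UNIV :: 'n set) = card E" using cardC by simp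
  then obtain f where f: "bij_betw f (UNIV :: 'n set) E"
    using finite_same_card_bij[of "UNIV :: 'n set" E] E(1) by auto
  have fE: "f k \<in> E" for k using f by (auto simp: bij_betw_def)
  have fi: "f k = f l \<longleftrightarrow> k = l" for k l using f by (auto simp: bij_betw_def inj_on_def)
  have "Z = (\<Sum>k\<in>UNIV. ip Z (f k) *\<^sub>R f k)" if Z: "Z \<in> ver" for Z
  proof -
    obtain c where c: "Z = (\<Sum>a\<in>E. c a *\<^sub>R a)"
      using Z unfolding E(3)[symmetric] span_finite[OF E(1)] by auto
    have "Z = (\<Sum>a\<in>E. ip Z a *\<^sub>R a)" unfolding c by (intro sum.cong refl) (simp add: coef)
    also have "\<dots> = (\<Sum>k\<in>UNIV. ip Z (f k) *\<^sub>R f k)"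
      by (rule sum.reindex_bij_betw[OF f, symmetric])
    finally show ?thesis .
  qed
  then show ?thesis using fE fi E(2,4) by (intro exI[of _ f]) auto
qed

definition vb :: "'n \<Rightarrow> ('m, 'n) vf" where
  "vb = (SOME f. (\<forall>k. f k \<in> ver) \<and> (\<forall>Z\<in>ver. Z = (\<Sum>k\<in>UNIV. ip Z (f k) *\<^sub>R f k))
     \<and> (\<forall>k l. ip (f k) (f l) = (if k = l then 1 else 0)))"

lemma vb_ver: "vb k \<in> ver" and vb_expand: "Z \<in> ver \<Longrightarrow> Z = (\<Sum>k\<in>UNIV. ip Z (vb k) *\<^sub>R vb k)"
  using someI_ex[OF exists_vertical_coordinates] unfolding vb_def[symmetric] by blast+

definition T :: "real^'n \<Rightarrow> real^'n" where "T c = (\<chi> k. ip (cf c) (vb k))"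

lemma cf_lie: "cf c \<in> lie" by (intro ver_lie cf_ver)

lemma linear_T: "linear T"
proof (rule linearI)
  show "T (c + d) = T c + T d" for c d
    using ip_lin[OF cf_lie cf_lie ver_lie[OF vb_ver], of 1 c 1 d] cf_lin[of 1 c 1 d] by (simp add: T_def vec_eq_iff)
  show "T (a *\<^sub>R c) = a *\<^sub>R T c" for a c
    using ip_lin[OF cf_lie cf_lie ver_lie[OF vb_ver], of a c 0 c] cf_lin[of a c 0 c] by (simp add: T_def vec_eq_iff)
qed

lemma ip_cf: "ip (cf c) (cf d) = T c \<bullet> T d"
proof -
  have "ip (cf c) (cf d) = ip (\<Sum>k\<in>UNIV. T c $ k *\<^sub>R vb k) (cf d)"
    using vb_expand[OF cf_ver[of c]] by (simp add: T_def)
  also have "\<dots> = (\<Sum>k\<in>UNIV. T c $ k * ip (vb k) (cf d))"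
    by (rule inner_product_on_sum_left[OF ip subspace_lie]) (auto intro: cf_lie ver_lie vb_ver)
  also have "\<dots> = T c \<bullet> T d"
    using ip_sym[OF cf_lie ver_lie[OF vb_ver]] by (simp add: T_def inner_vec_def)
  finally show ?thesis .
qed

lemma T_inj: "T c = 0 \<Longrightarrow> c = 0"
proof -
  assume "T c = 0"
  then have "ip (cf c) (cf c) = 0" by (simp add: ip_cf)
  then have "cf c = 0" using ip_pos[OF cf_lie[of c]] by force
  then show "c = 0" by (auto simp: cf_def fun_eq_iff zero_prod_def)
qed

lemma T_surj: "\<exists>c. T c = z"
proof -
  have "inj T" using T_inj linear_injective_0[OF linear_T] by blast
  then have "surj T" by (rule linear_injective_imp_surjective[OF linear_T]) simp
  then show ?thesis by (metis surjD)
qed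

lemma bracket_vfield: "vf_bracket (vfield s) (vfield t) = cf (\<beta> s t - \<beta> t s)"
proof -
  interpret \<beta>: bounded_bilinear \<beta> using bilinear_\<beta> by (simp add: bilinear_conv_bounded_bilinear)
  have D: "(vfield t has_derivative (\<lambda>h. (0, \<beta> (fst h) t))) (at p)" for t p
  proof -
    have "vfield t = (\<lambda>p. (t, \<beta> (fst p) t))" by (rule ext) (rule vfield_apply)
    then show ?thesis
      by (auto intro!: derivative_eq_intros bounded_linear.has_derivative[OF \<beta>.bounded_linear_left])
  qed
  show ?thesis
    unfolding vf_bracket_def frechet_derivative_at[OF D, symmetric]
    by (simp add: vfield_apply cf_def)
qed

text \<open>The field \<open>U\<close> with components \<open>\<langle>z, [s, e\<^sub>i]\<rangle>\<close> represents the functional that defines \<open>J\<^sub>z\<close>, hence is the value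
  of \<open>J\<^sub>z\<close>, and the orthogonality of \<open>J\<^sub>z\<close> computes its norm.\<close>

lemma htype_unit:
  assumes z: "norm z = 1"
  shows "(\<Sum>i\<in>UNIV. (z \<bullet> T (\<beta> s (e i) - \<beta> (e i) s))\<^sup>2) = (norm (v s))\<^sup>2"
proof -
  obtain c where c: "T c = z" using T_surj by blast
  define u where "u t = z \<bullet> T (\<beta> s t - \<beta> t s)" for t
  have u_br: "ip (cf c) (vf_bracket (vfield s) (vfield t)) = u t" for t
    by (simp add: bracket_vfield ip_cf c u_def)
  have "linear u" unfolding u_def
    by (rule linearI)
      (simp_all add: bilinear_radd[OF bilinear_\<beta>] bilinear_ladd[OF bilinear_\<beta>] bilinear_rmul[OF bilinear_\<beta>]
        bilinear_lmul[OF bilinear_\<beta>] linear_add[OF linear_T] linear_cmul[OF linear_T] linear_diff[OF linear_T]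
        inner_add_right inner_diff_right algebra_simps)
  then have u_sum: "u t = (\<Sum>i\<in>UNIV. v t $ i * u (e i))" for t
  proof -
    have "u t = u (\<Sum>i\<in>UNIV. v t $ i *\<^sub>R e i)" using em_v[of t] by (simp add: em_def)
    then show ?thesis using \<open>linear u\<close> by (simp add: linear_sum linear_cmul)
  qed
  define U where "U = (\<Sum>i\<in>UNIV. u (e i) *\<^sub>R X i)"
  have U: "U \<in> hor" unfolding U_def by (rule comb_hor)
  have U_ip: "ip U W = ip (cf c) (vf_bracket (vfield s) W)" if W: "W \<in> hor" for W
  proof -
    obtain t where t: "W = vfield t" using hor_vfield[OF W] by blast
    have "ip U W = (\<Sum>i\<in>UNIV. u (e i) * v t $ i)" unfolding t U_def vfield_def by (rule ip_comb_comb)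
    also have "\<dots> = u t" unfolding u_sum[of t] by (simp add: mult.commute)
    finally show ?thesis by (simp add: t u_br)
  qed
  have "J_map lie vf_bracket ip (cf c) (vfield s) = U"
    unfolding J_map_def horizontal_layer_def[symmetric]
  proof (rule the_equality)
    show "U \<in> hor \<and> (\<forall>W\<in>hor. ip U W = ip (cf c) (vf_bracket (vfield s) W))" using U U_ip by blast
    fix U' assume U': "U' \<in> hor \<and> (\<forall>W\<in>hor. ip U' W = ip (cf c) (vf_bracket (vfield s) W))"
    have d: "U' - U \<in> hor" using U U' unfolding hor_span by (simp add: span_diff)
    have "ip (U' - U) (U' - U) = ip U' (U' - U) - ip U (U' - U)"
      using U U' d by (intro ip_diff hor_lie) auto
    also have "\<dots> = 0" using U' U_ip d by simp
    finally have "U' - U = 0" using ip_pos[OF hor_lie[OF d]] by force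
    then show "U' = U" by simp
  qed
  moreover have "ip (J_map lie vf_bracket ip (cf c) (vfield s)) (J_map lie vf_bracket ip (cf c) (vfield s)) = ip (vfield s) (vfield s)"
  proof -
    have "ip (cf c) (cf c) = 1" using z c by (simp add: ip_cf dot_square_norm)
    then show ?thesis
      using algebra cf_ver[of c] vfield_hor[of s]
      unfolding H_type_algebra_def vertical_layer_def horizontal_layer_def by blast
  qed
  ultimately have "ip U U = ip (vfield s) (vfield s)" by simp
  then show ?thesis unfolding U_def ip_comb_comb ip_vfield
    by (simp add: u_def power2_eq_square dot_square_norm[unfolded power2_eq_square])
qed

lemma htype_general:
  "(\<Sum>i\<in>UNIV. (z \<bullet> T (\<beta> s (e i) - \<beta> (e i) s))\<^sup>2) = (norm z)\<^sup>2 * (norm (v s))\<^sup>2"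
proof (cases "z = 0")
  case False
  define y where "y = z /\<^sub>R norm z"
  have y: "norm y = 1" "z = norm z *\<^sub>R y" using False by (simp_all add: y_def)
  have "(\<Sum>i\<in>UNIV. (z \<bullet> T (\<beta> s (e i) - \<beta> (e i) s))\<^sup>2)
      = (norm z)\<^sup>2 * (\<Sum>i\<in>UNIV. (y \<bullet> T (\<beta> s (e i) - \<beta> (e i) s))\<^sup>2)"
    by (subst y(2)) (simp add: power_mult_distrib sum_distrib_left)
  then show ?thesis using htype_unit[OF y(1), of s] by simp
qed simp

sublocale C: htype_coordinates \<beta> v e T
proof (rule htype_coordinates.intro)
  show "bounded_bilinear \<beta>" using bilinear_\<beta> by (simp add: bilinear_conv_bounded_bilinear)
  show "s = 0" if "v s = 0" for s using em_v[of s] that by (simp add: linear_0[OF linear_em])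
qed (auto simp: v_e linear_conv_bounded_linear[symmetric] linear_v linear_T T_inj htype_general)

end

section \<open>The exponential map, the group law and the gauge\<close>

context htype_group begin

lemma field_sum_apply: "(vfield s + cf c) p = (s, \<beta> (fst p) s + c)"
  by (simp add: vfield_apply cf_def)

lemma linear_\<beta>_left: "linear (\<lambda>x. \<beta> x s)"
  using bilinear_\<beta> by (simp add: bilinear_def)

lemma integral_curve:
  assumes "\<And>t. (\<gamma> has_vector_derivative (vfield s + cf c) (\<gamma> t)) (at t)"
  shows "\<gamma> 1 = (fst (\<gamma> 0) + s, snd (\<gamma> 0) + \<beta> (fst (\<gamma> 0)) s + (1/2) *\<^sub>R \<beta> s s + c)"
  using affine_integral_curve[OF linear_\<beta>_left[of s], of \<gamma> s c 1] assms unfolding field_sum_apply by simp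

lemma integral_curve_exists:
  obtains \<gamma> where "\<gamma> 0 = 0" "\<And>t. (\<gamma> has_vector_derivative (vfield s + cf c) (\<gamma> t)) (at t)"
    "\<gamma> 1 = (s, (1/2) *\<^sub>R \<beta> s s + c)"
proof -
  define \<gamma> where "\<gamma> t = (t *\<^sub>R s, (t\<^sup>2 / 2) *\<^sub>R \<beta> s s + t *\<^sub>R c)" for t
  have D: "(\<gamma> has_vector_derivative (vfield s + cf c) (\<gamma> t)) (at t)" for t
    unfolding field_sum_apply unfolding \<gamma>_def[abs_def] has_vector_derivative_def
    by (auto intro!: derivative_eq_intros simp: fun_eq_iff C.\<beta>.scaleR_left scaleR_add_right)
  show ?thesis by (rule that[OF _ D]) (simp_all add: \<gamma>_def zero_prod_def)
qed

lemma Exp_eq: "Exp (vfield s + cf c) = (s, (1/2) *\<^sub>R \<beta> s s + c)"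
  unfolding Exp_def
proof (rule the_equality)
  obtain \<gamma> where \<gamma>: "\<gamma> 0 = 0" "\<And>t. (\<gamma> has_vector_derivative (vfield s + cf c) (\<gamma> t)) (at t)"
    "\<gamma> 1 = (s, (1/2) *\<^sub>R \<beta> s s + c)" by (rule integral_curve_exists) blast
  then show "\<exists>\<gamma>. \<gamma> 0 = 0 \<and> (\<forall>t. (\<gamma> has_vector_derivative (vfield s + cf c) (\<gamma> t)) (at t)) \<and> \<gamma> 1 = (s, (1/2) *\<^sub>R \<beta> s s + c)"
    by blast
  fix p assume "\<exists>\<gamma>. \<gamma> 0 = 0 \<and> (\<forall>t. (\<gamma> has_vector_derivative (vfield s + cf c) (\<gamma> t)) (at t)) \<and> \<gamma> 1 = p"
  then obtain \<gamma> where "\<gamma> 0 = 0" "\<And>t. (\<gamma> has_vector_derivative (vfield s + cf c) (\<gamma> t)) (at t)" "\<gamma> 1 = p" by blast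
  then show "p = (s, (1/2) *\<^sub>R \<beta> s s + c)" using integral_curve[of \<gamma> s c] by (simp add: C.\<beta>.zero_left)
qed

text \<open>Left translation maps integral curves of an invariant field to integral curves.  Translating the curve
  from the origin to \<open>y\<close> and comparing with the explicit solution starting in \<open>x\<close> gives the product.\<close>

lemma mul_eq: "mul x y = C.gmul x y"
proof -
  define s where "s = fst y"
  define c where "c = snd y - (1/2) *\<^sub>R \<beta> s s"
  let ?W = "vfield s + cf c"
  obtain \<gamma> where \<gamma>: "\<gamma> 0 = 0" "\<And>t. (\<gamma> has_vector_derivative ?W (\<gamma> t)) (at t)"
    "\<gamma> 1 = (s, (1/2) *\<^sub>R \<beta> s s + c)" by (rule integral_curve_exists) blast
  have y: "\<gamma> 1 = y" by (simp add: \<gamma>(3) c_def s_def)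
  have W: "?W \<in> lie" by (intro subspace_add subspace_lie hor_lie vfield_hor cf_lie)
  have "((\<lambda>t. mul x (\<gamma> t)) has_vector_derivative ?W (mul x (\<gamma> t))) (at t)" for t
  proof -
    have D: "(mul x has_derivative frechet_derivative (mul x) (at (\<gamma> t))) (at (\<gamma> t))"
      using mul_differentiable by (simp add: frechet_derivative_works)
    have "((\<lambda>t. mul x (\<gamma> t)) has_derivative (\<lambda>h. frechet_derivative (mul x) (at (\<gamma> t)) (h *\<^sub>R ?W (\<gamma> t)))) (at t)"
      by (rule has_derivative_compose[OF \<gamma>(2)[unfolded has_vector_derivative_def] D])
    also have "(\<lambda>h. frechet_derivative (mul x) (at (\<gamma> t)) (h *\<^sub>R ?W (\<gamma> t))) = (\<lambda>h. h *\<^sub>R ?W (mul x (\<gamma> t)))"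
      by (simp only: linear_cmul[OF has_derivative_linear[OF D]] invariant_field_mul[OF W])
    finally show ?thesis by (simp only: has_vector_derivative_def)
  qed
  from integral_curve[OF this] show ?thesis
    by (simp add: y \<gamma>(1) C.gmul_def s_def c_def prod_eq_iff)
qed

lemma ginv_eq: "ginv x = C.ginv x"
proof -
  have "C.gmul x (C.ginv x) = 0"
    by (simp add: C.gmul_def C.ginv_def C.\<beta>.minus_right zero_prod_def)
  then have "mul x (C.ginv x) = 0" by (simp add: mul_eq)
  then have "mul (ginv x) (mul x (C.ginv x)) = ginv x" by simp
  then show ?thesis using mul_assoc[of "ginv x" x "C.ginv x"] mul_ginv_left[of x] by simp
qed

lemma Exp_parts:
  assumes V: "V \<in> hor" and Z: "Z \<in> ver" and x: "x = Exp (V + Z)"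
  shows "V = vfield (fst x)" "Z = cf (snd x - (1/2) *\<^sub>R \<beta> (fst x) (fst x))"
proof -
  obtain s where s: "V = vfield s" using hor_vfield[OF V] by blast
  obtain c where c: "Z = cf c" using ver_cf[OF Z] by blast
  have "x = (s, (1/2) *\<^sub>R \<beta> s s + c)" using x by (simp add: s c Exp_eq)
  then show "V = vfield (fst x)" "Z = cf (snd x - (1/2) *\<^sub>R \<beta> (fst x) (fst x))" by (simp_all add: s c)
qed

lemma Exp_of_parts: "x = Exp (vfield (fst x) + cf (snd x - (1/2) *\<^sub>R \<beta> (fst x) (fst x)))"
  by (simp add: Exp_eq)

lemma v_part_eq: "v_part mul ip x = vfield (fst x)"
  unfolding v_part_def
  by (rule the_equality) (use Exp_of_parts vfield_hor cf_ver Exp_parts in blast)+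

lemma z_part_eq: "z_part mul ip x = cf (snd x - (1/2) *\<^sub>R \<beta> (fst x) (fst x))"
  unfolding z_part_def
  by (rule the_equality) (use Exp_of_parts vfield_hor cf_ver Exp_parts in blast)+

lemma gauge_eq: "gauge mul ip x = C.hnorm x"
  unfolding gauge_def v_part_eq z_part_eq ip_vfield ip_cf C.hnorm_def C.rho_def C.zc_def
  by (simp add: norm_eq_sqrt_inner)

lemma gball_eq: "gball mul ginv ip x0 R = {x. C.gdist x0 x < R}"
  by (simp add: gball_def gauge_eq mul_eq ginv_eq C.gdist_def)

lemma X_eq_fld: "X = C.fld"
  by (intro ext) (simp add: X_fld C.fld_def)

end

section \<open>The critical density property\<close>

theorem theorem2p4:
  fixes mul :: "('m::finite, 'n::finite) pt \<Rightarrow> ('m, 'n) pt \<Rightarrow> ('m, 'n) pt"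
    and ginv :: "('m, 'n) pt \<Rightarrow> ('m, 'n) pt"
    and ip :: "('m, 'n) vf \<Rightarrow> ('m, 'n) vf \<Rightarrow> real"
    and X :: "'m \<Rightarrow> ('m, 'n) vf"
    and \<Omega> :: "('m, 'n) pt set"
    and lam Lam \<delta> :: real
  assumes "H_type_group mul ginv ip"
    and "horizontal_orthonormal_basis mul ip X"
    and "open \<Omega>"
    and "0 < lam" and "lam \<le> Lam"
    and "0 < \<delta>" and "\<delta> \<le> 2"
  shows "\<exists>\<epsilon> c::real. 0 < \<epsilon> \<and> \<epsilon> < 1 \<and> 0 < c \<and>
    (\<forall>A :: ('m, 'n) pt \<Rightarrow> real ^ 'm ^ 'm.
      (\<forall>i j. smooth_on \<Omega> (\<lambda>x. A x $ i $ j)) \<longrightarrow>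
      (\<forall>x\<in>\<Omega>. A x \<in> M_class lam Lam) \<longrightarrow>
      landis_condition \<delta> \<Omega> A \<longrightarrow>
      (\<forall>x0 R. 0 < R \<longrightarrow> gball mul ginv ip x0 (2 * R) \<subseteq> \<Omega> \<longrightarrow>
        (\<forall>u \<in> K_class_at X \<Omega> A (gball mul ginv ip x0 (2 * R)).
          measure lebesgue {x \<in> gball mul ginv ip x0 R. 1 \<le> u x}
            \<ge> \<epsilon> * measure lebesgue (gball mul ginv ip x0 R) \<longrightarrow>
          (INF x \<in> gball mul ginv ip x0 (R / 2). u x) \<ge> c)))"
proof -
  interpret htype_group mul ginv ip X using assms(1,2) by unfold_locales
  have dim: "1 \<le> real CARD('m)" "1 \<le> real CARD('n)" by (simp_all add: Suc_leI)
  then have \<delta>: "\<delta> < C.homogeneous_dim" using \<open>\<delta> \<le> 2\<close> unfolding C.homogeneous_dim_def by linarith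
  define \<epsilon> :: real where "\<epsilon> = 1 - (1/4) powr C.homogeneous_dim / 2"
  have "(1/4::real) powr C.homogeneous_dim \<le> 1" using \<delta> \<open>0 < \<delta>\<close> by (intro powr_le1) auto
  then have \<epsilon>: "0 < \<epsilon>" "\<epsilon> < 1" by (auto simp: \<epsilon>_def)
  have "3 powr - (C.homogeneous_dim - \<delta>) < (1::real)" "2 powr - \<delta> < (1::real)"
    using \<delta> \<open>0 < \<delta>\<close> by (auto simp: powr_less_one)
  then have c: "0 < C.growth_const \<delta>" by (simp add: C.growth_const_def)
  show ?thesis
  proof (rule exI[of _ \<epsilon>], rule exI[of _ "C.growth_const \<delta>"], intro conjI allI impI ballI \<epsilon> c)
    fix A :: "('m, 'n) pt \<Rightarrow> real ^ 'm ^ 'm" and x0 R u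
    assume A: "\<forall>x\<in>\<Omega>. A x \<in> M_class lam Lam" "landis_condition \<delta> \<Omega> A" and R: "0 < R"
      and u: "u \<in> K_class_at X \<Omega> A (gball mul ginv ip x0 (2 * R))"
      and dens: "\<epsilon> * measure lebesgue (gball mul ginv ip x0 R) \<le> measure lebesgue {x \<in> gball mul ginv ip x0 R. 1 \<le> u x}"
    obtain V where V: "open V" "V \<subseteq> \<Omega>" "Ck_on 2 V u" "\<forall>x\<in>V. 0 \<le> u x" "\<forall>x\<in>V. L_op C.fld A u x \<le> 0"
      "{x. C.gdist x0 x < 2 * R} \<subseteq> V"
      using u by (auto simp: K_class_at_def K_class_def gball_eq X_eq_fld[symmetric])
    show "C.growth_const \<delta> \<le> (INF x \<in> gball mul ginv ip x0 (R / 2). u x)"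
    proof (rule cINF_greatest)
      have "C.gdist x0 x0 = 0" by (simp only: C.gdist_eq_0_iff)
      then have "x0 \<in> gball mul ginv ip x0 (R / 2)" using R by (simp add: gball_eq)
      then show "gball mul ginv ip x0 (R / 2) \<noteq> {}" by blast
      fix p assume "p \<in> gball mul ginv ip x0 (R / 2)"
      then have p: "C.gdist x0 p < R / 2" by (simp add: gball_eq)
      show "C.growth_const \<delta> \<le> u p"
      proof (rule C.supersolution_lower_bound[OF \<open>0 < lam\<close> \<open>0 < \<delta>\<close> \<delta> _ A(2) R V(1,2,6) V(3) _ _ _ p])
        show "(1 - (1/4) powr C.homogeneous_dim / 2) * measure lebesgue {x. C.gdist x0 x < R}
          \<le> measure lebesgue {x \<in> {x. C.gdist x0 x < R}. 1 \<le> u x}"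
          using dens by (simp only: gball_eq \<epsilon>_def)
      qed (use A(1) V(4,5) in auto)
    qed
  qed
qed

end
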